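(* Let $\mathbb{K}$ be $\mathbb{R}$ or $\mathbb{C}$ and let $\varphi\in\mathcal{L}_{bi}$. Then $Z(\varphi)$ is $\Phi$-stable. More precisely, every normalized basic sequence $(w_n)$ in $Z(\varphi)$ has a subsequence equivalent to the canonical basis of either $\ell_2$ or $\ell_\Phi$. In particular, if $w_n=(u_n,v_n)$ and $\inf_n\|v_n\|_2>0$, then $(w_n)$ has a subsequence equivalent to the canonical basis of $\ell_\Phi$.
   Context: $\mathcal{L}_{bi}$ is the class of bi-Lipschitz maps $\varphi:[0,\infty)\to\mathbb{K}$ (there are $a,b>0$ with $b|s-t|\le|\varphi(s)-\varphi(t)|\le a|s-t|$ for all $s,t$) with $\varphi(0)=0$ and $\varphi(t)\to\infty$ as $t\to\infty$ (in the sense $|\varphi(t)|\to\infty$ when $\mathbb{K}=\mathbb{C}$). Let $c_{00}$ be the space of finitely supported scalar sequences and $(e_n)$ the canonical basis of $\ell_2$. For a Lipschitz map $\varphi:[0,\infty)\to\mathbb{K}$ with $\varphi(0)=0$ define $\Omega_\varphi:c_{00}\to\ell_2$ by $\Omega_\varphi(x)=\sum_n x_n\,\varphi\left(-\log\frac{|x_n|}{\|x\|_2}\right)e_n$ (terms with $x_n=0$ are $0$, and $\Omega_\varphi(0)=0$). Then $\|(y,x)\|_\varphi=\|y-\Omega_\varphi(x)\|_2+\|x\|_2$ is a quasi-norm on $\ell_2\times c_{00}$, and $Z(\varphi)$ is the completion of $(\ell_2\times c_{00},\|\cdot\|_\varphi)$ (it is isomorphic to a Banach space). The elements of $Z(\varphi)$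 are written as pairs of sequences $(u,v)$, where $v\in\ell_2$ is the image under the quotient map $q:Z(\varphi)\to\ell_2$ extending $(y,x)\mapsto x$. $\ell_\Phi$ is the Orlicz sequence space of a convex (Orlicz) function $\Phi$ equivalent to $t^2\log^2t$ near $0$. A space is $\Phi$-stable if every normalized basic sequence in it has a subsequence equivalent to the canonical basis of either $\ell_2$ or $\ell_\Phi$. *)

theory Defs
  imports "HOL-Analysis.Analysis" "HOL-Library.Function_Algebras" "HOL-Library.Landau_Symbols"
begin

section \<open>Bi-Lipschitz maps\<close>

text \<open>Maps on \<open>[0,\<infinity>)\<close> are total functions whose values at negative arguments are never used.\<close>

definition bi_lipschitz_half_line :: "(real \<Rightarrow> 'k::real_normed_field) \<Rightarrow> bool" where
  "bi_lipschitz_half_line \<phi> \<longleftrightarrow>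
     (\<exists>a>0. \<exists>b>0. \<forall>s\<ge>0. \<forall>t\<ge>0.
        b * \<bar>s - t\<bar> \<le> norm (\<phi> s - \<phi> t) \<and> norm (\<phi> s - \<phi> t) \<le> a * \<bar>s - t\<bar>)"

definition Lbi_real :: "(real \<Rightarrow> real) set" where
  "Lbi_real = {\<phi>. bi_lipschitz_half_line \<phi> \<and> \<phi> 0 = 0 \<and> filterlim \<phi> at_top at_top}"

definition Lbi_complex :: "(real \<Rightarrow> complex) set" where
  "Lbi_complex = {\<phi>. bi_lipschitz_half_line \<phi> \<and> \<phi> 0 = 0 \<and> filterlim \<phi> at_infinity at_top}"

section \<open>Sequence spaces\<close>

definition c00 :: "(nat \<Rightarrow> 'k::real_normed_field) set" where
  "c00 = {x. finite {n. x n \<noteq> 0}}"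

definition ell2 :: "(nat \<Rightarrow> 'k::real_normed_field) set" where
  "ell2 = {x. summable (\<lambda>n. (norm (x n))\<^sup>2)}"

definition ell2_norm :: "(nat \<Rightarrow> 'k::real_normed_field) \<Rightarrow> real" where
  "ell2_norm x = sqrt (\<Sum>n. (norm (x n))\<^sup>2)"

definition seq_scale :: "'k::real_normed_field \<Rightarrow> (nat \<Rightarrow> 'k) \<Rightarrow> (nat \<Rightarrow> 'k)" where
  "seq_scale c x = (\<lambda>n. c * x n)"

definition unit_seq :: "nat \<Rightarrow> (nat \<Rightarrow> 'k::real_normed_field)" where
  "unit_seq n = (\<lambda>m. if m = n then 1 else 0)"

definition orlicz_function :: "(real \<Rightarrow> real) \<Rightarrow> bool" where
  "orlicz_function \<Phi> \<longleftrightarrow>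
     convex_on {0..} \<Phi> \<and> continuous_on {0..} \<Phi> \<and> mono_on {0..} \<Phi> \<and>
     \<Phi> 0 = 0 \<and> filterlim \<Phi> at_top at_top"

text \<open>The Luxemburg norm of the Orlicz sequence space; it is only meaningful for sequences
  \<open>x\<close> that belong to that space, in particular for finitely supported ones.\<close>

definition orlicz_norm :: "(real \<Rightarrow> real) \<Rightarrow> (nat \<Rightarrow> 'k::real_normed_field) \<Rightarrow> real" where
  "orlicz_norm \<Phi> x =
     Inf {\<rho>. \<rho> > 0 \<and> summable (\<lambda>n. \<Phi> (norm (x n) / \<rho>)) \<and> (\<Sum>n. \<Phi> (norm (x n) / \<rho>)) \<le> 1}"

section \<open>Quasi-normed spaces and basic sequences\<close>

text \<open>A quasi-normed space is given by a scalar multiplication \<open>s\<close> on an ambient type, a linear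
  subspace \<open>E\<close> and a quasi-norm \<open>N\<close>, of which only the values on \<open>E\<close> matter.\<close>

definition quasi_normed_space ::
  "('k::real_normed_field \<Rightarrow> 'z::ab_group_add \<Rightarrow> 'z) \<Rightarrow> 'z set \<Rightarrow> ('z \<Rightarrow> real) \<Rightarrow> bool" where
  "quasi_normed_space s E N \<longleftrightarrow>
     vector_space s \<and> module.subspace s E \<and>
     (\<forall>x\<in>E. 0 \<le> N x \<and> (N x = 0 \<longleftrightarrow> x = 0)) \<and>
     (\<forall>c. \<forall>x\<in>E. N (s c x) = norm c * N x) \<and>
     (\<exists>C. \<forall>x\<in>E. \<forall>y\<in>E. N (x + y) \<le> C * (N x + N y))"

definition quasi_norm_complete :: "'z::ab_group_add set \<Rightarrow> ('z \<Rightarrow> real) \<Rightarrow> bool" where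
  "quasi_norm_complete E N \<longleftrightarrow>
     (\<forall>X. range X \<subseteq> E \<and> (\<forall>e>0. \<exists>M. \<forall>m\<ge>M. \<forall>n\<ge>M. N (X m - X n) < e)
        \<longrightarrow> (\<exists>x\<in>E. (\<lambda>n. N (X n - x)) \<longlonglongrightarrow> 0))"

definition closed_span ::
  "('k::real_normed_field \<Rightarrow> 'z::ab_group_add \<Rightarrow> 'z) \<Rightarrow> 'z set \<Rightarrow> ('z \<Rightarrow> real) \<Rightarrow> 'z set \<Rightarrow> 'z set" where
  "closed_span s E N S = {x\<in>E. \<forall>e>0. \<exists>z\<in>module.span s S. N (x - z) < e}"

text \<open>A basic sequence is a Schauder basis of its closed linear span.\<close>

definition basic_sequence ::
  "('k::real_normed_field \<Rightarrow> 'z::ab_group_add \<Rightarrow> 'z) \<Rightarrow> 'z set \<Rightarrow> ('z \<Rightarrow> real) \<Rightarrow> (nat \<Rightarrow> 'z) \<Rightarrow> bool" where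
  "basic_sequence s E N w \<longleftrightarrow>
     range w \<subseteq> E \<and>
     (\<forall>x\<in>closed_span s E N (range w).
        \<exists>!a. (\<lambda>m. N (x - (\<Sum>n<m. s (a n) (w n)))) \<longlonglongrightarrow> 0)"

definition normalized_basic_sequence ::
  "('k::real_normed_field \<Rightarrow> 'z::ab_group_add \<Rightarrow> 'z) \<Rightarrow> 'z set \<Rightarrow> ('z \<Rightarrow> real) \<Rightarrow> (nat \<Rightarrow> 'z) \<Rightarrow> bool" where
  "normalized_basic_sequence s E N w \<longleftrightarrow> basic_sequence s E N w \<and> (\<forall>n. N (w n) = 1)"

text \<open>Equivalence of two sequences in quasi-normed spaces over the same field: the assignment
  \<open>x n \<mapsto> y n\<close> extends to an isomorphism of the linear spans.\<close>

definition equivalent_sequences ::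
  "('k::real_normed_field \<Rightarrow> 'z::ab_group_add \<Rightarrow> 'z) \<Rightarrow> ('z \<Rightarrow> real) \<Rightarrow> (nat \<Rightarrow> 'z) \<Rightarrow>
   ('k \<Rightarrow> 'y::ab_group_add \<Rightarrow> 'y) \<Rightarrow> ('y \<Rightarrow> real) \<Rightarrow> (nat \<Rightarrow> 'y) \<Rightarrow> bool" where
  "equivalent_sequences s N x s' N' y \<longleftrightarrow>
     (\<exists>A>0. \<exists>B>0. \<forall>a m.
        A * N' (\<Sum>n<m. s' (a n) (y n)) \<le> N (\<Sum>n<m. s (a n) (x n)) \<and>
        N (\<Sum>n<m. s (a n) (x n)) \<le> B * N' (\<Sum>n<m. s' (a n) (y n)))"

definition equivalent_to_ell2_basis ::
  "('k::real_normed_field \<Rightarrow> 'z::ab_group_add \<Rightarrow> 'z) \<Rightarrow> ('z \<Rightarrow> real) \<Rightarrow> (nat \<Rightarrow> 'z) \<Rightarrow> bool" where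
  "equivalent_to_ell2_basis s N x \<longleftrightarrow>
     equivalent_sequences s N x seq_scale ell2_norm unit_seq"

definition equivalent_to_orlicz_basis ::
  "(real \<Rightarrow> real) \<Rightarrow> ('k::real_normed_field \<Rightarrow> 'z::ab_group_add \<Rightarrow> 'z) \<Rightarrow> ('z \<Rightarrow> real) \<Rightarrow> (nat \<Rightarrow> 'z) \<Rightarrow> bool" where
  "equivalent_to_orlicz_basis \<Phi> s N x \<longleftrightarrow>
     equivalent_sequences s N x seq_scale (orlicz_norm \<Phi>) unit_seq"

definition orlicz_stable ::
  "(real \<Rightarrow> real) \<Rightarrow> ('k::real_normed_field \<Rightarrow> 'z::ab_group_add \<Rightarrow> 'z) \<Rightarrow> 'z set \<Rightarrow> ('z \<Rightarrow> real) \<Rightarrow> bool" where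
  "orlicz_stable \<Phi> s E N \<longleftrightarrow>
     (\<forall>w. normalized_basic_sequence s E N w \<longrightarrow>
        (\<exists>r. strict_mono r \<and>
           (equivalent_to_ell2_basis s N (w \<circ> r) \<or> equivalent_to_orlicz_basis \<Phi> s N (w \<circ> r))))"

section \<open>The spaces \<open>Z(\<phi>)\<close>\<close>

definition Omega :: "(real \<Rightarrow> 'k::real_normed_field) \<Rightarrow> (nat \<Rightarrow> 'k) \<Rightarrow> (nat \<Rightarrow> 'k)" where
  "Omega \<phi> x = (\<lambda>n. if x n = 0 then 0 else x n * \<phi> (- ln (norm (x n) / ell2_norm x)))"

definition phi_norm :: "(real \<Rightarrow> 'k::real_normed_field) \<Rightarrow> (nat \<Rightarrow> 'k) \<times> (nat \<Rightarrow> 'k) \<Rightarrow> real" where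
  "phi_norm \<phi> = (\<lambda>(y, x). ell2_norm (y - Omega \<phi> x) + ell2_norm x)"

definition pair_scale ::
  "'k::real_normed_field \<Rightarrow> (nat \<Rightarrow> 'k) \<times> (nat \<Rightarrow> 'k) \<Rightarrow> (nat \<Rightarrow> 'k) \<times> (nat \<Rightarrow> 'k)" where
  "pair_scale c = (\<lambda>(u, v). (seq_scale c u, seq_scale c v))"

text \<open>\<open>(E, N)\<close> is the completion of \<open>(\<ell>\<^sub>2 \<times> c\<^sub>0\<^sub>0, phi_norm \<phi>)\<close>, written as a space of pairs
  \<open>(u, v)\<close> of sequences: a complete quasi-normed space that contains \<open>\<ell>\<^sub>2 \<times> c\<^sub>0\<^sub>0\<close> as a dense
  subspace carrying the original quasi-norm. The last clause says that \<open>(u, v) \<mapsto> v\<close> is a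
  continuous (linear) map into \<open>\<ell>\<^sub>2\<close>; as it extends \<open>(y, x) \<mapsto> x\<close> and \<open>\<ell>\<^sub>2 \<times> c\<^sub>0\<^sub>0\<close> is dense,
  it is the quotient map. A completion is determined only up to isomorphism, so it is described
  by a predicate and results about it quantify over all \<open>E\<close> and \<open>N\<close>.\<close>

definition is_Z ::
  "(real \<Rightarrow> 'k::real_normed_field) \<Rightarrow> ((nat \<Rightarrow> 'k) \<times> (nat \<Rightarrow> 'k)) set \<Rightarrow>
   ((nat \<Rightarrow> 'k) \<times> (nat \<Rightarrow> 'k) \<Rightarrow> real) \<Rightarrow> bool" where
  "is_Z \<phi> E N \<longleftrightarrow>
     quasi_normed_space pair_scale E N \<and> quasi_norm_complete E N \<and>
     ell2 \<times> c00 \<subseteq> E \<and> (\<forall>z\<in>ell2 \<times> c00. N z = phi_norm \<phi> z) \<and>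
     (\<forall>z\<in>E. \<forall>e>0. \<exists>z'\<in>ell2 \<times> c00. N (z - z') < e) \<and>
     (\<exists>C. \<forall>z\<in>E. snd z \<in> ell2 \<and> ell2_norm (snd z) \<le> C * N z)"

end

theory Submission
  imports Defs "HOL-Complex_Analysis.Great_Picard" "HOL-Real_Asymp.Real_Asymp"
begin

text \<open>Let \<open>(w\<^sub>n)\<close> be bounded in \<open>Z(\<phi>)\<close>. Coordinatewise limits and a gliding hump, applied first to the
  \<open>v\<close>-coordinates and then to the remaining \<open>\<ell>\<^sub>2\<close>-part, show that a subsequence is, up to geometrically
  small errors, \<open>\<omega> + (y\<^sub>n + \<Omega>(v\<^sub>n), v\<^sub>n)\<close> with disjoint blocks \<open>y\<^sub>n\<close> and disjoint blocks \<open>v\<^sub>n\<close>.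
  For disjoint \<open>v\<^sub>n\<close> the function \<open>\<Omega>(\<Sum> a\<^sub>n v\<^sub>n) - \<Sum> a\<^sub>n \<Omega>(v\<^sub>n)\<close> can be computed exactly, and the bi-Lipschitz
  condition makes its norm comparable with \<open>\<parallel>(b\<^sub>n ln (b\<^sub>n / \<parallel>b\<parallel>))\<parallel>\<close> for \<open>b\<^sub>n = \<bar>a\<^sub>n\<bar> \<parallel>v\<^sub>n\<parallel>\<close>; together with \<open>\<parallel>b\<parallel>\<close>
  this is the norm of the Orlicz space of \<open>t\<^sup>2 ln\<^sup>2 t\<close>. So the blocks span \<open>\<ell>\<^sub>\<Phi>\<close> if the \<open>v\<^sub>n\<close> stay away from
  zero, and \<open>\<ell>\<^sub>2\<close> if they tend to zero. In both cases the Cesaro means of the blocks tend to zero, hence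
  \<open>\<omega>\<close> lies in the closed span of every tail of \<open>(w\<^sub>n)\<close>; continuity of the partial sum projections of a
  Schauder basis then forces \<open>\<omega> = 0\<close>.

  First coordinates of elements of the completion outside \<open>\<ell>\<^sub>2 \<times> c\<^sub>0\<^sub>0\<close> carry no information (they need not
  be continuous), so all computations take place in that dense subspace.\<close>


section \<open>Square-summable sequences\<close>

text \<open>Two obstacles shape the argument. First, \<open>N\<close> is only a quasi-norm:
  continuity is not assumed, and each triangle inequality costs a factor \<open>C\<close>. Hence the
  Banach space facts on bases (bounded partial sum projections, stability under small perturbations)
  are rebuilt from completeness, and errors are made to decay like \<open>q ^ n\<close> with
  \<open>q = 1/(2C)\<close>. Second, \<Omega> is not additive, so a vector of the dense subspace
  cannot simply be cut into pieces. The cut is made in the form \<open>twist y x\<close>, whose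
  quasi-norm is \<open>ell2_norm y + ell2_norm x\<close>, and the nonlinear defect is moved into
  \<open>y\<close>. The coordinatewise limit of the v-coordinates is in general not finitely
  supported, so it is lifted to a vector of \<open>E\<close> by surjectivity of the quotient map
  before it is subtracted. Cesaro means work because m blocks add up to a vector of size
  \<open>O(sqrt m * ln m)\<close>, which is \<open>o(m)\<close>. One functional,
  \<open>log_len\<close>, measures this growth, the twisted blocks and the Orlicz norm.\<close>

lemma ell2_norm_leI: "ell2_norm x \<le> B" and ell2_memI: "x \<in> ell2"
  if B: "B \<ge> 0" "\<And>m. L2_set (\<lambda>n. norm (x n)) {..<m} \<le> B"
proof -
  have le: "(\<Sum>n<m. (norm (x n))\<^sup>2) \<le> B\<^sup>2" for m
    using B(2)[of m] B(1) unfolding L2_set_def by (metis real_sqrt_le_iff real_sqrt_abs abs_of_nonneg)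
  have s: "summable (\<lambda>n. (norm (x n))\<^sup>2)"
    by (rule summableI_nonneg_bounded[where x="B\<^sup>2"]) (use le in auto)
  then show "x \<in> ell2" by (simp add: ell2_def)
  have "(\<Sum>n. (norm (x n))\<^sup>2) \<le> B\<^sup>2"
    by (rule suminf_le_const[OF s le])
  then show "ell2_norm x \<le> B"
    unfolding ell2_norm_def using B(1) real_le_lsqrt by blast
qed

lemma L2_set_le_ell2_norm: "x \<in> ell2 \<Longrightarrow> finite A \<Longrightarrow> L2_set (\<lambda>n. norm (x n)) A \<le> ell2_norm x"
  unfolding ell2_def ell2_norm_def L2_set_def by (auto intro!: sum_le_suminf)

lemma norm_le_ell2_norm: "x \<in> ell2 \<Longrightarrow> norm (x i) \<le> ell2_norm x"
  using L2_set_le_ell2_norm[of x "{i}"] by simp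

lemma ell2_norm_ge_0: "x \<in> ell2 \<Longrightarrow> 0 \<le> ell2_norm x"
  using norm_le_ell2_norm norm_ge_zero order_trans by blast

lemma
  assumes "y \<in> ell2" and le: "\<And>i. norm (x i) \<le> c * norm (y i)"
  shows ell2_mono: "x \<in> ell2" and ell2_norm_mono: "ell2_norm x \<le> \<bar>c\<bar> * ell2_norm y"
proof -
  have "L2_set (\<lambda>n. norm (x n)) {..<m} \<le> \<bar>c\<bar> * ell2_norm y" for m
  proof -
    have "norm (x i) \<le> \<bar>c\<bar> * norm (y i)" for i
      using le[of i] by (rule order_trans) (simp add: mult_right_mono)
    then have "L2_set (\<lambda>n. norm (x n)) {..<m} \<le> L2_set (\<lambda>n. \<bar>c\<bar> * norm (y n)) {..<m}"
      by (intro L2_set_mono) auto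
    also have "\<dots> = \<bar>c\<bar> * L2_set (\<lambda>n. norm (y n)) {..<m}"
      by (simp add: L2_set_right_distrib)
    also have "\<dots> \<le> \<bar>c\<bar> * ell2_norm y"
      using L2_set_le_ell2_norm[OF assms(1)] by (simp add: mult_left_mono)
    finally show ?thesis .
  qed
  moreover have "\<bar>c\<bar> * ell2_norm y \<ge> 0" using ell2_norm_ge_0[OF assms(1)] by simp
  ultimately show "x \<in> ell2" "ell2_norm x \<le> \<bar>c\<bar> * ell2_norm y"
    using ell2_norm_leI ell2_memI by blast+
qed

lemma ell2_norm_uminus: "ell2_norm (- x) = ell2_norm x"
  by (simp add: ell2_norm_def)

lemma ell2_uminus: "x \<in> ell2 \<Longrightarrow> - x \<in> ell2"
  by (simp add: ell2_def)

lemma ell2_zero: "0 \<in> ell2" and ell2_norm_zero: "ell2_norm 0 = 0"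
  by (simp_all add: ell2_def ell2_norm_def)

lemma
  assumes "x \<in> ell2" "y \<in> ell2"
  shows ell2_add: "x + y \<in> ell2" and ell2_norm_add: "ell2_norm (x + y) \<le> ell2_norm x + ell2_norm y"
proof -
  have "L2_set (\<lambda>n. norm ((x + y) n)) {..<m} \<le> ell2_norm x + ell2_norm y" for m
  proof -
    have "L2_set (\<lambda>n. norm ((x + y) n)) {..<m} \<le> L2_set (\<lambda>n. norm (x n) + norm (y n)) {..<m}"
      by (rule L2_set_mono) (auto intro: norm_triangle_ineq)
    also have "\<dots> \<le> L2_set (\<lambda>n. norm (x n)) {..<m} + L2_set (\<lambda>n. norm (y n)) {..<m}"
      by (rule L2_set_triangle_ineq)
    also have "\<dots> \<le> ell2_norm x + ell2_norm y"
      using L2_set_le_ell2_norm assms by (intro add_mono) auto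
    finally show ?thesis .
  qed
  moreover have "ell2_norm x + ell2_norm y \<ge> 0"
    using ell2_norm_ge_0[OF assms(1)] ell2_norm_ge_0[OF assms(2)] by simp
  ultimately show "x + y \<in> ell2" "ell2_norm (x + y) \<le> ell2_norm x + ell2_norm y"
    using ell2_norm_leI ell2_memI by blast+
qed

lemma ell2_diff: "x \<in> ell2 \<Longrightarrow> y \<in> ell2 \<Longrightarrow> x - y \<in> ell2"
  using ell2_add[of x "- y"] ell2_uminus[of y] by simp

lemma ell2_norm_diff: "x \<in> ell2 \<Longrightarrow> y \<in> ell2 \<Longrightarrow> ell2_norm (x - y) \<le> ell2_norm x + ell2_norm y"
  using ell2_norm_add[of x "- y"] ell2_uminus[of y] ell2_norm_uminus[of y] by simp

lemma c00_subset_ell2: "c00 \<subseteq> ell2"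
  unfolding c00_def ell2_def by (auto intro!: summable_finite[where N="{n. x n \<noteq> 0}" for x])

lemma c00_diff: "x - y \<in> c00" if "x \<in> c00" "y \<in> c00"
proof -
  have "{n. (x - y) n \<noteq> 0} \<subseteq> {n. x n \<noteq> 0} \<union> {n. y n \<noteq> 0}" by auto
  with that show ?thesis unfolding c00_def by (blast intro: finite_subset)
qed

lemma c00_subset: "y \<in> c00 \<Longrightarrow> (\<And>i. y i = 0 \<Longrightarrow> x i = 0) \<Longrightarrow> x \<in> c00"
  unfolding c00_def by (auto elim!: finite_subset[rotated])

lemma Omega_c00: "x \<in> c00 \<Longrightarrow> Omega \<phi> x \<in> c00"
  by (erule c00_subset) (simp add: Omega_def)

text \<open>Fatou's lemma for sums: the bound holds on each finite section, where only finitely many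
  coordinates pass to the limit, and finite sections determine \<open>ell2_norm\<close>.\<close>

lemma ell2_pointwise_limit:
  assumes "\<And>n. x n \<in> ell2" "\<And>n. ell2_norm (x n) \<le> R" "\<And>i. (\<lambda>n. x n i) \<longlonglongrightarrow> y i"
  shows "y \<in> ell2" "ell2_norm y \<le> R"
proof -
  have "L2_set (\<lambda>i. norm (y i)) {..<m} \<le> R" for m
  proof (rule tendsto_upperbound)
    show "(\<lambda>n. L2_set (\<lambda>i. norm (x n i)) {..<m}) \<longlonglongrightarrow> L2_set (\<lambda>i. norm (y i)) {..<m}"
      unfolding L2_set_def by (intro tendsto_intros assms)
    show "\<forall>\<^sub>F n in sequentially. L2_set (\<lambda>i. norm (x n i)) {..<m} \<le> R"
      using L2_set_le_ell2_norm[OF assms(1)] assms(2) order_trans by (blast intro: always_eventually)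
  qed simp
  moreover have "R \<ge> 0"
    using ell2_norm_ge_0[OF assms(1)[of 0]] assms(2)[of 0] by linarith
  ultimately show "y \<in> ell2" "ell2_norm y \<le> R"
    using ell2_norm_leI ell2_memI by blast+
qed

text \<open>Weak sequential compactness of balls of \<open>ell2\<close>, in coordinates: each
  coordinate is bounded by \<open>R\<close>, so a diagonal subsequence converges everywhere, and
  \<open>ell2_pointwise_limit\<close> keeps the limit in the ball.\<close>

lemma bounded_ell2_pointwise_subseq:
  fixes x :: "nat \<Rightarrow> nat \<Rightarrow> 'k::{real_normed_field,heine_borel}"
  assumes "\<And>n. x n \<in> ell2" "\<And>n. ell2_norm (x n) \<le> R"
  obtains r y where "strict_mono (r :: nat \<Rightarrow> nat)" "\<And>i. (\<lambda>n. x (r n) i) \<longlonglongrightarrow> y i"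
    "y \<in> ell2" "ell2_norm y \<le> R"
proof -
  have "norm (x n i) \<le> R" for n i
    using norm_le_ell2_norm[OF assms(1)] assms(2) order_trans by blast
  then obtain r where r: "strict_mono r" "\<And>i. \<exists>l. (\<lambda>n. x (r n) i) \<longlonglongrightarrow> l"
    using function_convergent_subsequence[of "UNIV :: nat set" x R] by (metis UNIV_I countableI_type)
  then obtain y where "\<And>i. (\<lambda>n. x (r n) i) \<longlonglongrightarrow> y i" by metis
  with r(1) show ?thesis
    using ell2_pointwise_limit[of "\<lambda>n. x (r n)" R y] assms that by blast
qed

section \<open>Disjointly supported sequences and the gliding hump\<close>

definition disjoint_seq :: "(nat \<Rightarrow> nat \<Rightarrow> 'k::zero) \<Rightarrow> bool" where
  "disjoint_seq y \<longleftrightarrow> (\<forall>m n i. y m i \<noteq> 0 \<longrightarrow> y n i \<noteq> 0 \<longrightarrow> m = n)"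

lemma disjoint_seq_comp: "disjoint_seq y \<Longrightarrow> inj r \<Longrightarrow> disjoint_seq (y \<circ> r)"
  unfolding disjoint_seq_def inj_def by (metis comp_apply)

lemma disjoint_seq_sum_eq:
  fixes y :: "nat \<Rightarrow> nat \<Rightarrow> 'k::comm_monoid_add"
  assumes "disjoint_seq y" "y k i \<noteq> 0" "k < m" "\<And>n. y n i = 0 \<Longrightarrow> f n = 0"
  shows "(\<Sum>n<m. f n) = f k"
proof -
  have "(\<Sum>n<m. f n) = (\<Sum>n\<in>{k}. f n)"
    by (rule sum.mono_neutral_right) (use assms in \<open>auto simp: disjoint_seq_def\<close>)
  then show ?thesis by simp
qed

text \<open>Pythagoras for disjoint supports: at each coordinate at most one summand survives, so
  the square of the sum is the sum of the squares, and a finite sum may be exchanged with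
  \<open>suminf\<close>.\<close>

lemma
  fixes y :: "nat \<Rightarrow> nat \<Rightarrow> 'k::real_normed_field"
  assumes dis: "disjoint_seq y" and y: "\<And>n. y n \<in> ell2"
  shows ell2_disjoint_sum: "(\<lambda>i. \<Sum>n<m. c n * y n i) \<in> ell2"
    and ell2_norm_disjoint_sum:
      "ell2_norm (\<lambda>i. \<Sum>n<m. c n * y n i) = L2_set (\<lambda>n. norm (c n) * ell2_norm (y n)) {..<m}"
proof -
  have eq: "(norm (\<Sum>n<m. c n * y n i))\<^sup>2 = (\<Sum>n<m. (norm (c n))\<^sup>2 * (norm (y n i))\<^sup>2)" for i
  proof (cases "\<exists>k<m. y k i \<noteq> 0")
    case True
    then obtain k where k: "k < m" "y k i \<noteq> 0" by blast
    have "(\<Sum>n<m. c n * y n i) = c k * y k i"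
      by (rule disjoint_seq_sum_eq[OF dis k(2,1)]) simp
    moreover have "(\<Sum>n<m. (norm (c n))\<^sup>2 * (norm (y n i))\<^sup>2) = (norm (c k))\<^sup>2 * (norm (y k i))\<^sup>2"
      by (rule disjoint_seq_sum_eq[OF dis k(2,1)]) simp
    ultimately show ?thesis by (simp add: norm_mult power_mult_distrib)
  qed simp
  have s: "summable (\<lambda>i. (norm (c n))\<^sup>2 * (norm (y n i))\<^sup>2)" for n
    using y[of n] by (intro summable_mult) (simp add: ell2_def)
  have nn: "(ell2_norm (y n))\<^sup>2 = (\<Sum>i. (norm (y n i))\<^sup>2)" for n
    unfolding ell2_norm_def using y[of n] by (intro real_sqrt_pow2 suminf_nonneg) (auto simp: ell2_def)
  show "(\<lambda>i. \<Sum>n<m. c n * y n i) \<in> ell2"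
    unfolding ell2_def using summable_sum[of "{..<m}", OF s] by (simp add: eq)
  have "(\<Sum>i. \<Sum>n<m. (norm (c n))\<^sup>2 * (norm (y n i))\<^sup>2)
      = (\<Sum>n<m. \<Sum>i. (norm (c n))\<^sup>2 * (norm (y n i))\<^sup>2)"
    by (rule suminf_sum) (rule s)
  also have "\<dots> = (\<Sum>n<m. (norm (c n))\<^sup>2 * (ell2_norm (y n))\<^sup>2)"
    using y unfolding nn by (intro sum.cong refl suminf_mult) (simp add: ell2_def)
  finally show "ell2_norm (\<lambda>i. \<Sum>n<m. c n * y n i) = L2_set (\<lambda>n. norm (c n) * ell2_norm (y n)) {..<m}"
    unfolding ell2_norm_def[of "\<lambda>i. \<Sum>n<m. c n * y n i"] L2_set_def by (simp add: eq power_mult_distrib)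
qed

definition restr :: "nat set \<Rightarrow> (nat \<Rightarrow> 'k::zero) \<Rightarrow> nat \<Rightarrow> 'k" where
  "restr A x = (\<lambda>i. if i \<in> A then x i else 0)"

lemma restr_ell2: "x \<in> ell2 \<Longrightarrow> restr A x \<in> ell2"
  by (rule ell2_mono[where c=1]) (auto simp: restr_def)

lemma restr_c00: "finite A \<Longrightarrow> restr A x \<in> c00"
  unfolding c00_def restr_def by (auto elim!: finite_subset[rotated])

lemma ell2_tail_tendsto_0:
  assumes "x \<in> ell2"
  shows "(\<lambda>k. ell2_norm (restr {k..} x)) \<longlonglongrightarrow> 0"
proof -
  let ?f = "\<lambda>n. (norm (x n))\<^sup>2"
  have s: "summable ?f" using assms by (simp add: ell2_def)
  have "(\<Sum>n. (norm (restr {k..} x n))\<^sup>2) = (\<Sum>n. ?f n) - (\<Sum>n<k. ?f n)" for k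
  proof -
    have s': "summable (\<lambda>n. (norm (restr {k..} x n))\<^sup>2)"
      using restr_ell2[OF assms] by (simp add: ell2_def)
    have "(\<Sum>n<k. (norm (restr {k..} x n))\<^sup>2) = 0"
      by (simp add: restr_def)
    with suminf_split_initial_segment[OF s', of k] suminf_split_initial_segment[OF s, of k]
    show ?thesis by (simp add: restr_def)
  qed
  then have "(\<lambda>k. ell2_norm (restr {k..} x)) = (\<lambda>k. sqrt ((\<Sum>n. ?f n) - (\<Sum>n<k. ?f n)))"
    by (simp add: ell2_norm_def)
  moreover have "\<dots> \<longlonglongrightarrow> sqrt ((\<Sum>n. ?f n) - (\<Sum>n. ?f n))"
    by (intro tendsto_intros summable_LIMSEQ s)
  ultimately show ?thesis by simp
qed

lemma ell2_head_tendsto_0: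
  assumes "\<And>i. (\<lambda>n. x n i) \<longlonglongrightarrow> 0"
  shows "(\<lambda>n. ell2_norm (restr {..<k} (x n))) \<longlonglongrightarrow> 0"
proof -
  have "ell2_norm (restr {..<k} (x n)) = L2_set (\<lambda>i. norm (x n i)) {..<k}" for n
    unfolding ell2_norm_def L2_set_def
    by (subst suminf_finite[of "{..<k}"]) (auto simp: restr_def)
  moreover have "(\<lambda>n. L2_set (\<lambda>i. norm (x n i)) {..<k}) \<longlonglongrightarrow> sqrt (\<Sum>i<k. (norm (0::'a))\<^sup>2)"
    unfolding L2_set_def by (intro tendsto_intros assms)
  ultimately show ?thesis by simp
qed

text \<open>On a fixed initial window the terms tend to zero, and each single term has a small tail.
  So a late term is small on the coordinates already used, and a further window captures all of it
  but a small tail.\<close>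

lemma gliding_hump:
  fixes x :: "nat \<Rightarrow> nat \<Rightarrow> 'k::real_normed_field"
  assumes x: "\<And>n. x n \<in> ell2" and lim: "\<And>i. (\<lambda>n. x n i) \<longlonglongrightarrow> 0" and eps: "\<And>n. \<epsilon> n > 0"
  obtains r y where "strict_mono (r :: nat \<Rightarrow> nat)" "\<And>n. y n \<in> c00" "disjoint_seq y"
    "\<And>n. ell2_norm (x (r n) - y n) \<le> \<epsilon> n"
proof -
  \<comment> \<open>A state is an index \<open>r\<close> with a window from \<open>k\<close> to
    \<open>k'\<close> (exclusive). By \<open>Q\<close> the next window starts where the previous one
    ends, which yields disjointness.\<close>
  define P where "P = (\<lambda>n (r::nat, k::nat, k'::nat). k \<le> k' \<and>
     ell2_norm (restr {..<k} (x r)) \<le> \<epsilon> n / 2 \<and> ell2_norm (restr {k'..} (x r)) \<le> \<epsilon> n / 2)"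
  define Q where "Q = (\<lambda>(n::nat) (r::nat, k::nat, k'::nat) (r', l, l'::nat). r < r' \<and> l = k')"
  have step: "\<exists>r' l'. r < r' \<and> P n (r', k, l')" for n r k
  proof -
    have "\<forall>\<^sub>F n' in sequentially. ell2_norm (restr {..<k} (x n')) < \<epsilon> n / 2"
      using order_tendstoD(2)[OF ell2_head_tendsto_0[of x, OF lim], of "\<epsilon> n / 2"] eps[of n] by simp
    then have "\<forall>\<^sub>F n' in sequentially. ell2_norm (restr {..<k} (x n')) < \<epsilon> n / 2 \<and> r < n'"
      using eventually_gt_at_top[of r] by (rule eventually_conj)
    then obtain r' where r': "ell2_norm (restr {..<k} (x r')) < \<epsilon> n / 2" "r < r'"
      using eventually_happens by fastforce
    have "\<forall>\<^sub>F l in sequentially. ell2_norm (restr {l..} (x r')) < \<epsilon> n / 2"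
      using order_tendstoD(2)[OF ell2_tail_tendsto_0[OF x], of "\<epsilon> n / 2"] eps[of n] by simp
    then have "\<forall>\<^sub>F l in sequentially. ell2_norm (restr {l..} (x r')) < \<epsilon> n / 2 \<and> k \<le> l"
      using eventually_ge_at_top[of k] by (rule eventually_conj)
    then obtain l' where "ell2_norm (restr {l'..} (x r')) < \<epsilon> n / 2" "k \<le> l'"
      using eventually_happens by fastforce
    with r' show ?thesis unfolding P_def by force
  qed
  have "\<exists>f. \<forall>n. P n (f n) \<and> Q n (f n) (f (Suc n))"
  proof (rule dependent_nat_choice)
    show "\<exists>p. P 0 p" using step by blast
    fix p :: "nat \<times> nat \<times> nat" and n
    obtain r k k' where "p = (r, k, k')" by (cases p)
    then show "\<exists>p'. P (Suc n) p' \<and> Q n p p'"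
      using step[of r "Suc n" k'] unfolding Q_def by auto
  qed
  then obtain f where f: "\<And>n. P n (f n)" "\<And>n. Q n (f n) (f (Suc n))" by blast
  define r k k' where "r = (\<lambda>n. fst (f n))" and "k = (\<lambda>n. fst (snd (f n)))" and "k' = (\<lambda>n. snd (snd (f n)))"
  have feq: "f n = (r n, k n, k' n)" for n by (simp add: r_def k_def k'_def)
  have fP: "k n \<le> k' n" "ell2_norm (restr {..<k n} (x (r n))) \<le> \<epsilon> n / 2"
    "ell2_norm (restr {k' n..} (x (r n))) \<le> \<epsilon> n / 2" and fQ: "r n < r (Suc n)" "k (Suc n) = k' n" for n
    using f[of n] unfolding feq P_def Q_def by auto
  define y where "y = (\<lambda>n. restr {k n..<k' n} (x (r n)))"
  have kmono: "k m \<le> k n" if "m \<le> n" for m n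
    by (rule lift_Suc_mono_le[OF _ that]) (metis fP(1) fQ(2))
  have ky: "k' m \<le> k n" if "m < n" for m n
    using kmono[of "Suc m" n] that fQ(2)[of m] by simp
  show ?thesis
  proof
    show "strict_mono r" using fQ(1) by (simp add: strict_mono_Suc_iff)
    show "y n \<in> c00" for n unfolding y_def by (rule restr_c00) simp
    show "disjoint_seq y"
      unfolding disjoint_seq_def
    proof (intro allI impI)
      fix m n i assume "y m i \<noteq> 0" "y n i \<noteq> 0"
      then have "k m \<le> i" "i < k' m" "k n \<le> i" "i < k' n"
        unfolding y_def restr_def by (auto split: if_splits)
      then show "m = n" using ky[of m n] ky[of n m] by (cases m n rule: linorder_cases) auto
    qed
    show "ell2_norm (x (r n) - y n) \<le> \<epsilon> n" for n
    proof -
      have "x (r n) - y n = restr {..<k n} (x (r n)) + restr {k' n..} (x (r n))"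
        unfolding y_def restr_def using fP(1)[of n] by (auto simp: fun_eq_iff)
      then show ?thesis
        using ell2_norm_add[OF restr_ell2[OF x] restr_ell2[OF x], of "{..<k n}" "r n" "{k' n..}" "r n"]
          fP(2,3)[of n] by simp
    qed
  qed
qed

section \<open>The Orlicz sequence space and the logarithmic functional\<close>

text \<open>For nonnegative \<open>b\<close> cut off at \<open>m\<close> this is the quasi-norm of
  \<open>(0, b)\<close> in the Kalton-Peck space, that is, \<open>phi_norm\<close> for
  \<open>\<phi> t = t\<close>. It is an explicit, homogeneous substitute for the implicitly defined
  Luxemburg norm.\<close>

definition log_len :: "(nat \<Rightarrow> real) \<Rightarrow> nat \<Rightarrow> real" where
  "log_len b m = L2_set b {..<m} + L2_set (\<lambda>n. b n * ln (b n / L2_set b {..<m})) {..<m}"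

lemma log_len_ge_L2: "L2_set b {..<m} \<le> log_len b m"
  by (simp add: log_len_def)

lemma log_len_nonneg: "0 \<le> log_len b m"
  using log_len_ge_L2[of b m] L2_set_nonneg order_trans by blast

lemma le_log_len: "n < m \<Longrightarrow> b n \<le> log_len b m"
  using member_le_L2_set[of "{..<m}" n b] log_len_ge_L2[of b m] by simp

lemma L2_set_mult_left: "L2_set (\<lambda>n. c * f n) A = \<bar>c\<bar> * L2_set f A"
proof -
  have "L2_set (\<lambda>n. c * f n) A = L2_set (\<lambda>n. \<bar>c\<bar> * f n) A"
    by (simp add: L2_set_def power_mult_distrib)
  then show ?thesis by (simp add: L2_set_right_distrib)
qed

lemma log_len_scale: "log_len (\<lambda>n. c * b n) m = c * log_len b m" if "c > 0"
proof -
  have L: "L2_set (\<lambda>n. c * b n) {..<m} = c * L2_set b {..<m}"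
    using that by (simp add: L2_set_mult_left)
  have "L2_set (\<lambda>n. c * b n * ln (c * b n / (c * L2_set b {..<m}))) {..<m}
      = c * L2_set (\<lambda>n. b n * ln (b n / L2_set b {..<m})) {..<m}"
    using that by (simp add: L2_set_mult_left mult.assoc)
  with L show ?thesis by (simp add: log_len_def distrib_left)
qed

text \<open>The bound is \<open>o(m)\<close>; this slow growth of a sum of m unit vectors is what
  makes the Cesaro means of the blocks vanish.\<close>

lemma log_len_const_le: "log_len (\<lambda>_. 1) m \<le> sqrt m + sqrt m * ln (sqrt m)"
proof (cases "m = 0")
  case False
  then have "\<bar>ln (1 / sqrt m)\<bar> = ln (sqrt m)" by (simp add: ln_div)
  then have "L2_set (\<lambda>_. ln (1 / sqrt m)) {..<m} = sqrt m * ln (sqrt m)"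
    by (simp only: L2_set_constant) simp
  moreover have "L2_set (\<lambda>_. 1) {..<m} = sqrt m" by (simp add: L2_set_constant)
  ultimately show ?thesis by (simp only: log_len_def mult_1)
qed (simp add: log_len_def)

text \<open>The bounds below only see that \<open>\<Phi>\<close> is nonnegative, increasing and equivalent to
  \<open>t\<^sup>2 ln\<^sup>2 t\<close> on some \<open>(0, \<delta>]\<close>. Taking \<open>\<delta> \<le> 1/e\<close> makes \<open>\<bar>ln t\<bar> \<ge> 1\<close> there.\<close>

lemma orlicz_function_log_bounds:
  assumes "orlicz_function \<Phi>" and "\<Phi> \<in> \<Theta>[at_right 0](\<lambda>t. t\<^sup>2 * (ln t)\<^sup>2)"
  obtains \<delta> c1 c2 where "0 < \<delta>" "\<delta> \<le> exp (-1)" "c1 > 0" "c2 > 0"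
    "\<And>t. 0 \<le> t \<Longrightarrow> t \<le> \<delta> \<Longrightarrow> c1 * (t * ln t)\<^sup>2 \<le> \<Phi> t \<and> \<Phi> t \<le> c2 * (t * ln t)\<^sup>2"
proof -
  have \<Phi>: "mono_on {0..} \<Phi>" "\<Phi> 0 = 0" using assms(1) by (auto simp: orlicz_function_def)
  have nonneg: "\<Phi> t \<ge> 0" if "t \<ge> 0" for t
    using mono_onD[OF \<Phi>(1), of 0 t] that \<Phi>(2) by simp
  obtain c2 where c2: "c2 > 0" "\<forall>\<^sub>F t in at_right 0. norm (\<Phi> t) \<le> c2 * norm (t\<^sup>2 * (ln t)\<^sup>2)"
    using bigthetaD1[OF assms(2)] by (rule landau_o.bigE)
  obtain c1 where c1: "c1 > 0" "\<forall>\<^sub>F t in at_right 0. norm (\<Phi> t) \<ge> c1 * norm (t\<^sup>2 * (ln t)\<^sup>2)"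
    using bigthetaD2[OF assms(2)] by (rule landau_omega.bigE)
  obtain d where d: "d > 0" "\<And>t. t > 0 \<Longrightarrow> t < d \<Longrightarrow>
      norm (\<Phi> t) \<le> c2 * norm (t\<^sup>2 * (ln t)\<^sup>2) \<and> norm (\<Phi> t) \<ge> c1 * norm (t\<^sup>2 * (ln t)\<^sup>2)"
    using eventually_conj[OF c2(2) c1(2)] unfolding eventually_at_right_field by auto
  show ?thesis
  proof
    show "c1 * (t * ln t)\<^sup>2 \<le> \<Phi> t \<and> \<Phi> t \<le> c2 * (t * ln t)\<^sup>2"
      if "0 \<le> t" "t \<le> min (d / 2) (exp (-1))" for t
    proof (cases "t = 0")
      case False
      then show ?thesis using d(2)[of t] d(1) that nonneg[of t]
        by (auto simp: abs_mult power_mult_distrib)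
    qed (simp add: \<Phi>)
  qed (use d c1 c2 in auto)
qed

text \<open>With \<open>\<rho> = K * log_len b m\<close> and \<open>x = ?L / \<rho>\<close>,
  \<open>ln (b n / \<rho>)\<close> splits into the normalized logarithm, whose contribution has L2
  norm at most \<open>1/K\<close>, and \<open>ln x\<close>, whose contribution is
  \<open>|x ln x| <= 2 sqrt x <= 2 sqrt (1/K)\<close>. Together they give at most
  \<open>3 sqrt (1/K)\<close>, so the sum of squares is at most \<open>9/K\<close>. In
  \<open>K\<close>, the summand \<open>1\<close> gives \<open>x <= 1\<close>,
  \<open>1 / \<delta>\<close> keeps all arguments in the range of \<open>bd\<close>, and
  \<open>9 * c2\<close> makes the final bound 1.\<close>

lemma orlicz_sum_le_1:
  assumes bd: "\<And>t. 0 \<le> t \<Longrightarrow> t \<le> \<delta> \<Longrightarrow> \<Phi> t \<le> c2 * (t * ln t)\<^sup>2" and "\<delta> > 0" "c2 > 0"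
    and b: "\<And>n. 0 \<le> b n" and pos: "log_len b m > 0" and K: "K = 1 + 1 / \<delta> + 9 * c2"
  shows "(\<Sum>n<m. \<Phi> (b n / (K * log_len b m))) \<le> 1"
proof -
  let ?L = "L2_set b {..<m}"
  define \<rho> x where "\<rho> = K * log_len b m" and "x = ?L / \<rho>"
  have K1: "K \<ge> 1" "K \<ge> 1 / \<delta>" "K \<ge> 9 * c2" using K assms(2,3) by auto
  have \<rho>: "\<rho> > 0" using K1 pos by (simp add: \<rho>_def)
  have L: "?L > 0"
  proof (rule ccontr)
    assume "\<not> ?L > 0"
    then have "?L = 0" using L2_set_nonneg[of b "{..<m}"] by linarith
    then have "\<forall>n<m. b n = 0" by (simp add: L2_set_eq_0_iff)
    then have "log_len b m = 0" by (simp add: log_len_def L2_set_def)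
    with pos show False by simp
  qed
  have x: "0 < x" using L \<rho> by (simp add: x_def)
  have "?L * K \<le> \<rho>" using log_len_ge_L2[of b m] K1 by (simp add: \<rho>_def mult.commute mult_left_mono)
  then have xK: "x \<le> 1 / K" using \<rho> K1 by (simp add: x_def field_simps)
  have xd: "1 / K \<le> \<delta>" using K1 assms(2) by (simp add: field_simps)
  have x1: "x \<le> 1" using xK K1 by (smt (verit) divide_le_eq_1)
  have t: "b n / \<rho> \<le> x" if "n < m" for n
    using member_le_L2_set[of "{..<m}" n b] that \<rho> by (simp add: x_def divide_right_mono)
  have "\<bar>x * ln x\<bar> \<le> 2 * sqrt x"
  proof -
    have "ln (1 / sqrt x) \<le> 1 / sqrt x" using x by (intro ln_bound) simp
    then have "- ln x \<le> 2 / sqrt x" using x by (simp add: ln_div ln_sqrt)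
    then have "x * (- ln x) \<le> x * (2 / sqrt x)" using x by (intro mult_left_mono) auto
    also have "\<dots> = 2 * sqrt x" using real_div_sqrt[of x] x by (simp add: mult.commute[of x])
    finally have "- (x * ln x) \<le> 2 * sqrt x" by simp
    moreover have "x * ln x \<le> 0" using x x1 by (simp add: mult_nonneg_nonpos)
    ultimately show ?thesis by simp
  qed
  also have "\<dots> \<le> 2 * sqrt (1 / K)" using xK by simp
  finally have xlnx: "\<bar>x * ln x\<bar> \<le> 2 * sqrt (1 / K)" .
  have eq: "b n / \<rho> * ln (b n / \<rho>) = b n * ln (b n / ?L) / \<rho> + b n * (ln x / \<rho>)" for n
  proof (cases "b n = 0")
    case False
    then have *: "b n / \<rho> = b n / ?L * x" using L \<rho> by (simp add: x_def)
    have "b n / ?L > 0" using False b[of n] L by simp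
    then have "ln (b n / \<rho>) = ln (b n / ?L) + ln x" unfolding * using x by (rule ln_mult_pos)
    then show ?thesis by (simp add: field_simps add_divide_distrib)
  qed simp
  have "L2_set (\<lambda>n. b n / \<rho> * ln (b n / \<rho>)) {..<m}
      \<le> L2_set (\<lambda>n. b n * ln (b n / ?L) / \<rho>) {..<m} + L2_set (\<lambda>n. b n * (ln x / \<rho>)) {..<m}"
    unfolding eq by (rule L2_set_triangle_ineq)
  also have "L2_set (\<lambda>n. b n * ln (b n / ?L) / \<rho>) {..<m} = L2_set (\<lambda>n. b n * ln (b n / ?L)) {..<m} / \<rho>"
    using \<rho> L2_set_mult_left[of "1 / \<rho>" "\<lambda>n. b n * ln (b n / ?L)" "{..<m}"] by simp
  also have "L2_set (\<lambda>n. b n * (ln x / \<rho>)) {..<m} = \<bar>x * ln x\<bar>"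
  proof -
    have "L2_set (\<lambda>n. b n * (ln x / \<rho>)) {..<m} = \<bar>ln x / \<rho>\<bar> * ?L"
      using L2_set_mult_left[of "ln x / \<rho>" b "{..<m}"] by (simp only: mult.commute)
    then show ?thesis using \<rho> L by (simp add: x_def abs_mult)
  qed
  also have "L2_set (\<lambda>n. b n * ln (b n / ?L)) {..<m} / \<rho> \<le> 1 / K"
  proof -
    have "L2_set (\<lambda>n. b n * ln (b n / ?L)) {..<m} \<le> log_len b m" by (simp add: log_len_def)
    then show ?thesis using pos K1 by (simp add: \<rho>_def field_simps)
  qed
  also have "1 / K \<le> sqrt (1 / K)"
    using K1 by (intro real_le_rsqrt) (simp add: power2_eq_square field_simps)
  finally have "L2_set (\<lambda>n. b n / \<rho> * ln (b n / \<rho>)) {..<m} \<le> 3 * sqrt (1 / K)" using xlnx by linarith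
  then have "(L2_set (\<lambda>n. b n / \<rho> * ln (b n / \<rho>)) {..<m})\<^sup>2 \<le> (3 * sqrt (1 / K))\<^sup>2"
    by (rule power_mono) simp
  then have sq: "(\<Sum>n<m. (b n / \<rho> * ln (b n / \<rho>))\<^sup>2) \<le> 9 / K"
    using K1 by (simp add: L2_set_def sum_nonneg power_mult_distrib)
  have "(\<Sum>n<m. \<Phi> (b n / \<rho>)) \<le> (\<Sum>n<m. c2 * (b n / \<rho> * ln (b n / \<rho>))\<^sup>2)"
    by (intro sum_mono bd) (use t xK xd b \<rho> in \<open>force+\<close>)
  also have "\<dots> = c2 * (\<Sum>n<m. (b n / \<rho> * ln (b n / \<rho>))\<^sup>2)" by (simp add: sum_distrib_left)
  also have "\<dots> \<le> c2 * (9 / K)" using sq assms(3) by (intro mult_left_mono) auto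
  also have "\<dots> \<le> 1" using K1 by (simp add: field_simps)
  finally show ?thesis by (simp add: \<rho>_def)
qed

text \<open>Each term of the sum is at most 1, so every \<open>b n / \<rho>\<close> is at most
  \<open>T\<close>, and scaling by \<open>\<delta> / T\<close> brings all entries into the range of
  \<open>bd\<close> without increasing the sum. There the sum controls the squares of
  \<open>s n * ln (s n)\<close> and, as \<open>\<delta> <= 1/e\<close>, also those of
  \<open>s n\<close>. Homogeneity of \<open>log_len\<close> undoes the scaling.\<close>

lemma log_len_le_orlicz:
  assumes bd: "\<And>t. 0 \<le> t \<Longrightarrow> t \<le> \<delta> \<Longrightarrow> c1 * (t * ln t)\<^sup>2 \<le> \<Phi> t"
    and \<delta>: "\<delta> > 0" "\<delta> \<le> exp (-1)" and "c1 > 0"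
    and mono: "mono_on {0..} \<Phi>" and "\<Phi> 0 = 0" and T: "T \<ge> \<delta>" "\<And>t. t \<ge> T \<Longrightarrow> \<Phi> t > 1"
    and b: "\<And>n. 0 \<le> b n" and "\<rho> > 0" and sum1: "(\<Sum>n<m. \<Phi> (b n / \<rho>)) \<le> 1"
  shows "log_len b m \<le> T / \<delta> * (2 * sqrt (1 / c1) + 1 / c1) * \<rho>"
proof -
  define s where "s = (\<lambda>n. \<delta> / (T * \<rho>) * b n)"
  let ?S = "L2_set s {..<m}"
  have Tpos: "T > 0" using T \<delta> by simp
  have nonneg: "\<Phi> t \<ge> 0" if "t \<ge> 0" for t
    using mono_onD[OF mono, of 0 t] that assms(6) by simp
  have s0: "s n \<ge> 0" for n using b \<delta> Tpos \<open>\<rho> > 0\<close> by (simp add: s_def)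
  have bn: "b n / \<rho> \<ge> 0" for n using b \<open>\<rho> > 0\<close> by simp
  have "\<Phi> (b n / \<rho>) \<le> 1" if "n < m" for n
  proof -
    have "\<Phi> (b n / \<rho>) \<le> (\<Sum>n<m. \<Phi> (b n / \<rho>))"
      using that nonneg bn by (intro member_le_sum) auto
    then show ?thesis using sum1 by simp
  qed
  then have bT: "b n / \<rho> \<le> T" if "n < m" for n
    using T(2)[of "b n / \<rho>"] that by force
  have sb: "s n = \<delta> / T * (b n / \<rho>)" for n by (simp add: s_def)
  have s\<delta>: "s n \<le> \<delta>" if "n < m" for n
    using mult_left_mono[OF bT[OF that], of "\<delta> / T"] \<delta> Tpos by (simp add: sb)
  have sle: "s n \<le> b n / \<rho>" for n
    unfolding sb using bn[of n] \<delta> T Tpos by (intro mult_left_le_one_le) auto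
  have "c1 * (\<Sum>n<m. (s n * ln (s n))\<^sup>2) \<le> (\<Sum>n<m. \<Phi> (b n / \<rho>))"
    unfolding sum_distrib_left
  proof (rule sum_mono)
    fix n assume "n \<in> {..<m}"
    then have "c1 * (s n * ln (s n))\<^sup>2 \<le> \<Phi> (s n)" using bd s0 s\<delta> by simp
    also have "\<dots> \<le> \<Phi> (b n / \<rho>)" using mono_onD[OF mono, of "s n"] s0 bn sle by simp
    finally show "c1 * (s n * ln (s n))\<^sup>2 \<le> \<Phi> (b n / \<rho>)" .
  qed
  then have "(\<Sum>n<m. (s n * ln (s n))\<^sup>2) \<le> 1 / c1"
    using sum1 \<open>c1 > 0\<close> by (simp add: field_simps)
  then have sln: "L2_set (\<lambda>n. s n * ln (s n)) {..<m} \<le> sqrt (1 / c1)"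
    unfolding L2_set_def by (rule real_sqrt_le_mono)
  have lns: "ln (s n) \<le> -1" if "n < m" "s n > 0" for n
  proof -
    have "s n \<le> exp (-1)" using s\<delta>[OF that(1)] \<delta> by simp
    then show ?thesis using that(2) by (metis ln_exp ln_le_cancel_iff exp_gt_zero)
  qed
  have "?S = L2_set (\<lambda>n. \<bar>s n\<bar>) {..<m}" by (simp add: L2_set_def)
  also have "\<dots> \<le> L2_set (\<lambda>n. \<bar>s n * ln (s n)\<bar>) {..<m}"
  proof (rule L2_set_mono)
    fix n assume "n \<in> {..<m}"
    then show "\<bar>s n\<bar> \<le> \<bar>s n * ln (s n)\<bar>"
      using lns[of n] s0[of n] by (cases "s n = 0") (auto simp: abs_mult)
  qed simp
  also have "\<dots> = L2_set (\<lambda>n. s n * ln (s n)) {..<m}" by (simp add: L2_set_def)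
  finally have S: "?S \<le> sqrt (1 / c1)" using sln by linarith
  have "L2_set (\<lambda>n. s n * ln (s n / ?S)) {..<m} = L2_set (\<lambda>n. \<bar>s n * ln (s n / ?S)\<bar>) {..<m}"
    by (simp add: L2_set_def)
  also have "\<dots> \<le> L2_set (\<lambda>n. \<bar>s n * ln (s n)\<bar> + s n * ?S) {..<m}"
  proof (rule L2_set_mono)
    fix n assume n: "n \<in> {..<m}"
    show "\<bar>s n * ln (s n / ?S)\<bar> \<le> \<bar>s n * ln (s n)\<bar> + s n * ?S"
    proof (cases "s n = 0")
      case False
      then have sn: "s n > 0" using s0[of n] by simp
      have snS: "s n \<le> ?S" using n by (intro member_le_L2_set) auto
      then have Spos: "?S > 0" using sn by simp
      \<comment> \<open>Only an upper bound for \<open>ln ?S\<close> is available, as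
        \<open>?S\<close> may be tiny. It suffices: \<open>ln (s n / ?S)\<close> is nonpositive, so
        its absolute value is \<open>ln ?S - ln (s n)\<close>.\<close>
      have "ln ?S \<le> ?S" using Spos by (rule ln_bound)
      moreover have "ln (s n / ?S) \<le> 0" using snS sn Spos by simp
      moreover have "ln (s n / ?S) = ln (s n) - ln ?S" using sn Spos by (simp add: ln_div)
      ultimately have "\<bar>ln (s n / ?S)\<bar> \<le> \<bar>ln (s n)\<bar> + ?S" by linarith
      then have "s n * \<bar>ln (s n / ?S)\<bar> \<le> s n * (\<bar>ln (s n)\<bar> + ?S)" using sn by simp
      then show ?thesis using sn by (simp add: abs_mult algebra_simps)
    qed simp
  qed simp
  also have "\<dots> \<le> L2_set (\<lambda>n. \<bar>s n * ln (s n)\<bar>) {..<m} + L2_set (\<lambda>n. s n * ?S) {..<m}"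
    by (rule L2_set_triangle_ineq)
  also have "L2_set (\<lambda>n. \<bar>s n * ln (s n)\<bar>) {..<m} = L2_set (\<lambda>n. s n * ln (s n)) {..<m}"
    by (simp add: L2_set_def)
  also have "L2_set (\<lambda>n. s n * ?S) {..<m} = ?S * ?S"
    using L2_set_mult_left[of ?S s "{..<m}"] by (simp add: mult.commute)
  also have "?S * ?S \<le> sqrt (1 / c1) * sqrt (1 / c1)" using S \<open>c1 > 0\<close> by (intro mult_mono) auto
  also have "\<dots> = 1 / c1" using \<open>c1 > 0\<close> by simp
  finally have "log_len s m \<le> 2 * sqrt (1 / c1) + 1 / c1"
    unfolding log_len_def using S sln by linarith
  moreover have "log_len s m = \<delta> / (T * \<rho>) * log_len b m"
    unfolding s_def using \<delta> Tpos \<open>\<rho> > 0\<close> by (intro log_len_scale) simp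
  ultimately show ?thesis using \<delta> Tpos \<open>\<rho> > 0\<close> by (simp add: field_simps)
qed

section \<open>The Luxemburg norm on finitely supported sequences\<close>

lemma
  fixes a :: "nat \<Rightarrow> 'k::real_normed_field"
  shows sum_seq_scale_unit_seq: "(\<Sum>n<m. seq_scale (a n) (unit_seq n)) = (\<lambda>i. if i < m then a i else 0)"
proof (rule ext)
  fix i
  have "(\<Sum>n<m. seq_scale (a n) (unit_seq n)) i = (\<Sum>n<m. if i = n then a n else 0)"
    by (induction m) (auto simp: seq_scale_def unit_seq_def)
  then show "(\<Sum>n<m. seq_scale (a n) (unit_seq n)) i = (if i < m then a i else 0)" by simp
qed

lemma ell2_norm_sum_unit_seq:
  "ell2_norm (\<Sum>n<m. seq_scale (a n) (unit_seq n)) = L2_set (\<lambda>n. norm (a n)) {..<m}"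
  unfolding sum_seq_scale_unit_seq ell2_norm_def L2_set_def
  by (subst suminf_finite[of "{..<m}"]) auto

lemma orlicz_norm_sum_unit_seq:
  assumes "\<Phi> 0 = 0"
  shows "orlicz_norm \<Phi> (\<Sum>n<m. seq_scale (a n) (unit_seq n))
      = Inf {\<rho>. \<rho> > 0 \<and> (\<Sum>n<m. \<Phi> (norm (a n) / \<rho>)) \<le> 1}"
proof -
  have "summable (\<lambda>i. \<Phi> (norm (if i < m then a i else 0) / \<rho>))" for \<rho>
    by (rule summable_finite[of "{..<m}"]) (auto simp: assms)
  moreover have "(\<Sum>i. \<Phi> (norm (if i < m then a i else 0) / \<rho>)) = (\<Sum>n<m. \<Phi> (norm (a n) / \<rho>))" for \<rho>
    by (subst suminf_finite[of "{..<m}"]) (auto simp: assms)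
  ultimately show ?thesis unfolding orlicz_norm_def sum_seq_scale_unit_seq by simp
qed

text \<open>The first bound makes a multiple of \<open>log_len b m\<close> admissible in the infimum
  defining the Luxemburg norm, the second bounds every admissible value from below. The constants
  depend on \<Phi> alone.\<close>

lemma log_len_orlicz_bounds:
  assumes "orlicz_function \<Phi>" and "\<Phi> \<in> \<Theta>[at_right 0](\<lambda>t. t\<^sup>2 * (ln t)\<^sup>2)"
  obtains K K' where "K > 0" "K' > 0"
    "\<And>b m. (\<And>n. 0 \<le> b n) \<Longrightarrow> log_len b m > 0 \<Longrightarrow> (\<Sum>n<m. \<Phi> (b n / (K * log_len b m))) \<le> 1"
    "\<And>b m \<rho>. (\<And>n. 0 \<le> b n) \<Longrightarrow> \<rho> > 0 \<Longrightarrow> (\<Sum>n<m. \<Phi> (b n / \<rho>)) \<le> 1 \<Longrightarrow> log_len b m \<le> K' * \<rho>"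
proof -
  obtain \<delta> c1 c2 where \<delta>: "0 < \<delta>" "\<delta> \<le> exp (-1)" "c1 > 0" "c2 > 0"
    and bd: "\<And>t. 0 \<le> t \<Longrightarrow> t \<le> \<delta> \<Longrightarrow> c1 * (t * ln t)\<^sup>2 \<le> \<Phi> t \<and> \<Phi> t \<le> c2 * (t * ln t)\<^sup>2"
    using orlicz_function_log_bounds[OF assms] by blast
  have \<Phi>: "mono_on {0..} \<Phi>" "\<Phi> 0 = 0" "filterlim \<Phi> at_top at_top"
    using assms(1) by (auto simp: orlicz_function_def)
  obtain T0 where T0: "\<And>t. t \<ge> T0 \<Longrightarrow> \<Phi> t > 1"
    using \<Phi>(3) unfolding filterlim_at_top_dense eventually_at_top_linorder by blast
  \<comment> \<open>The maximum with \<delta> makes the scaling factor \<open>\<delta> / T\<close>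
    at most 1.\<close>
  define T where "T = max T0 \<delta>"
  show ?thesis
  proof
    show "1 + 1 / \<delta> + 9 * c2 > 0" "T / \<delta> * (2 * sqrt (1 / c1) + 1 / c1) > 0"
      using \<delta> by (auto simp: T_def add_pos_pos)
    show "(\<Sum>n<m. \<Phi> (b n / ((1 + 1 / \<delta> + 9 * c2) * log_len b m))) \<le> 1"
      if "\<And>n. 0 \<le> b n" "log_len b m > 0" for b m
      using orlicz_sum_le_1[of \<delta> \<Phi> c2 b m] bd \<delta> that by blast
    show "log_len b m \<le> T / \<delta> * (2 * sqrt (1 / c1) + 1 / c1) * \<rho>"
      if "\<And>n. 0 \<le> b n" "\<rho> > 0" "(\<Sum>n<m. \<Phi> (b n / \<rho>)) \<le> 1" for b m \<rho>
      using log_len_le_orlicz[of \<delta> c1 \<Phi> T b \<rho> m] bd \<delta> that \<Phi> T0 by (auto simp: T_def)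
  qed
qed

lemma orlicz_norm_log_len:
  assumes "orlicz_function \<Phi>" and "\<Phi> \<in> \<Theta>[at_right 0](\<lambda>t. t\<^sup>2 * (ln t)\<^sup>2)"
  obtains A B where "A > 0" "B > 0"
    "\<forall>(a :: nat \<Rightarrow> 'k::real_normed_field) m.
       A * log_len (\<lambda>n. norm (a n)) m \<le> orlicz_norm \<Phi> (\<Sum>n<m. seq_scale (a n) (unit_seq n)) \<and>
       orlicz_norm \<Phi> (\<Sum>n<m. seq_scale (a n) (unit_seq n)) \<le> B * log_len (\<lambda>n. norm (a n)) m"
proof -
  obtain K K' where K: "K > 0" "K' > 0"
    "\<And>b m. (\<And>n. 0 \<le> b n) \<Longrightarrow> log_len b m > 0 \<Longrightarrow> (\<Sum>n<m. \<Phi> (b n / (K * log_len b m))) \<le> 1"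
    "\<And>b m \<rho>. (\<And>n. 0 \<le> b n) \<Longrightarrow> \<rho> > 0 \<Longrightarrow> (\<Sum>n<m. \<Phi> (b n / \<rho>)) \<le> 1 \<Longrightarrow> log_len b m \<le> K' * \<rho>"
    using log_len_orlicz_bounds[OF assms] by metis
  have \<Phi>0: "\<Phi> 0 = 0" using assms(1) by (auto simp: orlicz_function_def)
  show ?thesis
  proof
    show "1 / K' > 0" "K > 0" using K by auto
    show "\<forall>(a :: nat \<Rightarrow> 'k) m.
       1 / K' * log_len (\<lambda>n. norm (a n)) m \<le> orlicz_norm \<Phi> (\<Sum>n<m. seq_scale (a n) (unit_seq n)) \<and>
       orlicz_norm \<Phi> (\<Sum>n<m. seq_scale (a n) (unit_seq n)) \<le> K * log_len (\<lambda>n. norm (a n)) m"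
    proof (intro allI)
      fix a :: "nat \<Rightarrow> 'k" and m
      let ?b = "\<lambda>n. norm (a n)"
      let ?R = "{\<rho>. \<rho> > 0 \<and> (\<Sum>n<m. \<Phi> (norm (a n) / \<rho>)) \<le> 1}"
      have bdd: "bdd_below ?R" by (rule bdd_belowI[of _ 0]) auto
      have ne: "?R \<noteq> {} \<and> Inf ?R \<le> K * log_len ?b m"
      proof (cases "log_len ?b m > 0")
        case True
        then have "K * log_len ?b m \<in> ?R" using K by simp
        then show ?thesis using cInf_lower[OF _ bdd] by blast
      next
        case False
        \<comment> \<open>For the zero vector \<open>K * log_len ?b m\<close> is 0 and hence not
          admissible itself, but every positive number is, so the infimum is 0.\<close>
        then have 0: "log_len ?b m = 0" using log_len_nonneg[of ?b m] by linarith
        then have "a n = 0" if "n < m" for n using le_log_len[OF that, of ?b] by simp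
        then have "?R = {0<..}" using \<Phi>0 by auto
        with 0 show ?thesis by simp
      qed
      then have "1 / K' * log_len ?b m \<le> Inf ?R"
      proof (intro cInf_greatest)
        fix \<rho> assume "\<rho> \<in> ?R"
        then have "log_len ?b m \<le> K' * \<rho>" using K(4)[of ?b \<rho> m] by simp
        then show "1 / K' * log_len ?b m \<le> \<rho>" using K(2) by (simp add: field_simps)
      qed blast
      with ne show "1 / K' * log_len ?b m \<le> orlicz_norm \<Phi> (\<Sum>n<m. seq_scale (a n) (unit_seq n)) \<and>
          orlicz_norm \<Phi> (\<Sum>n<m. seq_scale (a n) (unit_seq n)) \<le> K * log_len ?b m"
        by (simp add: orlicz_norm_sum_unit_seq[of \<Phi>, OF \<Phi>0])
    qed
  qed
qed

text \<open>Monotonicity up to a constant is not visible from the definition of \<^const>\<open>log_len\<close>;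
  it is inherited from the lattice norm of the Orlicz space.\<close>

lemma log_len_quasi_mono:
  assumes "orlicz_function \<Phi>" and "\<Phi> \<in> \<Theta>[at_right 0](\<lambda>t. t\<^sup>2 * (ln t)\<^sup>2)" and R: "R > 0"
  obtains K where "K > 0"
    "\<And>b c m. (\<And>n. 0 \<le> b n) \<Longrightarrow> (\<And>n. b n \<le> R * c n) \<Longrightarrow> log_len b m \<le> K * log_len c m"
proof -
  obtain K K' where K: "K > 0" "K' > 0"
    "\<And>b m. (\<And>n. 0 \<le> b n) \<Longrightarrow> log_len b m > 0 \<Longrightarrow> (\<Sum>n<m. \<Phi> (b n / (K * log_len b m))) \<le> 1"
    "\<And>b m \<rho>. (\<And>n. 0 \<le> b n) \<Longrightarrow> \<rho> > 0 \<Longrightarrow> (\<Sum>n<m. \<Phi> (b n / \<rho>)) \<le> 1 \<Longrightarrow> log_len b m \<le> K' * \<rho>"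
    using log_len_orlicz_bounds[OF assms(1,2)] by metis
  have mono: "mono_on {0..} \<Phi>" using assms(1) by (auto simp: orlicz_function_def)
  show ?thesis
  proof
    show "K' * R * K > 0" using K R by simp
    fix b c :: "nat \<Rightarrow> real" and m
    assume b: "\<And>n. 0 \<le> b n" "\<And>n. b n \<le> R * c n"
    then have c: "0 \<le> c n" for n using order_trans[OF b(1) b(2)] R by (simp add: zero_le_mult_iff)
    show "log_len b m \<le> K' * R * K * log_len c m"
    proof (cases "log_len c m > 0")
      case True
      let ?\<rho> = "K * log_len c m"
      have \<rho>: "?\<rho> > 0" using True K by simp
      have "(\<Sum>n<m. \<Phi> (b n / (R * ?\<rho>))) \<le> (\<Sum>n<m. \<Phi> (c n / ?\<rho>))"
      proof (rule sum_mono)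
        fix n
        have "b n / (R * ?\<rho>) \<le> R * c n / (R * ?\<rho>)"
          using b(2)[of n] R \<rho> by (intro divide_right_mono) auto
        also have "\<dots> = c n / ?\<rho>" using R by simp
        finally show "\<Phi> (b n / (R * ?\<rho>)) \<le> \<Phi> (c n / ?\<rho>)"
          using b(1)[of n] c[of n] R \<rho> by (intro mono_onD[OF mono]) auto
      qed
      also have "\<dots> \<le> 1" using K(3)[OF c True] .
      finally have "log_len b m \<le> K' * (R * ?\<rho>)" using R \<rho> b(1) by (intro K(4)) auto
      then show ?thesis by (simp add: mult.assoc)
    next
      case False
      then have "log_len c m = 0" using log_len_nonneg[of c m] by linarith
      moreover from this have "c n = 0" if "n < m" for n
        using le_log_len[OF that, of c] c[of n] by simp
      then have "b n = 0" if "n < m" for n using that b[of n] by simp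
      then have "log_len b m = 0" by (simp add: log_len_def L2_set_def)
      ultimately show ?thesis by simp
    qed
  qed
qed

section \<open>Basic sequences in quasi-normed spaces\<close>

text \<open>The constant is a parameter because later bounds are explicit in it. Continuity of
  \<open>N\<close> is not assumed, so a bound passes to a limit only up to another factor
  \<open>C\<close>. The sort \<open>banach\<close> serves the coefficient series in
  \<open>basis_constant\<close>.\<close>

locale quasi_normed = vector_space s
  for s :: "'k::{real_normed_field,banach} \<Rightarrow> 'z::ab_group_add \<Rightarrow> 'z" +
  fixes E :: "'z set" and N :: "'z \<Rightarrow> real" and C :: real
  assumes subspace_E: "subspace E"
    and N_nonneg: "x \<in> E \<Longrightarrow> 0 \<le> N x"
    and N_eq_0_iff: "x \<in> E \<Longrightarrow> N x = 0 \<longleftrightarrow> x = 0"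
    and N_scale: "x \<in> E \<Longrightarrow> N (s c x) = norm c * N x"
    and C_ge_1: "1 \<le> C"
    and N_add: "x \<in> E \<Longrightarrow> y \<in> E \<Longrightarrow> N (x + y) \<le> C * (N x + N y)"
begin

lemma C_pos: "0 < C" using C_ge_1 by simp

lemmas E_closed = subspace_0[OF subspace_E] subspace_add[OF subspace_E] subspace_diff[OF subspace_E]
  subspace_scale[OF subspace_E] subspace_neg[OF subspace_E]

lemma E_sum: "(\<And>n. n \<in> A \<Longrightarrow> x n \<in> E) \<Longrightarrow> (\<Sum>n\<in>A. x n) \<in> E"
  by (rule subspace_sum[OF subspace_E])

lemma N_zero: "N 0 = 0" using N_eq_0_iff[OF E_closed(1)] by simp

lemma N_minus: "x \<in> E \<Longrightarrow> N (- x) = N x"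
  using N_scale[of x "-1"] by (simp add: scale_minus_left)

lemma N_minus_commute: "x \<in> E \<Longrightarrow> y \<in> E \<Longrightarrow> N (x - y) = N (y - x)"
  using N_minus[of "x - y"] E_closed(3)[of x y] by simp

lemma N_diff: "x \<in> E \<Longrightarrow> y \<in> E \<Longrightarrow> N (x - y) \<le> C * (N x + N y)"
  using N_add[of x "- y"] E_closed(5)[of y] N_minus[of y] by simp

lemma N_triangle: "x \<in> E \<Longrightarrow> y \<in> E \<Longrightarrow> z \<in> E \<Longrightarrow> N (x - z) \<le> C * (N (x - y) + N (y - z))"
  using N_add[of "x - y" "y - z"] E_closed(3)[of x y] E_closed(3)[of y z] by simp

lemma N_le_N_diff: "x \<in> E \<Longrightarrow> y \<in> E \<Longrightarrow> N x \<le> C * (N (x - y) + N y)"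
  using N_triangle[of x y 0] E_closed(1) by simp

text \<open>Splitting off the first term rather than the last gives the n-th term a weight that does
  not depend on the length \<open>m\<close>.\<close>

lemma N_sum: "(\<And>n. n < m \<Longrightarrow> x n \<in> E) \<Longrightarrow> N (\<Sum>n<m. x n) \<le> (\<Sum>n<m. C ^ Suc n * N (x n))"
proof (induction m arbitrary: x)
  case 0
  then show ?case by (simp add: N_zero)
next
  case (Suc m)
  have "N (\<Sum>n<Suc m. x n) = N (x 0 + (\<Sum>n<m. x (Suc n)))"
    by (simp only: sum.lessThan_Suc_shift)
  also have "\<dots> \<le> C * (N (x 0) + N (\<Sum>n<m. x (Suc n)))"
    by (rule N_add) (use Suc.prems in \<open>auto intro!: E_sum\<close>)
  also have "\<dots> \<le> C * (N (x 0) + (\<Sum>n<m. C ^ Suc n * N (x (Suc n))))"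
    using Suc.IH[of "\<lambda>n. x (Suc n)"] Suc.prems C_pos by simp
  also have "\<dots> = (\<Sum>n<Suc m. C ^ Suc n * N (x n))"
    by (simp only: sum.lessThan_Suc_shift) (simp add: sum_distrib_left distrib_left mult.assoc)
  finally show ?case .
qed

text \<open>In a series whose terms decay like powers of \<open>q = 1/(2C)\<close>, the factors \<open>C\<^sup>n\<close> of the iterated
  quasi-triangle inequality are absorbed.\<close>

definition q :: real where "q = 1 / (2 * C)"

lemma q_pos: "0 < q" and q_less_1: "q < 1"
  using C_ge_1 by (simp_all add: q_def)

lemma q_power_tendsto: "(\<lambda>n. c * q ^ n) \<longlonglongrightarrow> 0"
  by (intro tendsto_mult_right_zero LIMSEQ_power_zero) (use q_pos q_less_1 in simp)

lemma N_sum_geometric: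
  assumes "\<And>n. n < m \<Longrightarrow> x n \<in> E" "\<And>n. n < m \<Longrightarrow> N (x n) \<le> M * q ^ n" "0 \<le> M"
  shows "N (\<Sum>n<m. x n) \<le> 2 * C * M"
proof -
  have "C ^ Suc n * (M * q ^ n) = (C * M) * (1 / 2) ^ n" for n
    using C_pos by (simp add: q_def power_mult_distrib power_divide field_simps)
  then have "C ^ Suc n * N (x n) \<le> (C * M) * (1 / 2) ^ n" if "n < m" for n
    using mult_left_mono[OF assms(2)[OF that], of "C ^ Suc n"] C_pos by (metis less_imp_le zero_less_power)
  then have "(\<Sum>n<m. C ^ Suc n * N (x n)) \<le> (\<Sum>n<m. (C * M) * (1 / 2) ^ n)"
    by (intro sum_mono) auto
  also have "\<dots> = (C * M) * (\<Sum>n<m. (1 / 2) ^ n)" by (simp add: sum_distrib_left)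
  also have "\<dots> \<le> (C * M) * 2"
    using C_pos assms(3) by (intro mult_left_mono) (auto simp: sum_gp_strict)
  finally show ?thesis using N_sum[of m x, OF assms(1)] by simp
qed

text \<open>Segments of the telescoping sum are bounded by \<open>2 * C * R j\<close>, so the
  sequence is Cauchy. The second factor \<open>C\<close> in the conclusion is the price of passing
  to the limit with a possibly discontinuous \<open>N\<close>.\<close>

lemma geometric_limit:
  assumes complete: "quasi_norm_complete E N" and X: "\<And>j. X j \<in> E"
    and step: "\<And>j. N (X (Suc j) - X j) \<le> R j" and R: "\<And>j. R (Suc j) \<le> q * R j"
  obtains x where "x \<in> E" "\<And>j. N (x - X j) \<le> 2 * C\<^sup>2 * R j"
proof -
  have R0: "0 \<le> R j" for j
    using N_nonneg[OF E_closed(3)[OF X X]] step order_trans by blast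
  have Rle: "R (j + i) \<le> R j * q ^ i" for i j
  proof (induction i)
    case (Suc i)
    have "R (j + Suc i) \<le> q * R (j + i)" using R[of "j + i"] by simp
    also have "\<dots> \<le> q * (R j * q ^ i)" using Suc q_pos by simp
    finally show ?case by (simp add: mult.commute mult.left_commute)
  qed simp
  have seg: "N (X (j + i) - X j) \<le> 2 * C * R j" for i j
  proof -
    have "X (j + i) - X j = (\<Sum>k<i. X (Suc (j + k)) - X (j + k))"
      using sum_lessThan_telescope[of "\<lambda>k. X (j + k)" i] by simp
    moreover have "N (X (Suc (j + k)) - X (j + k)) \<le> R j * q ^ k" for k
      using step Rle order_trans by blast
    ultimately show ?thesis using N_sum_geometric[of i _ "R j"] R0 X E_closed(3) by simp
  qed
  have small: "(\<lambda>j. 4 * C\<^sup>2 * R j) \<longlonglongrightarrow> 0"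
  proof (rule tendsto_sandwich[where f="\<lambda>_. 0" and h="\<lambda>j. (4 * C\<^sup>2 * R 0) * q ^ j"])
    show "\<forall>\<^sub>F j in sequentially. 4 * C\<^sup>2 * R j \<le> (4 * C\<^sup>2 * R 0) * q ^ j"
      using Rle[of 0] by (auto simp: mult.assoc intro!: always_eventually mult_left_mono)
  qed (use R0 q_power_tendsto in auto)
  have "\<exists>M. \<forall>m\<ge>M. \<forall>n\<ge>M. N (X m - X n) < e" if e: "e > 0" for e
  proof -
    obtain p where p: "4 * C\<^sup>2 * R p < e"
      using order_tendstoD(2)[OF small e] eventually_happens by force
    have "N (X m - X n) < e" if "m \<ge> p" "n \<ge> p" for m n
    proof -
      have "N (X m - X n) \<le> C * (N (X m - X p) + N (X p - X n))" by (rule N_triangle) (rule X)+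
      also have "\<dots> \<le> C * (2 * C * R p + 2 * C * R p)"
        using seg[of p "m - p"] seg[of p "n - p"] that N_minus_commute[OF X X, of p n] C_pos
        by (intro mult_left_mono add_mono) auto
      also have "\<dots> = 4 * C\<^sup>2 * R p" by (simp add: power2_eq_square)
      finally show ?thesis using p by simp
    qed
    then show ?thesis by blast
  qed
  then obtain x where x: "x \<in> E" "(\<lambda>n. N (X n - x)) \<longlonglongrightarrow> 0"
    using complete X unfolding quasi_norm_complete_def by blast
  have "N (x - X j) \<le> 2 * C\<^sup>2 * R j" for j
  proof (rule tendsto_lowerbound)
    show "(\<lambda>i. C * (N (X (i + j) - x) + 2 * C * R j)) \<longlonglongrightarrow> 2 * C\<^sup>2 * R j"
      using tendsto_mult[OF tendsto_const tendsto_add[OF LIMSEQ_ignore_initial_segment[OF x(2), of j] tendsto_const],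
          of C "2 * C * R j"]
      by (simp add: power2_eq_square mult_ac)
    have "N (x - X j) \<le> C * (N (X (i + j) - x) + 2 * C * R j)" for i
    proof -
      have "N (x - X j) \<le> C * (N (x - X (i + j)) + N (X (i + j) - X j))"
        by (rule N_triangle) (use x X in auto)
      then show ?thesis
        using seg[of j i] N_minus_commute[OF x(1) X, of "i + j"] C_pos
        by (smt (verit) add.commute mult_left_mono)
    qed
    then show "\<forall>\<^sub>F i in sequentially. N (x - X j) \<le> C * (N (X (i + j) - x) + 2 * C * R j)"
      by (intro always_eventually) blast
  qed simp
  with x(1) show ?thesis using that by blast
qed

text \<open>Baire category in a closed subset, without a metric. If no \<open>A M\<close> were dense
  in a ball of \<open>X\<close>, points could be chosen in shrinking balls, each new point keeping a
  distance from the next covering set; their limit would belong to \<open>X\<close> but to none of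
  these sets.\<close>

lemma Baire:
  assumes complete: "quasi_norm_complete E N" and X: "X \<subseteq> E" "x0 \<in> X"
    and closed: "\<And>x. x \<in> E \<Longrightarrow> (\<And>e. e > 0 \<Longrightarrow> \<exists>y\<in>X. N (x - y) < e) \<Longrightarrow> x \<in> X"
    and cover: "X \<subseteq> (\<Union>n::nat. A n)" and A: "\<And>n. A n \<subseteq> E"
  obtains M x r where "x \<in> X" "r > 0"
    "\<And>y e. y \<in> X \<Longrightarrow> N (y - x) < r \<Longrightarrow> e > 0 \<Longrightarrow> \<exists>z\<in>A M. N (y - z) < e"
proof (rule ccontr)
  assume "\<not> thesis"
  with that have H: "\<exists>y e. y \<in> X \<and> N (y - x) < r \<and> e > 0 \<and> (\<forall>z\<in>A M. \<not> N (y - z) < e)"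
    if "x \<in> X" "r > 0" for M x r
    using that by blast
  define P where "P = (\<lambda>(n::nat) (x, r::real). x \<in> X \<and> r > 0)"
  define Q where "Q = (\<lambda>n (x, r) (x', r'). N (x' - x) \<le> r \<and> r' \<le> q * r \<and>
    (\<forall>z\<in>A n. 4 * C\<^sup>2 * r' \<le> N (x' - z)))"
  have "\<exists>f. \<forall>n. P n (f n) \<and> Q n (f n) (f (Suc n))"
  proof (rule dependent_nat_choice)
    show "\<exists>p. P 0 p" using X(2) by (auto simp: P_def intro: exI[of _ 1])
    fix p n assume "P n p"
    then obtain x r where p: "p = (x, r)" "x \<in> X" "r > 0" by (auto simp: P_def)
    obtain y e where y: "y \<in> X" "N (y - x) < r" "e > 0" "\<forall>z\<in>A n. \<not> N (y - z) < e"
      using H[OF p(2,3)] by blast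
    \<comment> \<open>The first bound lets \<open>geometric_limit\<close> apply. The second keeps
      the limit off \<open>A n\<close>: it lies within \<open>2 * C\<^sup>2 * r'\<close> of
      \<open>y\<close>, half the distance \<open>4 * C\<^sup>2 * r'\<close> that \<open>y\<close>
      keeps from \<open>A n\<close>.\<close>
    define r' where "r' = min (q * r) (e / (4 * C\<^sup>2))"
    have "r' > 0" using p y q_pos C_pos by (simp add: r'_def)
    moreover have "4 * C\<^sup>2 * r' \<le> e"
    proof -
      have "4 * C\<^sup>2 * r' \<le> 4 * C\<^sup>2 * (e / (4 * C\<^sup>2))" using C_pos by (intro mult_left_mono) (auto simp: r'_def)
      then show ?thesis using C_pos by simp
    qed
    ultimately have "P (Suc n) (y, r') \<and> Q n p (y, r')"
      using y unfolding P_def Q_def p by (force simp: r'_def)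
    then show "\<exists>p'. P (Suc n) p' \<and> Q n p p'" by blast
  qed
  then obtain f where f: "\<And>n. P n (f n)" "\<And>n. Q n (f n) (f (Suc n))" by blast
  define x r where "x = (\<lambda>n. fst (f n))" and "r = (\<lambda>n. snd (f n))"
  have feq: "f n = (x n, r n)" for n by (simp add: x_def r_def)
  have x: "x n \<in> X" "r n > 0" and step: "N (x (Suc n) - x n) \<le> r n" "r (Suc n) \<le> q * r n"
    and far: "\<And>z. z \<in> A n \<Longrightarrow> 4 * C\<^sup>2 * r (Suc n) \<le> N (x (Suc n) - z)" for n
    using f[of n] unfolding feq P_def Q_def by auto
  have xE: "x n \<in> E" for n using x(1) X(1) by blast
  obtain y where y: "y \<in> E" "\<And>j. N (y - x j) \<le> 2 * C\<^sup>2 * r j"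
    using geometric_limit[OF complete, of x r] xE step by blast
  have rle: "r n \<le> r 0 * q ^ n" for n
  proof (induction n)
    case (Suc n)
    then have "q * r n \<le> q * (r 0 * q ^ n)" using q_pos by simp
    then show ?case using step(2)[of n] by (simp add: mult_ac)
  qed simp
  have "y \<in> X"
  proof (rule closed[OF y(1)])
    fix e :: real assume "e > 0"
    then obtain n where n: "2 * C\<^sup>2 * r 0 * q ^ n < e"
      using order_tendstoD(2)[OF q_power_tendsto[of "2 * C\<^sup>2 * r 0"]] eventually_happens by force
    have "N (y - x n) \<le> 2 * C\<^sup>2 * (r 0 * q ^ n)"
      using y(2)[of n] mult_left_mono[OF rle[of n], of "2 * C\<^sup>2"] by simp
    with n x(1)[of n] show "\<exists>z\<in>X. N (y - z) < e" by (intro bexI[of _ "x n"]) auto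
  qed
  then obtain n where n: "y \<in> A n" using cover by blast
  have "4 * C\<^sup>2 * r (Suc n) \<le> 2 * C\<^sup>2 * r (Suc n)"
    using far[OF n] y(2)[of "Suc n"] N_minus_commute[OF y(1) xE, of "Suc n"] by linarith
  moreover have "C\<^sup>2 * r (Suc n) > 0" using x(2)[of "Suc n"] C_pos by simp
  ultimately show False by linarith
qed

section \<open>Partial sums and expansions\<close>

definition psum :: "(nat \<Rightarrow> 'z) \<Rightarrow> (nat \<Rightarrow> 'k) \<Rightarrow> nat \<Rightarrow> 'z" where
  "psum w a m = (\<Sum>n<m. s (a n) (w n))"

definition expands :: "(nat \<Rightarrow> 'z) \<Rightarrow> 'z \<Rightarrow> (nat \<Rightarrow> 'k) \<Rightarrow> bool" where
  "expands w x a \<longleftrightarrow> (\<lambda>m. N (x - psum w a m)) \<longlonglongrightarrow> 0"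

lemma psum_in_E: "range w \<subseteq> E \<Longrightarrow> psum w a m \<in> E"
  unfolding psum_def by (intro E_sum E_closed(4)) auto

lemma psum_diff: "psum w (\<lambda>n. a n - b n) m = psum w a m - psum w b m"
  by (simp add: psum_def scale_left_diff_distrib sum_subtractf)

lemma psum_scale: "psum w (\<lambda>n. c * a n) m = s c (psum w a m)"
  by (simp add: psum_def scale_sum_right)

lemma expands_diff:
  assumes "range w \<subseteq> E" "x \<in> E" "y \<in> E" "expands w x a" "expands w y b"
  shows "expands w (x - y) (\<lambda>n. a n - b n)"
  unfolding expands_def psum_diff
proof (rule tendsto_sandwich[where f="\<lambda>_. 0" and h="\<lambda>m. C * (N (x - psum w a m) + N (y - psum w b m))"])
  note in_E = assms(2,3) psum_in_E[OF assms(1)]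
  show "\<forall>\<^sub>F m in sequentially. 0 \<le> N (x - y - (psum w a m - psum w b m))"
    by (intro always_eventually allI N_nonneg E_closed(3) in_E)
  have "N (x - y - (psum w a m - psum w b m)) \<le> C * (N (x - psum w a m) + N (y - psum w b m))" for m
    using N_diff[of "x - psum w a m" "y - psum w b m"] in_E E_closed(3) by (simp add: algebra_simps)
  then show "\<forall>\<^sub>F m in sequentially. N (x - y - (psum w a m - psum w b m))
      \<le> C * (N (x - psum w a m) + N (y - psum w b m))" by (rule always_eventually[OF allI])
  show "(\<lambda>m. C * (N (x - psum w a m) + N (y - psum w b m))) \<longlonglongrightarrow> 0"
    using assms(4,5) unfolding expands_def by (auto intro!: tendsto_mult_right_zero tendsto_add_zero)
qed simp

lemma expands_scale:
  assumes "range w \<subseteq> E" "x \<in> E" "expands w x a"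
  shows "expands w (s c x) (\<lambda>n. c * a n)"
proof -
  have "N (s c x - psum w (\<lambda>n. c * a n) m) = norm c * N (x - psum w a m)" for m
    using N_scale[of "x - psum w a m" c] assms psum_in_E[OF assms(1)] E_closed(3)
    by (simp add: psum_scale scale_right_diff_distrib)
  then show ?thesis using assms(3) unfolding expands_def by (auto intro!: tendsto_mult_right_zero)
qed

section \<open>Closed linear spans\<close>

lemma span_subset_E: "S \<subseteq> E \<Longrightarrow> span S \<subseteq> E"
  by (rule span_minimal[OF _ subspace_E])

lemma closed_span_subset: "closed_span s E N S \<subseteq> E"
  by (auto simp: closed_span_def)

lemma span_subset_closed_span: "S \<subseteq> E \<Longrightarrow> span S \<subseteq> closed_span s E N S"
  using span_subset_E[of S] N_zero by (force simp: closed_span_def)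

lemma closed_span_closed:
  assumes "S \<subseteq> E" "x \<in> E" "\<And>e. e > 0 \<Longrightarrow> \<exists>y\<in>closed_span s E N S. N (x - y) < e"
  shows "x \<in> closed_span s E N S"
proof -
  have "\<exists>z\<in>span S. N (x - z) < e" if "e > 0" for e
  proof -
    have e: "e / (2 * C) > 0" using that C_pos by simp
    obtain y where y: "y \<in> closed_span s E N S" "N (x - y) < e / (2 * C)" using assms(3)[OF e] by blast
    obtain z where z: "z \<in> span S" "N (y - z) < e / (2 * C)"
      using y(1) e unfolding closed_span_def by blast
    have "N (x - z) \<le> C * (N (x - y) + N (y - z))"
      by (rule N_triangle) (use assms y z span_subset_E closed_span_subset in blast)+
    also have "\<dots> < C * (e / (2 * C) + e / (2 * C))"
      using y z C_pos by (intro mult_strict_left_mono add_strict_mono) auto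
    also have "\<dots> = e" using C_pos by simp
    finally show ?thesis using z(1) by blast
  qed
  with assms(2) show ?thesis by (auto simp: closed_span_def)
qed

lemma closed_span_diff:
  assumes "S \<subseteq> E" "x \<in> closed_span s E N S" "y \<in> closed_span s E N S"
  shows "x - y \<in> closed_span s E N S"
proof -
  have E: "x \<in> E" "y \<in> E" using assms closed_span_subset by auto
  have "\<exists>z\<in>span S. N (x - y - z) < e" if "e > 0" for e
  proof -
    have e: "e / (2 * C) > 0" using that C_pos by simp
    obtain u v where u: "u \<in> span S" "N (x - u) < e / (2 * C)" and v: "v \<in> span S" "N (y - v) < e / (2 * C)"
      using assms e unfolding closed_span_def by blast
    have uv: "u \<in> E" "v \<in> E" using u v span_subset_E[OF assms(1)] by auto
    have "N (x - y - (u - v)) = N ((x - u) - (y - v))" by (simp add: algebra_simps)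
    also have "\<dots> \<le> C * (N (x - u) + N (y - v))" by (rule N_diff) (use uv E E_closed(3) in auto)
    also have "\<dots> < C * (e / (2 * C) + e / (2 * C))"
      using u v C_pos by (intro mult_strict_left_mono add_strict_mono) auto
    also have "\<dots> = e" using C_pos by simp
    finally show ?thesis using u v span_diff by blast
  qed
  with E E_closed(3) show ?thesis by (auto simp: closed_span_def)
qed

lemma closed_span_scale:
  assumes "S \<subseteq> E" "x \<in> closed_span s E N S"
  shows "s c x \<in> closed_span s E N S"
proof -
  have E: "x \<in> E" using assms closed_span_subset by auto
  have "\<exists>z\<in>span S. N (s c x - z) < e" if "e > 0" for e
  proof -
    have e: "e / (norm c + 1) > 0" using that by (simp add: add_nonneg_pos)
    obtain u where u: "u \<in> span S" "N (x - u) < e / (norm c + 1)"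
      using assms e unfolding closed_span_def by blast
    have uE: "u \<in> E" using u span_subset_E[OF assms(1)] by auto
    have "N (s c x - s c u) = norm c * N (x - u)"
      using N_scale[of "x - u" c] E uE E_closed(3) by (simp add: scale_right_diff_distrib)
    also have "\<dots> \<le> (norm c + 1) * N (x - u)"
      using N_nonneg[OF E_closed(3)[OF E uE]] by (simp add: mult_right_mono)
    also have "\<dots> < e" using u(2) by (simp add: pos_less_divide_eq add_nonneg_pos mult.commute)
    finally show ?thesis using u(1) span_scale by blast
  qed
  with E E_closed(4) show ?thesis by (auto simp: closed_span_def)
qed

text \<open>For a basic sequence these are the balls of the gauge
  \<open>SUP m. N (psum w a m)\<close>; the open mapping argument compares this gauge with
  \<open>N\<close>.\<close>

definition bounded_expansions :: "(nat \<Rightarrow> 'z) \<Rightarrow> real \<Rightarrow> 'z set" where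
  "bounded_expansions w M =
     {x \<in> closed_span s E N (range w). \<exists>a. expands w x a \<and> (\<forall>m. N (psum w a m) \<le> M)}"

lemma bounded_expansions_diff:
  assumes w: "range w \<subseteq> E" and "x \<in> bounded_expansions w M" "y \<in> bounded_expansions w M'"
  shows "x - y \<in> bounded_expansions w (C * (M + M'))"
proof -
  obtain a b where x: "x \<in> closed_span s E N (range w)" "expands w x a" "\<And>m. N (psum w a m) \<le> M"
    and y: "y \<in> closed_span s E N (range w)" "expands w y b" "\<And>m. N (psum w b m) \<le> M'"
    using assms unfolding bounded_expansions_def by blast
  have "N (psum w (\<lambda>n. a n - b n) m) \<le> C * (M + M')" for m
  proof -
    have "N (psum w (\<lambda>n. a n - b n) m) \<le> C * (N (psum w a m) + N (psum w b m))"
      unfolding psum_diff by (rule N_diff; rule psum_in_E[OF w])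
    also have "\<dots> \<le> C * (M + M')"
      using x(3) y(3) C_pos by (intro mult_left_mono add_mono) auto
    finally show ?thesis .
  qed
  moreover have "expands w (x - y) (\<lambda>n. a n - b n)"
    using expands_diff[OF w _ _ x(2) y(2)] x y closed_span_subset by blast
  ultimately show ?thesis
    using closed_span_diff[OF w x(1) y(1)] unfolding bounded_expansions_def by blast
qed

lemma bounded_expansions_scale:
  assumes w: "range w \<subseteq> E" and "x \<in> bounded_expansions w M"
  shows "s c x \<in> bounded_expansions w (norm c * M)"
proof -
  obtain a where x: "x \<in> closed_span s E N (range w)" "expands w x a" "\<And>m. N (psum w a m) \<le> M"
    using assms unfolding bounded_expansions_def by blast
  have "N (psum w (\<lambda>n. c * a n) m) \<le> norm c * M" for m
    unfolding psum_scale N_scale[OF psum_in_E[OF w]] using x(3) by (simp add: mult_left_mono)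
  moreover have "expands w (s c x) (\<lambda>n. c * a n)"
    using expands_scale[OF w _ x(2)] x closed_span_subset by blast
  ultimately show ?thesis
    using closed_span_scale[OF w x(1)] unfolding bounded_expansions_def by blast
qed

lemma basic_sequence_expansion:
  assumes "basic_sequence s E N w" "x \<in> closed_span s E N (range w)"
  shows "\<exists>a. expands w x a" and "expands w x a \<Longrightarrow> expands w x b \<Longrightarrow> a = b"
  using assms unfolding basic_sequence_def expands_def psum_def by blast+

lemma expands_bounded:
  assumes "range w \<subseteq> E" "x \<in> E" "expands w x a"
  shows "\<exists>M. \<forall>m. N (psum w a m) \<le> M"
proof -
  have "Bseq (\<lambda>m. N (x - psum w a m))"
    using assms(3) unfolding expands_def by (intro convergent_imp_Bseq convergentI)
  then obtain K where K: "\<And>m. norm (N (x - psum w a m)) \<le> K" unfolding Bseq_def by blast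
  have "N (psum w a m) \<le> C * (K + N x)" for m
  proof -
    have "N (psum w a m) \<le> C * (N (psum w a m - x) + N x)"
      by (rule N_le_N_diff) (use assms psum_in_E in auto)
    moreover have "N (psum w a m - x) \<le> K"
      using K[of m] N_minus_commute[OF assms(2) psum_in_E[OF assms(1)], of a m] by simp
    ultimately show ?thesis using C_pos by (smt (verit) mult_left_mono)
  qed
  then show ?thesis by blast
qed

text \<open>This is the first half of the open mapping argument; the errors are summed up in
  \<open>basis_constant\<close>.\<close>

lemma approximate_bounded_expansions:
  assumes complete: "quasi_norm_complete E N" and basic: "basic_sequence s E N w"
  obtains K where "0 \<le> K"
    "\<And>x e. x \<in> closed_span s E N (range w) \<Longrightarrow> e > 0 \<Longrightarrow> \<exists>y\<in>bounded_expansions w (K * N x). N (x - y) < e"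
proof -
  let ?X = "closed_span s E N (range w)"
  have w: "range w \<subseteq> E" using basic by (simp add: basic_sequence_def)
  have XE: "?X \<subseteq> E" by (rule closed_span_subset)
  have cover: "?X \<subseteq> (\<Union>n. bounded_expansions w (real n))"
  proof
    fix x assume x: "x \<in> ?X"
    then obtain a where a: "expands w x a" using basic_sequence_expansion(1)[OF basic] by blast
    then obtain M where M: "\<And>m. N (psum w a m) \<le> M" using expands_bounded[OF w _ a] x XE by blast
    obtain n where "M \<le> real n" using real_arch_simple by blast
    then have "N (psum w a m) \<le> real n" for m using M[of m] by simp
    with x a have "x \<in> bounded_expansions w (real n)" unfolding bounded_expansions_def by blast
    then show "x \<in> (\<Union>n. bounded_expansions w (real n))" by blast
  qed
  have zero: "0 \<in> ?X" using span_subset_closed_span[OF w] span_zero by blast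
  obtain M x0 r where x0: "x0 \<in> ?X" "r > 0"
    "\<And>y e. y \<in> ?X \<Longrightarrow> N (y - x0) < r \<Longrightarrow> e > 0 \<Longrightarrow> \<exists>z\<in>bounded_expansions w (real M). N (y - z) < e"
  proof (rule Baire[OF complete XE zero closed_span_closed[OF w] cover])
    show "bounded_expansions w (real n) \<subseteq> E" for n using XE by (auto simp: bounded_expansions_def)
  qed blast+
  \<comment> \<open>\<open>C * (M + M)\<close> bounds the partial sums of a difference of two
    approximants; division by the scaling factor \<open>t = r / (2 * N x)\<close> chosen below gives
    \<open>K * N x\<close>.\<close>
  define K where "K = 4 * C * real M / r"
  show ?thesis
  proof
    show "0 \<le> K" using C_pos x0 by (simp add: K_def)
    fix x and e :: real assume x: "x \<in> ?X" and e: "e > 0"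
    have xE: "x \<in> E" using x XE by blast
    show "\<exists>y\<in>bounded_expansions w (K * N x). N (x - y) < e"
    proof (cases "x = 0")
      case True
      have "expands w 0 (\<lambda>_. 0)" by (simp add: expands_def psum_def N_zero)
      then have "0 \<in> bounded_expansions w (K * N x)"
        using zero True N_zero by (auto simp: bounded_expansions_def psum_def intro!: exI[of _ "\<lambda>_. 0"])
      then show ?thesis using True e N_zero by force
    next
      case False
      then have Nx: "N x > 0" using N_nonneg[OF xE] N_eq_0_iff[OF xE] by simp
      \<comment> \<open>The scaled vector \<open>x'\<close> has \<open>N x' = r / 2\<close>, so
        \<open>x0 + x'\<close> lies in the ball supplied by \<open>Baire\<close>; subtracting an
        approximant of \<open>x0\<close> moves the centre to the origin.\<close>
      define t where "t = r / (2 * N x)"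
      have t: "t > 0" using Nx x0 by (simp add: t_def)
      define x' where "x' = s (of_real t) x"
      have x': "x' \<in> ?X" unfolding x'_def by (rule closed_span_scale[OF w x])
      have "N x' = t * N x" using N_scale[OF xE] t by (simp add: x'_def)
      then have "N x' = r / 2" using Nx by (simp add: t_def)
      define e' where "e' = t * e / (2 * C)"
      have e': "e' > 0" using t e C_pos by (simp add: e'_def)
      have "x0 - (0 - x') \<in> ?X" by (intro closed_span_diff[OF w] zero x0 x')
      then obtain z1 where z1: "z1 \<in> bounded_expansions w (real M)" "N (x0 + x' - z1) < e'"
        using x0(3)[of "x0 + x'" e'] e' \<open>N x' = r / 2\<close> x0(2) by auto
      obtain z2 where z2: "z2 \<in> bounded_expansions w (real M)" "N (x0 - z2) < e'"
        using x0(3)[of x0 e'] e' x0(1,2) N_zero by (metis diff_self)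
      have E: "x0 \<in> E" "x' \<in> E" "z1 \<in> E" "z2 \<in> E"
        using x0 x' z1 z2 XE by (auto simp: bounded_expansions_def)
      have "N (x' - (z1 - z2)) = N ((x0 + x' - z1) - (x0 - z2))" by (simp add: algebra_simps)
      also have "\<dots> \<le> C * (N (x0 + x' - z1) + N (x0 - z2))"
        by (rule N_diff) (intro E E_closed)+
      also have "\<dots> < C * (e' + e')"
        using z1 z2 C_pos by (intro mult_strict_left_mono add_strict_mono) auto
      also have "\<dots> = t * e" using C_pos by (simp add: e'_def)
      finally have close: "N (x' - (z1 - z2)) < t * e" .
      define y where "y = s (of_real (1 / t)) (z1 - z2)"
      have y: "y \<in> bounded_expansions w (norm (of_real (1 / t) :: 'k) * (C * (real M + real M)))"
        unfolding y_def by (intro bounded_expansions_scale[OF w] bounded_expansions_diff[OF w] z1 z2)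
      have "norm (of_real (1 / t) :: 'k) * (C * (real M + real M)) = K * N x"
        using t Nx x0(2) unfolding norm_of_real by (simp add: K_def t_def field_simps)
      then have yb: "y \<in> bounded_expansions w (K * N x)" using y by simp
      have "x - y = s (of_real (1 / t)) (x' - (z1 - z2))"
        using t by (simp add: y_def x'_def scale_right_diff_distrib flip: of_real_mult)
      then have "N (x - y) = 1 / t * N (x' - (z1 - z2))"
        using N_scale[of "x' - (z1 - z2)" "of_real (1 / t)"] E E_closed(3) t
        by (simp add: norm_divide)
      moreover have "1 / t * N (x' - (z1 - z2)) < 1 / t * (t * e)"
        using close t by (intro mult_strict_left_mono) auto
      ultimately have "N (x - y) < e" using t by simp
      with yb show ?thesis by blast
    qed
  qed
qed

section \<open>The basis constant and tails of a basic sequence\<close>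

lemma norm_coeff_le:
  assumes w: "range w \<subseteq> E" "N (w n) = 1" and "\<And>m. N (psum w a m) \<le> M"
  shows "norm (a n) \<le> 2 * C * M"
proof -
  have "s (a n) (w n) = psum w a (Suc n) - psum w a n" by (simp add: psum_def)
  then have "norm (a n) = N (psum w a (Suc n) - psum w a n)"
    using N_scale[of "w n" "a n"] w by (simp add: range_subsetD)
  also have "\<dots> \<le> C * (N (psum w a (Suc n)) + N (psum w a n))"
    by (rule N_diff; rule psum_in_E[OF w(1)])
  also have "\<dots> \<le> C * (M + M)" using assms(3) C_pos by (intro mult_left_mono add_mono) auto
  finally show ?thesis by simp
qed

lemma N_psum_tendsto_0:
  assumes w: "range w \<subseteq> E" and "\<And>n. (\<lambda>j. b j n) \<longlonglongrightarrow> 0"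
  shows "(\<lambda>j. N (psum w (b j) m)) \<longlonglongrightarrow> 0"
proof (rule tendsto_sandwich[where f="\<lambda>_. 0" and h="\<lambda>j. \<Sum>n<m. C ^ Suc n * (norm (b j n) * N (w n))"])
  show "\<forall>\<^sub>F j in sequentially. 0 \<le> N (psum w (b j) m)"
    by (intro always_eventually allI N_nonneg psum_in_E[OF w])
  have "N (psum w (b j) m) \<le> (\<Sum>n<m. C ^ Suc n * N (s (b j n) (w n)))" for j
    unfolding psum_def using w by (intro N_sum E_closed(4)) auto
  then show "\<forall>\<^sub>F j in sequentially. N (psum w (b j) m) \<le> (\<Sum>n<m. C ^ Suc n * (norm (b j n) * N (w n)))"
    using w by (intro always_eventually allI) (simp add: N_scale range_subsetD)
  have "(\<lambda>j. \<Sum>n<m. C ^ Suc n * (norm (b j n) * N (w n))) \<longlonglongrightarrow> (\<Sum>n<m. C ^ Suc n * (norm (0::'k) * N (w n)))"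
    by (intro tendsto_intros assms)
  then show "(\<lambda>j. \<Sum>n<m. C ^ Suc n * (norm (b j n) * N (w n))) \<longlonglongrightarrow> 0" by simp
qed simp

text \<open>Second half of the open mapping argument: \<open>x\<close> is a series of approximants
  \<open>y j\<close> whose expansions \<open>b j\<close> have partial sums of order
  \<open>q ^ j\<close>. The coefficients add up to an expansion of \<open>x\<close> with controlled
  partial sums, and by uniqueness every expansion of \<open>x\<close> is this one.\<close>

lemma basis_constant:
  assumes complete: "quasi_norm_complete E N" and basic: "basic_sequence s E N w" and nw: "\<And>n. N (w n) = 1"
  obtains K where "0 \<le> K"
    "\<And>x a m. x \<in> closed_span s E N (range w) \<Longrightarrow> expands w x a \<Longrightarrow> N (psum w a m) \<le> K * N x"
proof -
  let ?X = "closed_span s E N (range w)"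
  have w: "range w \<subseteq> E" using basic by (simp add: basic_sequence_def)
  have XE: "?X \<subseteq> E" by (rule closed_span_subset)
  obtain K where K: "0 \<le> K"
    "\<And>x e. x \<in> ?X \<Longrightarrow> e > 0 \<Longrightarrow> \<exists>y\<in>bounded_expansions w (K * N x). N (x - y) < e"
    using approximate_bounded_expansions[OF complete basic] by blast
  have main: "\<exists>a. expands w x a \<and> (\<forall>m. N (psum w a m) \<le> 2 * C\<^sup>2 * K * N x)"
    if x: "x \<in> ?X" and Nx: "N x > 0" for x
  proof -
    let ?\<nu> = "N x"
    \<comment> \<open>\<open>u\<close> is what remains of \<open>x\<close>, \<open>y\<close> an
      approximant of \<open>u\<close>, and \<open>b\<close> the expansion of \<open>y\<close>. The
      clause for \<open>j = 0\<close> fixes the start of the dependent choice.\<close>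
    define P where "P = (\<lambda>j (u, y, b). (j = 0 \<longrightarrow> u = x) \<and> u \<in> ?X \<and> N u \<le> ?\<nu> * q ^ j \<and> y \<in> ?X \<and> expands w y b \<and>
      (\<forall>m. N (psum w b m) \<le> K * ?\<nu> * q ^ j) \<and> N (u - y) \<le> ?\<nu> * q ^ Suc j)"
    define Q where "Q = (\<lambda>(j::nat) (u, y::'z, b::nat \<Rightarrow> 'k) (u', y'::'z, b'::nat \<Rightarrow> 'k). u' = u - y)"
    have step: "\<exists>y b. P j (u, y, b)" if that': "u \<in> ?X" "N u \<le> ?\<nu> * q ^ j" "j = 0 \<longrightarrow> u = x" for j u
    proof -
      have "?\<nu> * q ^ Suc j > 0" using Nx q_pos by simp
      then obtain y where y: "y \<in> bounded_expansions w (K * N u)" "N (u - y) < ?\<nu> * q ^ Suc j"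
        using K(2)[OF that'(1)] by blast
      then obtain b where b: "y \<in> ?X" "expands w y b" "\<And>m. N (psum w b m) \<le> K * N u"
        unfolding bounded_expansions_def by blast
      have "K * N u \<le> K * ?\<nu> * q ^ j"
        using mult_left_mono[OF that'(2) K(1)] by (simp add: mult.assoc)
      then have "\<forall>m. N (psum w b m) \<le> K * ?\<nu> * q ^ j" using b(3) order_trans by blast
      then have "P j (u, y, b)" using that' b(1,2) y(2) unfolding P_def by simp
      then show ?thesis by blast
    qed
    have "\<exists>f. \<forall>j. P j (f j) \<and> Q j (f j) (f (Suc j))"
    proof (rule dependent_nat_choice)
      show "\<exists>p. P 0 p" using step[of x 0] x by auto
      fix p j assume "P j p"
      then obtain u y b where p: "p = (u, y, b)" "P j (u, y, b)" by (cases p) auto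
      then have "u - y \<in> ?X" "N (u - y) \<le> ?\<nu> * q ^ Suc j"
        unfolding P_def using closed_span_diff[OF w] by auto
      then have "\<exists>y' b'. P (Suc j) (u - y, y', b')" by (intro step) auto
      then show "\<exists>p'. P (Suc j) p' \<and> Q j p p'" unfolding Q_def p by auto
    qed
    then obtain f where f: "\<And>j. P j (f j)" "\<And>j. Q j (f j) (f (Suc j))" by blast
    define u y b where "u = (\<lambda>j. fst (f j))" and "y = (\<lambda>j. fst (snd (f j)))" and "b = (\<lambda>j. snd (snd (f j)))"
    have feq: "f j = (u j, y j, b j)" for j by (simp add: u_def y_def b_def)
    have u0: "u 0 = x" using f(1)[of 0] unfolding feq P_def by simp
    have u: "u j \<in> ?X" "N (u j) \<le> ?\<nu> * q ^ j" and y: "y j \<in> ?X" "expands w (y j) (b j)"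
      and b: "\<And>m. N (psum w (b j) m) \<le> K * ?\<nu> * q ^ j" and uSuc: "u (Suc j) = u j - y j" for j
      using f[of j] unfolding feq P_def Q_def by auto
    have E: "u j \<in> E" "y j \<in> E" for j using u y XE by auto
    have ueq: "u j = x - (\<Sum>i<j. y i)" for j
      by (induction j) (auto simp: uSuc u0)
    let ?R = "\<lambda>J. K * ?\<nu> * q ^ J"
    have R0: "0 \<le> ?R J" for J using K(1) Nx q_pos by simp
    have bsum: "summable (\<lambda>j. b j n)" for n
    proof (rule summable_comparison_test'[where g="\<lambda>j. 2 * C * (K * ?\<nu>) * q ^ j"])
      show "summable (\<lambda>j. 2 * C * (K * ?\<nu>) * q ^ j)"
        using q_pos q_less_1 by (intro summable_mult summable_geometric) simp
      show "norm (b j n) \<le> 2 * C * (K * ?\<nu>) * q ^ j" if "j \<ge> 0" for j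
        using norm_coeff_le[OF w nw b, of j n] by (simp add: mult.assoc)
    qed
    define a where "a = (\<lambda>n. \<Sum>j. b j n)"
    define Y where "Y = (\<lambda>m J. \<Sum>j<J. psum w (b j) m)"
    have YE: "Y m J \<in> E" for m J unfolding Y_def by (intro E_sum psum_in_E[OF w])
    have Y_eq: "Y m J = psum w (\<lambda>n. \<Sum>j<J. b j n) m" for m J
      unfolding Y_def psum_def by (simp add: scale_sum_left sum.swap[of _ "{..<m}"])
    \<comment> \<open>The estimate is uniform in \<open>m\<close>. Completeness gives a limit
      \<open>z\<close> of \<open>Y m J\<close> as \<open>J\<close> grows; convergence of the
      finitely many coefficients involved identifies \<open>z\<close> with
      \<open>psum w a m\<close>.\<close>
    have tail: "N (psum w a m - Y m J) \<le> 2 * C\<^sup>2 * ?R J" for m J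
    proof -
      have "N (Y m (Suc J) - Y m J) \<le> ?R J" for J using b[of J m] by (simp add: Y_def)
      then obtain z where z: "z \<in> E" "\<And>J. N (z - Y m J) \<le> 2 * C\<^sup>2 * ?R J"
        using geometric_limit[OF complete, of "Y m" ?R] YE by (auto simp: mult_ac)
      have T: "psum w a m \<in> E" by (rule psum_in_E[OF w])
      have lim1: "(\<lambda>J. N (psum w (\<lambda>n. a n - (\<Sum>j<J. b j n)) m)) \<longlonglongrightarrow> 0"
      proof (rule N_psum_tendsto_0[OF w])
        fix n
        have "(\<lambda>J. \<Sum>j<J. b j n) \<longlonglongrightarrow> a n" unfolding a_def by (rule summable_LIMSEQ[OF bsum])
        then show "(\<lambda>J. a n - (\<Sum>j<J. b j n)) \<longlonglongrightarrow> 0"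
          using tendsto_diff[OF tendsto_const[of "a n"]] by fastforce
      qed
      have lim2: "(\<lambda>J. 2 * C\<^sup>2 * ?R J) \<longlonglongrightarrow> 0"
        using q_power_tendsto[of "2 * C\<^sup>2 * (K * ?\<nu>)"] by (simp add: mult.assoc)
      have "(\<lambda>J. C * (2 * C\<^sup>2 * ?R J + N (psum w (\<lambda>n. a n - (\<Sum>j<J. b j n)) m))) \<longlonglongrightarrow> 0"
        by (intro tendsto_mult_right_zero tendsto_add_zero lim1 lim2)
      moreover have "N (z - psum w a m) \<le> C * (2 * C\<^sup>2 * ?R J + N (psum w (\<lambda>n. a n - (\<Sum>j<J. b j n)) m))" for J
      proof -
        have "N (z - psum w a m) \<le> C * (N (z - Y m J) + N (Y m J - psum w a m))"
          by (rule N_triangle) (use z T YE in auto)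
        also have "\<dots> \<le> C * (2 * C\<^sup>2 * ?R J + N (psum w a m - Y m J))"
          using z(2)[of J] N_minus_commute[OF T YE, of m J] C_pos by (intro mult_left_mono) auto
        finally show ?thesis by (simp add: psum_diff Y_eq)
      qed
      ultimately have "N (z - psum w a m) \<le> 0" by (intro tendsto_lowerbound) auto
      then have "z = psum w a m"
        using N_nonneg[OF E_closed(3)[OF z(1) T]] N_eq_0_iff[OF E_closed(3)[OF z(1) T]] by simp
      then show ?thesis using z(2) by blast
    qed
    have "N (psum w a m) \<le> 2 * C\<^sup>2 * K * ?\<nu>" for m
      using tail[of m 0] by (simp add: Y_def mult.assoc)
    moreover have "expands w x a"
      unfolding expands_def
    proof (rule LIMSEQ_I)
      fix e :: real assume e: "e > 0"
      \<comment> \<open>\<open>?c * q ^ J\<close> collects the two errors that are uniform in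
        \<open>m\<close>: the remainder of \<open>x\<close> after \<open>J\<close> approximants and
        \<open>tail\<close>. Once \<open>J\<close> is fixed, \<open>?D\<close> is a finite sum of
        terms that tend to 0 in \<open>m\<close>.\<close>
      let ?c = "C * (?\<nu> + C * (2 * C\<^sup>2 * (K * ?\<nu>)))"
      obtain J where J: "?c * q ^ J < e / 2"
        using order_tendstoD(2)[OF q_power_tendsto[of ?c], of "e / 2"] e eventually_happens by force
      let ?D = "\<lambda>m. \<Sum>j<J. C ^ Suc j * N (y j - psum w (b j) m)"
      have "(\<lambda>m. C * (C * ?D m)) \<longlonglongrightarrow> 0"
        using y(2) unfolding expands_def by (intro tendsto_mult_right_zero tendsto_null_sum) auto
      then have "\<forall>\<^sub>F m in sequentially. C * (C * ?D m) < e / 2"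
        using order_tendstoD(2)[of _ 0 _ "e / 2"] e by force
      then obtain M where M: "\<And>m. m \<ge> M \<Longrightarrow> C * (C * ?D m) < e / 2"
        unfolding eventually_sequentially by blast
      have "N (x - psum w a m) < e" if "m \<ge> M" for m
      proof -
        have T: "psum w a m \<in> E" by (rule psum_in_E[OF w])
        have Sy: "(\<Sum>j<J. y j) \<in> E" by (intro E_sum E)
        have xE: "x \<in> E" using x XE by blast
        have "N ((\<Sum>j<J. y j) - Y m J) \<le> ?D m"
          unfolding Y_def sum_subtractf[symmetric] by (intro N_sum E_closed(3) E psum_in_E[OF w])
        moreover have "N (Y m J - psum w a m) \<le> 2 * C\<^sup>2 * ?R J"
          using tail[of m J] N_minus_commute[OF T YE] by simp
        moreover have "N ((\<Sum>j<J. y j) - psum w a m) \<le> C * (N ((\<Sum>j<J. y j) - Y m J) + N (Y m J - psum w a m))"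
          by (rule N_triangle[OF Sy YE T])
        ultimately have "N ((\<Sum>j<J. y j) - psum w a m) \<le> C * (?D m + 2 * C\<^sup>2 * ?R J)"
          using C_pos by (smt (verit) mult_left_mono)
        moreover have "N (x - (\<Sum>j<J. y j)) \<le> ?\<nu> * q ^ J" using u(2)[of J] by (simp add: ueq)
        moreover have "N (x - psum w a m) \<le> C * (N (x - (\<Sum>j<J. y j)) + N ((\<Sum>j<J. y j) - psum w a m))"
          by (rule N_triangle[OF xE Sy T])
        ultimately have "N (x - psum w a m) \<le> C * (?\<nu> * q ^ J + C * (?D m + 2 * C\<^sup>2 * ?R J))"
          using C_pos by (smt (verit) mult_left_mono)
        also have "\<dots> = ?c * q ^ J + C * (C * ?D m)" by (simp add: algebra_simps)
        finally show ?thesis using J M[OF that] by linarith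
      qed
      moreover have "0 \<le> N (x - psum w a m)" for m
        using x XE by (intro N_nonneg E_closed(3) psum_in_E[OF w]) auto
      ultimately show "\<exists>M. \<forall>m\<ge>M. norm (N (x - psum w a m) - 0) < e" by auto
    qed
    ultimately show ?thesis by blast
  qed
  show ?thesis
  proof
    show "0 \<le> 2 * C\<^sup>2 * K" using K(1) by simp
    fix x a m assume x: "x \<in> ?X" and a: "expands w x a"
    have xE: "x \<in> E" using x XE by blast
    show "N (psum w a m) \<le> 2 * C\<^sup>2 * K * N x"
    proof (cases "x = 0")
      case True
      \<comment> \<open>The iteration needs \<open>N x > 0\<close> for positive error margins; for
        the zero vector the claim is uniqueness of the expansion.\<close>
      have "expands w 0 (\<lambda>_. 0)" by (simp add: expands_def psum_def N_zero)
      then have "a = (\<lambda>_. 0)" using basic_sequence_expansion(2)[OF basic x] a True by blast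
      then show ?thesis using True by (simp add: psum_def N_zero)
    next
      case False
      then have "N x > 0" using N_nonneg[OF xE] N_eq_0_iff[OF xE] by simp
      then show ?thesis using main[OF x] basic_sequence_expansion(2)[OF basic x a] by blast
    qed
  qed
qed

text \<open>A finite linear combination, padded by zeros, is its own expansion; this makes the
  coefficients of \<open>x\<close> comparable with those of nearby tail vectors.\<close>

lemma span_tail_psum:
  assumes "z \<in> span (w ` {k..})"
  shows "\<exists>b m0. (\<forall>n<k. b n = 0) \<and> (\<forall>m\<ge>m0. psum w b m = z)"
  using assms
proof (induction rule: span_induct_alt)
  case base
  show ?case by (intro exI[of _ "\<lambda>_. 0"] exI[of _ 0]) (simp add: psum_def)
next
  case (step c x y)
  then obtain b m0 n where b: "\<forall>n<k. b n = 0" "\<forall>m\<ge>m0. psum w b m = y" and n: "n \<ge> k" "x = w n" by auto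
  let ?b = "\<lambda>i. (if i = n then c else 0) + b i"
  have "psum w ?b m = s c x + y" if "m \<ge> max m0 (Suc n)" for m
  proof -
    have "psum w ?b m = (\<Sum>i<m. s (if i = n then c else 0) (w i)) + psum w b m"
      by (simp add: psum_def scale_left_distrib sum.distrib)
    also have "(\<Sum>i<m. s (if i = n then c else 0) (w i)) = (\<Sum>i<m. if i = n then s c (w i) else 0)"
      by (intro sum.cong) auto
    also have "\<dots> = s c (w n)" using that by simp
    finally show ?thesis using b that n by simp
  qed
  then show ?case using b(1) n(1) by (intro exI[of _ ?b] exI[of _ "max m0 (Suc n)"]) auto
qed

text \<open>Subtracting a vector \<open>z\<close> of the tail span from \<open>k\<close> on leaves
  the first \<open>k\<close> coefficients of \<open>x\<close> unchanged. So
  \<open>basis_constant\<close> bounds the k-th partial sum of \<open>x\<close> by a multiple of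
  \<open>N (x - z)\<close>, which is arbitrarily small, and all partial sums vanish.\<close>

lemma basic_sequence_tails:
  assumes complete: "quasi_norm_complete E N" and basic: "basic_sequence s E N w" and nw: "\<And>n. N (w n) = 1"
    and xE: "x \<in> E" and tails: "\<And>k e. e > 0 \<Longrightarrow> \<exists>z\<in>span (w ` {k..}). N (x - z) < e"
  shows "x = 0"
proof -
  let ?X = "closed_span s E N (range w)"
  have w: "range w \<subseteq> E" using basic by (simp add: basic_sequence_def)
  obtain K where K: "0 \<le> K" "\<And>x a m. x \<in> ?X \<Longrightarrow> expands w x a \<Longrightarrow> N (psum w a m) \<le> K * N x"
    using basis_constant[OF complete basic nw] by blast
  have sub: "span (w ` {k..}) \<subseteq> span (range w)" for k by (intro span_mono) auto
  have x: "x \<in> ?X" unfolding closed_span_def using xE tails[of _ 0] sub[of 0] by blast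
  then obtain a where a: "expands w x a" using basic_sequence_expansion(1)[OF basic] by blast
  have "psum w a k = 0" for k
  proof -
    have "N (psum w a k) \<le> e" if e: "e > 0" for e
    proof -
      have "e / (K + 1) > 0" using e K(1) by simp
      then obtain z where z: "z \<in> span (w ` {k..})" "N (x - z) < e / (K + 1)" using tails by blast
      obtain b m0 where b: "\<forall>n<k. b n = 0" "\<forall>m\<ge>m0. psum w b m = z" using span_tail_psum[OF z(1)] by blast
      have zX: "z \<in> ?X" using z(1) sub[of k] span_subset_closed_span[OF w] by blast
      have zE: "z \<in> E" using zX closed_span_subset by blast
      have "expands w z b"
        unfolding expands_def
        by (rule tendsto_eventually) (use b(2) N_zero in \<open>auto simp: eventually_sequentially intro!: exI[of _ m0]\<close>)
      then have "expands w (x - z) (\<lambda>n. a n - b n)" by (rule expands_diff[OF w xE zE a])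
      then have "N (psum w (\<lambda>n. a n - b n) k) \<le> K * N (x - z)"
        using K(2) closed_span_diff[OF w x zX] by blast
      moreover have "psum w (\<lambda>n. a n - b n) k = psum w a k" using b(1) by (simp add: psum_def)
      moreover have "K * N (x - z) \<le> (K + 1) * N (x - z)"
        using N_nonneg[OF E_closed(3)[OF xE zE]] by (simp add: mult_right_mono)
      moreover have "(K + 1) * N (x - z) < e" using z(2) K(1) by (simp add: pos_less_divide_eq mult.commute)
      ultimately show ?thesis by simp
    qed
    then have "N (psum w a k) \<le> 0" by (metis field_le_epsilon add_0)
    then show ?thesis using N_nonneg N_eq_0_iff psum_in_E[OF w] by (metis order_antisym)
  qed
  then have "(\<lambda>m. N x) \<longlonglongrightarrow> 0" using a by (simp add: expands_def)
  then show "x = 0" using N_eq_0_iff[OF xE] by (simp add: LIMSEQ_const_iff)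
qed

section \<open>Perturbation and limits of basic sequences\<close>

lemma psum_perturb:
  assumes "\<And>n. x n \<in> E" "\<And>n. z n \<in> E" and close: "\<And>n. N (x n - z n) \<le> M * q ^ n"
    and a: "\<And>n. n < m \<Longrightarrow> norm (a n) \<le> G" and G: "0 \<le> G"
  shows "N (psum x a m - psum z a m) \<le> 2 * C * (G * M)"
proof -
  have M: "0 \<le> M"
    using close[of 0] N_nonneg[OF E_closed(3)[OF assms(1,2)], of 0 0] by simp
  have "psum x a m - psum z a m = (\<Sum>n<m. s (a n) (x n - z n))"
    by (simp add: psum_def sum_subtractf scale_right_diff_distrib)
  moreover have "N (s (a n) (x n - z n)) \<le> (G * M) * q ^ n" if "n < m" for n
  proof -
    have "N (s (a n) (x n - z n)) = norm (a n) * N (x n - z n)" by (intro N_scale E_closed assms)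
    also have "\<dots> \<le> G * (M * q ^ n)"
      using a[OF that] close G N_nonneg E_closed(3) assms(1,2) by (intro mult_mono) auto
    finally show ?thesis by (simp add: mult.assoc)
  qed
  ultimately show ?thesis
    using N_sum_geometric[of m _ "G * M"] G M E_closed assms(1,2) by simp
qed

text \<open>Since only the error of a tail has to be small compared with the lower constant \<open>A\<close>, the
  constant \<open>M\<close> may be arbitrary.\<close>

lemma perturbation:
  fixes G :: "(nat \<Rightarrow> 'k) \<Rightarrow> nat \<Rightarrow> real"
  assumes xz: "\<And>n. x n \<in> E" "\<And>n. z n \<in> E" and close: "\<And>n. N (x n - z n) \<le> M * q ^ n"
    and A: "0 < A" and B: "0 < B" and \<kappa>: "0 < \<kappa>"
    and G: "\<And>a m n. n < m \<Longrightarrow> norm (a n) \<le> \<kappa> * G a m" "\<And>a m. 0 \<le> G a m"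
    and z: "\<And>a m k. k \<ge> k0 \<Longrightarrow> A * G a m \<le> N (psum (\<lambda>n. z (n + k)) a m) \<and>
      N (psum (\<lambda>n. z (n + k)) a m) \<le> B * G a m"
  obtains k A' B' where "0 < A'" "0 < B'"
    "\<And>a m. A' * G a m \<le> N (psum (\<lambda>n. x (n + k)) a m) \<and> N (psum (\<lambda>n. x (n + k)) a m) \<le> B' * G a m"
proof -
  have M: "0 \<le> M" using close[of 0] N_nonneg[OF E_closed(3)[OF xz], of 0 0] by simp
  \<comment> \<open>\<open>psum_perturb\<close> for the shifted sequences produces this factor in
    front of \<open>G a m\<close>. Below \<open>A / (2 * C)\<close>, half of \<open>A\<close> is
    left after one quasi-triangle inequality.\<close>
  have "\<forall>\<^sub>F k in sequentially. 2 * C * \<kappa> * M * q ^ k < A / (2 * C)"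
    using order_tendstoD(2)[OF q_power_tendsto] A C_pos by simp
  then have "\<forall>\<^sub>F k in sequentially. 2 * C * \<kappa> * M * q ^ k < A / (2 * C) \<and> k \<ge> k0"
    using eventually_ge_at_top by (rule eventually_conj)
  then obtain k where k: "2 * C * \<kappa> * M * q ^ k < A / (2 * C)" "k \<ge> k0"
    using eventually_happens by fastforce
  have bounds: "A / (2 * C) * G a m \<le> N (psum (\<lambda>n. x (n + k)) a m) \<and>
      N (psum (\<lambda>n. x (n + k)) a m) \<le> C * (A + B) * G a m" for a m
  proof -
    define X Z where "X = psum (\<lambda>n. x (n + k)) a m" and "Z = psum (\<lambda>n. z (n + k)) a m"
    have XZ: "X \<in> E" "Z \<in> E" unfolding X_def Z_def by (intro psum_in_E; use xz in auto)+
    have "N (X - Z) \<le> 2 * C * (\<kappa> * G a m * (M * q ^ k))"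
      unfolding X_def Z_def
    proof (rule psum_perturb)
      show "N (x (n + k) - z (n + k)) \<le> M * q ^ k * q ^ n" for n
        using close[of "n + k"] by (simp add: power_add mult_ac)
    qed (use xz G \<kappa> in auto)
    also have "\<dots> = (2 * C * \<kappa> * M * q ^ k) * G a m" by simp
    also have "\<dots> \<le> A / (2 * C) * G a m" using k(1) G(2) by (intro mult_right_mono) auto
    finally have XmZ: "N (X - Z) \<le> A / (2 * C) * G a m" .
    have Zb: "A * G a m \<le> N Z" "N Z \<le> B * G a m" using z[OF k(2)] by (auto simp: Z_def)
    have "A * G a m \<le> C * (N (X - Z) + N X)"
      using N_le_N_diff[OF XZ(2,1)] N_minus_commute[OF XZ] Zb(1) by simp
    also have "\<dots> \<le> C * (A / (2 * C) * G a m + N X)" using XmZ C_pos by simp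
    also have "\<dots> = A * G a m / 2 + C * N X" using C_pos by (simp add: distrib_left)
    finally have "A * G a m / 2 \<le> C * N X" by simp
    then have lower: "A / (2 * C) * G a m \<le> N X" using C_pos by (simp add: field_simps)
    have "A / (2 * C) \<le> A" using A C_ge_1 by (simp add: field_simps)
    then have "A / (2 * C) * G a m \<le> A * G a m" using G(2) by (intro mult_right_mono)
    then have "N (X - Z) + N Z \<le> (A + B) * G a m" using XmZ Zb(2) by (simp add: distrib_right)
    then have "N X \<le> C * ((A + B) * G a m)"
      using N_le_N_diff[OF XZ] C_pos by (smt (verit) mult_left_mono)
    with lower show ?thesis by (simp add: X_def mult.assoc)
  qed
  show ?thesis
    by (rule that[OF _ _ bounds]) (use A B C_pos in auto)
qed

text \<open>A basic sequence cannot cluster around a nonzero vector: if its terms differ from \<open>x\<close> by a sequence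
  with \<open>o(m)\<close> sums, their Cesaro means converge to \<open>x\<close>, which then lies in every tail span.\<close>

lemma basic_sequence_weak_limit_0:
  assumes complete: "quasi_norm_complete E N" and basic: "basic_sequence s E N w" and nw: "\<And>n. N (w n) = 1"
    and r: "strict_mono r" and xE: "x \<in> E" and zE: "\<And>n. z n \<in> E"
    and close: "\<And>n. N (w (r n) - (x + z n)) \<le> M * q ^ n"
    and z: "\<And>k m. N (psum (\<lambda>n. z (n + k)) (\<lambda>_. 1) m) \<le> B * h m" and h: "(\<lambda>m. h m / real m) \<longlonglongrightarrow> 0"
  shows "x = 0"
proof (rule basic_sequence_tails[OF complete basic nw xE])
  fix k and e :: real assume e: "e > 0"
  have w: "range w \<subseteq> E" using basic by (simp add: basic_sequence_def)
  have M: "0 \<le> M"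
    using close[of 0] N_nonneg[OF E_closed(3)[OF _ E_closed(2)[OF xE zE]], of "w (r 0)" 0] range_subsetD[OF w] by simp
  \<comment> \<open>The two summands are the accumulated perturbation, at most
    \<open>2 * C * M\<close> for any number of terms, and the sum of the blocks, both divided by
    \<open>m\<close>.\<close>
  have "(\<lambda>m. C * (2 * C * M * (1 / real m) + B * (h m / real m))) \<longlonglongrightarrow> C * (2 * C * M * 0 + B * 0)"
    by (intro tendsto_intros h lim_1_over_n)
  then have "\<forall>\<^sub>F m in sequentially. C * (2 * C * M * (1 / real m) + B * (h m / real m)) < e"
    using order_tendstoD(2)[of _ 0 _ e] e by simp
  then have "\<forall>\<^sub>F m in sequentially. C * (2 * C * M * (1 / real m) + B * (h m / real m)) < e \<and> m > 0"
    using eventually_gt_at_top by (rule eventually_conj)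
  then obtain m where m: "C * (2 * C * M * (1 / real m) + B * (h m / real m)) < e" "m > 0"
    using eventually_happens by fastforce
  define S where "S = (\<Sum>n<m. w (r (n + k)))"
  define y where "y = s (of_real (1 / real m)) S"
  have "w (r (n + k)) \<in> w ` {k..}" for n
    using strict_mono_imp_increasing[OF r, of "n + k"] by (intro imageI) simp
  then have "y \<in> span (w ` {k..})"
    unfolding y_def S_def by (intro span_scale span_sum span_base)
  moreover have "N (x - y) < e"
  proof -
    let ?w = "\<lambda>n. w (r (n + k))" and ?z = "\<lambda>n. x + z (n + k)"
    have wE: "?w n \<in> E" for n using w by auto
    have SE: "S \<in> E" unfolding S_def by (intro E_sum wE)
    let ?Z = "psum (\<lambda>n. z (n + k)) (\<lambda>_. 1) m"
    have ZE: "?Z \<in> E" using zE by (intro psum_in_E) auto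
    define mx where "mx = s (of_nat m) x"
    have mxE: "mx \<in> E" using xE E_closed by (simp add: mx_def)
    have mx: "(\<Sum>n<m. x) = mx"
      unfolding mx_def by (induction m) (simp_all add: scale_left_distrib add.commute)
    have "S - mx = (psum ?w (\<lambda>_. 1) m - psum ?z (\<lambda>_. 1) m) + ?Z"
      by (simp add: psum_def S_def sum.distrib mx)
    then have "N (S - mx) \<le> C * (N (psum ?w (\<lambda>_. 1) m - psum ?z (\<lambda>_. 1) m) + N ?Z)"
      using wE zE xE ZE by (metis (no_types, lifting) N_add E_closed(2,3) psum_in_E image_subset_iff)
    also have "\<dots> \<le> C * (2 * C * (1 * M) + B * h m)"
    proof -
      have "N (psum ?w (\<lambda>_. 1) m - psum ?z (\<lambda>_. 1) m) \<le> 2 * C * (1 * M)"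
      proof (rule psum_perturb)
        show "N (?w n - ?z n) \<le> M * q ^ n" for n
        proof -
          have "q ^ (n + k) \<le> q ^ n" using q_pos q_less_1 by (intro power_decreasing) auto
          then show ?thesis using close[of "n + k"] M by (smt (verit) mult_left_mono)
        qed
      qed (use wE zE xE E_closed in auto)
      then show ?thesis using z[of k m] C_pos by (intro mult_left_mono add_mono) auto
    qed
    finally have bound: "N (S - mx) \<le> C * (2 * C * M + B * h m)" by simp
    have "y - x = s (of_real (1 / real m)) (S - mx)"
      using m(2) by (simp add: y_def mx_def scale_right_diff_distrib)
    then have "N (y - x) = 1 / real m * N (S - mx)"
      using N_scale[of "S - mx" "of_real (1 / real m)"] SE mxE E_closed(3) by (simp add: norm_divide)
    also have "\<dots> \<le> 1 / real m * (C * (2 * C * M + B * h m))" using bound by (intro mult_left_mono) auto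
    also have "\<dots> = C * (2 * C * M * (1 / real m) + B * (h m / real m))" using m(2) by (simp add: field_simps)
    finally have "N (y - x) < e" using m(1) by simp
    moreover have "y \<in> E" using SE E_closed by (simp add: y_def)
    ultimately show ?thesis using N_minus_commute[OF xE] by simp
  qed
  ultimately show "\<exists>z\<in>span (w ` {k..}). N (x - z) < e" by blast
qed

end

section \<open>Block sequences in twisted sums\<close>

lemma Omega_zero: "Omega \<phi> 0 = 0"
  by (simp add: Omega_def fun_eq_iff)

text \<open>The whole theorem rests on the following pointwise estimate: on the support of the block \<open>v n\<close> the
  arguments of \<open>\<phi>\<close> in \<open>\<Omega>(\<Sum> a\<^sub>n v\<^sub>n)\<close> and \<open>\<Sum> a\<^sub>n \<Omega>(v\<^sub>n)\<close> differ by exactly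
  \<open>ln (\<bar>a\<^sub>n\<bar> \<parallel>v\<^sub>n\<parallel> / \<parallel>\<Sum> a\<^sub>k v\<^sub>k\<parallel>)\<close>, which turns the bi-Lipschitz condition into a two-sided bound.\<close>

lemma Omega_disjoint_sum:
  fixes v :: "nat \<Rightarrow> nat \<Rightarrow> 'k::real_normed_field" and a :: "nat \<Rightarrow> 'k" and m :: nat
  assumes lip: "\<And>s t. 0 \<le> s \<Longrightarrow> 0 \<le> t \<Longrightarrow>
      \<beta> * \<bar>s - t\<bar> \<le> norm (\<phi> s - \<phi> t) \<and> norm (\<phi> s - \<phi> t) \<le> \<alpha> * \<bar>s - t\<bar>"
    and pos: "0 < \<alpha>" "0 < \<beta>" and v: "\<And>n. v n \<in> c00" and dis: "disjoint_seq v"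
  defines "b \<equiv> \<lambda>n. norm (a n) * ell2_norm (v n)"
  defines "\<Delta> \<equiv> (\<lambda>i. \<Sum>n<m. a n * Omega \<phi> (v n) i) - Omega \<phi> (\<lambda>i. \<Sum>n<m. a n * v n i)"
  shows "ell2_norm \<Delta> \<le> \<alpha> * L2_set (\<lambda>n. b n * ln (b n / L2_set b {..<m})) {..<m}"
    and "\<beta> * L2_set (\<lambda>n. b n * ln (b n / L2_set b {..<m})) {..<m} \<le> ell2_norm \<Delta>"
    and "\<Delta> \<in> ell2"
proof -
  define x where "x = (\<lambda>i. \<Sum>n<m. a n * v n i)"
  let ?B = "L2_set b {..<m}"
  define l where "l = (\<lambda>n. ln (b n / ?B))"
  \<comment> \<open>\<open>g\<close> is the model for \<Delta>: each entry is the entry of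
    \<open>x\<close> times the difference of the two arguments of \<phi>. Being a combination of the
    \<open>v n\<close>, it has the logarithmic sum as its norm by Pythagoras.\<close>
  define c where "c = (\<lambda>n. a n * of_real (l n))"
  define g where "g = (\<lambda>i. \<Sum>n<m. c n * v n i)"
  have vE: "v n \<in> ell2" for n using v c00_subset_ell2 by blast
  have xE: "x \<in> ell2" and nx: "ell2_norm x = ?B"
    unfolding x_def b_def using ell2_disjoint_sum[OF dis vE] ell2_norm_disjoint_sum[OF dis vE] by auto
  have pointwise: "norm (\<Delta> i) \<le> \<alpha> * norm (g i) \<and> \<beta> * norm (g i) \<le> norm (\<Delta> i)" for i
  proof (cases "\<exists>k<m. v k i \<noteq> 0 \<and> a k \<noteq> 0")
    \<comment> \<open>Blocks with \<open>a k = 0\<close> are put into this case: their logarithms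
      would be taken at 0, while all three sums vanish.\<close>
    case False
    then have "a n * Omega \<phi> (v n) i = 0" "a n * v n i = 0" "c n * v n i = 0" if "n < m" for n
      using that by (auto simp: Omega_def c_def)
    then have "(\<Sum>n<m. a n * Omega \<phi> (v n) i) = 0" "x i = 0" "g i = 0"
      unfolding x_def g_def by (auto intro!: sum.neutral)
    then have "\<Delta> i = 0" "g i = 0" by (simp_all add: \<Delta>_def Omega_def flip: x_def)
    then show ?thesis by simp
  next
    case True
    then obtain k where k: "k < m" "v k i \<noteq> 0" "a k \<noteq> 0" by blast
    have single: "(\<Sum>n<m. f n) = f k" if "\<And>n. v n i = 0 \<Longrightarrow> f n = 0" for f :: "nat \<Rightarrow> 'k"
      by (rule disjoint_seq_sum_eq[OF dis k(2,1)]) (rule that)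
    have xi: "x i = a k * v k i" unfolding x_def by (rule single) simp
    have gi: "g i = c k * v k i" unfolding g_def by (rule single) simp
    have "(\<Sum>n<m. a n * Omega \<phi> (v n) i) = a k * Omega \<phi> (v k) i"
      by (rule single) (simp add: Omega_def)
    then have \<Delta>i: "\<Delta> i = a k * Omega \<phi> (v k) i - Omega \<phi> x i" by (simp add: \<Delta>_def x_def)
    define t s where "t = - ln (norm (v k i) / ell2_norm (v k))" and "s = - ln (norm (x i) / ell2_norm x)"
    have le: "norm (v k i) \<le> ell2_norm (v k)" "norm (x i) \<le> ell2_norm x"
      using norm_le_ell2_norm vE xE by auto
    have p: "0 < norm (v k i)" "0 < ell2_norm (v k)" "0 < norm (x i)" "0 < ell2_norm x"
      using k xi le by (auto intro: less_le_trans[OF _ le(1)] less_le_trans[OF _ le(2)])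
    have "0 \<le> t" "0 \<le> s" using p le by (auto simp: t_def s_def)
    note lip' = lip[OF this]
    have "t - s = ln (b k / ?B)"
      using p k(3) unfolding t_def s_def b_def xi
      by (simp add: ln_div ln_mult norm_mult flip: nx b_def)
    then have "norm (g i) = norm (x i) * \<bar>t - s\<bar>" by (simp add: gi c_def l_def xi norm_mult)
    moreover have "\<Delta> i = x i * (\<phi> t - \<phi> s)"
      using k p by (simp add: \<Delta>i Omega_def t_def s_def xi algebra_simps)
    then have "norm (\<Delta> i) = norm (x i) * norm (\<phi> t - \<phi> s)" by (simp add: norm_mult)
    ultimately show ?thesis
      using mult_left_mono[OF conjunct1[OF lip'], of "norm (x i)"]
        mult_left_mono[OF conjunct2[OF lip'], of "norm (x i)"] by (simp add: mult.left_commute)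
  qed
  have lb: "ln (b n / ?B) = l n" for n by (simp add: l_def)
  have gE: "g \<in> ell2" unfolding g_def by (rule ell2_disjoint_sum[OF dis vE])
  have "ell2_norm g = L2_set (\<lambda>n. norm (c n) * ell2_norm (v n)) {..<m}"
    unfolding g_def by (rule ell2_norm_disjoint_sum[OF dis vE])
  also have "\<dots> = L2_set (\<lambda>n. b n * ln (b n / ?B)) {..<m}"
    unfolding lb by (simp add: L2_set_def c_def b_def norm_mult power_mult_distrib mult_ac)
  finally have ng: "ell2_norm g = L2_set (\<lambda>n. b n * ln (b n / ?B)) {..<m}" .
  show \<Delta>: "\<Delta> \<in> ell2" by (rule ell2_mono[OF gE]) (use pointwise in blast)
  show "ell2_norm \<Delta> \<le> \<alpha> * L2_set (\<lambda>n. b n * ln (b n / ?B)) {..<m}"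
    using ell2_norm_mono[OF gE, of \<Delta> \<alpha>] pointwise pos ng by simp
  have "norm (g i) \<le> 1 / \<beta> * norm (\<Delta> i)" for i
    using pointwise[of i] pos by (simp add: field_simps)
  from ell2_norm_mono[OF \<Delta> this] show "\<beta> * L2_set (\<lambda>n. b n * ln (b n / ?B)) {..<m} \<le> ell2_norm \<Delta>"
    using pos ng by (simp add: field_simps)
qed

text \<open>The sorts admit the real and the complex scalars at once; \<open>heine_borel\<close>
  provides the coordinatewise convergent subsequences. Of the completion the locale records
  completeness, density, the quasi-norm on the dense subspace and the bounded second
  coordinate.\<close>

locale twisted_sum = quasi_normed pair_scale E N C
  for E :: "((nat \<Rightarrow> 'k) \<times> (nat \<Rightarrow> 'k::{real_normed_field,banach,heine_borel})) set" and N C +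
  fixes \<phi> :: "real \<Rightarrow> 'k" and \<alpha> \<beta> D :: real
  assumes complete: "quasi_norm_complete E N"
    and lip: "\<And>s t. 0 \<le> s \<Longrightarrow> 0 \<le> t \<Longrightarrow>
      \<beta> * \<bar>s - t\<bar> \<le> norm (\<phi> s - \<phi> t) \<and> norm (\<phi> s - \<phi> t) \<le> \<alpha> * \<bar>s - t\<bar>"
    and \<alpha>_pos: "0 < \<alpha>" and \<beta>_pos: "0 < \<beta>"
    and incl: "ell2 \<times> c00 \<subseteq> E"
    and N_phi_norm: "\<And>z. z \<in> ell2 \<times> c00 \<Longrightarrow> N z = phi_norm \<phi> z"
    and dense: "\<And>z e. z \<in> E \<Longrightarrow> e > 0 \<Longrightarrow> \<exists>z'\<in>ell2 \<times> c00. N (z - z') < e"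
    and snd_ell2: "\<And>z. z \<in> E \<Longrightarrow> snd z \<in> ell2"
    and snd_le: "\<And>z. z \<in> E \<Longrightarrow> ell2_norm (snd z) \<le> D * N z"
    and D_nonneg: "0 \<le> D"
begin

section \<open>Twisted coordinates on the dense subspace\<close>

lemma pair_in_E: "y \<in> ell2 \<Longrightarrow> x \<in> c00 \<Longrightarrow> (y, x) \<in> E"
  using incl by blast

lemma Omega_ell2: "x \<in> c00 \<Longrightarrow> Omega \<phi> x \<in> ell2"
  using Omega_c00 c00_subset_ell2 by blast

lemma zero_c00: "0 \<in> c00"
  by (simp add: c00_def)

text \<open>Coordinates in which the quasi-norm splits as \<open>ell2_norm y + ell2_norm x\<close>.
  They are not linear in \<open>x\<close>; the block estimates measure the defect.\<close>

definition twist :: "(nat \<Rightarrow> 'k) \<Rightarrow> (nat \<Rightarrow> 'k) \<Rightarrow> (nat \<Rightarrow> 'k) \<times> (nat \<Rightarrow> 'k)" where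
  "twist y x = (y + Omega \<phi> x, x)"

lemma twist_in_E: "y \<in> ell2 \<Longrightarrow> x \<in> c00 \<Longrightarrow> twist y x \<in> E"
  unfolding twist_def by (intro pair_in_E ell2_add Omega_ell2)

lemma N_twist: "y \<in> ell2 \<Longrightarrow> x \<in> c00 \<Longrightarrow> N (twist y x) = ell2_norm y + ell2_norm x"
  unfolding twist_def by (subst N_phi_norm) (auto simp: phi_norm_def ell2_add Omega_ell2)

lemma psum_pair:
  "psum (\<lambda>n. (u n, v n)) a m = ((\<lambda>i. \<Sum>n<m. a n * u n i), (\<lambda>i. \<Sum>n<m. a n * v n i))"
  unfolding psum_def
  by (induction m) (auto simp: pair_scale_def seq_scale_def fun_eq_iff zero_prod_def)

text \<open>A combination of blocks is again of the form \<open>twist (Y + \<Delta>) x\<close>, so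
  its norm is \<open>ell2_norm (Y + \<Delta>) + ell2_norm x\<close>. The rest is the triangle
  inequality and the two-sided bound on \<Delta> from \<open>Omega_disjoint_sum\<close>. The last
  lower bound is the one that remains useful when all \<open>v n\<close> vanish.\<close>

lemma
  fixes a :: "nat \<Rightarrow> 'k" and m :: nat
  assumes v: "\<And>n. v n \<in> c00" "disjoint_seq v" and y: "\<And>n. y n \<in> ell2" "disjoint_seq y"
  defines "b \<equiv> \<lambda>n. norm (a n) * ell2_norm (v n)" and "c \<equiv> \<lambda>n. norm (a n) * ell2_norm (y n)"
  defines "\<Lambda> \<equiv> L2_set (\<lambda>n. b n * ln (b n / L2_set b {..<m})) {..<m}"
    and "\<nu> \<equiv> N (psum (\<lambda>n. twist (y n) (v n)) a m)"
  shows N_psum_twist_le: "\<nu> \<le> L2_set c {..<m} + \<alpha> * \<Lambda> + L2_set b {..<m}"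
    and N_psum_twist_ge: "L2_set b {..<m} \<le> \<nu>" "\<beta> * \<Lambda> \<le> \<nu> + L2_set c {..<m}"
      "L2_set c {..<m} \<le> \<nu> + \<alpha> * \<Lambda>"
proof -
  define x where "x = (\<lambda>i. \<Sum>n<m. a n * v n i)"
  define Y where "Y = (\<lambda>i. \<Sum>n<m. a n * y n i)"
  define \<Delta> where "\<Delta> = (\<lambda>i. \<Sum>n<m. a n * Omega \<phi> (v n) i) - Omega \<phi> x"
  have vE: "v n \<in> ell2" for n using v c00_subset_ell2 by blast
  have nx: "ell2_norm x = L2_set b {..<m}" and nY: "ell2_norm Y = L2_set c {..<m}"
    unfolding x_def Y_def b_def c_def
    using ell2_norm_disjoint_sum[OF v(2) vE] ell2_norm_disjoint_sum[OF y(2,1)] by auto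
  have YE: "Y \<in> ell2" unfolding Y_def by (rule ell2_disjoint_sum[OF y(2,1)])
  have \<Delta>: "ell2_norm \<Delta> \<le> \<alpha> * \<Lambda>" "\<beta> * \<Lambda> \<le> ell2_norm \<Delta>" "\<Delta> \<in> ell2"
    unfolding \<Delta>_def x_def \<Lambda>_def b_def
    by (rule Omega_disjoint_sum[OF lip \<alpha>_pos \<beta>_pos v]; simp)+
  have "finite (\<Union>n\<in>{..<m}. {i. v n i \<noteq> 0})" using v(1) by (auto simp: c00_def)
  moreover have "{i. x i \<noteq> 0} \<subseteq> (\<Union>n\<in>{..<m}. {i. v n i \<noteq> 0})"
    unfolding x_def using sum.not_neutral_contains_not_neutral by fastforce
  ultimately have xc: "x \<in> c00" unfolding c00_def using finite_subset by blast
  have "psum (\<lambda>n. twist (y n) (v n)) a m = twist (Y + \<Delta>) x"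
    unfolding twist_def psum_pair Y_def \<Delta>_def x_def
    by (auto simp: fun_eq_iff distrib_left sum.distrib)
  then have eq: "\<nu> = ell2_norm (Y + \<Delta>) + ell2_norm x"
    unfolding \<nu>_def using N_twist[OF ell2_add[OF YE \<Delta>(3)] xc] by simp
  show "\<nu> \<le> L2_set c {..<m} + \<alpha> * \<Lambda> + L2_set b {..<m}"
    using ell2_norm_add[OF YE \<Delta>(3)] \<Delta>(1) eq nx nY by linarith
  have YD: "0 \<le> ell2_norm (Y + \<Delta>)" by (rule ell2_norm_ge_0[OF ell2_add[OF YE \<Delta>(3)]])
  show "L2_set b {..<m} \<le> \<nu>" using eq nx YD by simp
  have x0: "0 \<le> ell2_norm x" by (simp add: nx)
  have "ell2_norm \<Delta> \<le> ell2_norm (Y + \<Delta>) + ell2_norm Y" "ell2_norm Y \<le> ell2_norm (Y + \<Delta>) + ell2_norm \<Delta>"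
    using ell2_norm_diff[OF ell2_add[OF YE \<Delta>(3)] YE] ell2_norm_diff[OF ell2_add[OF YE \<Delta>(3)] \<Delta>(3)] by auto
  then show "\<beta> * \<Lambda> \<le> \<nu> + L2_set c {..<m}" "L2_set c {..<m} \<le> \<nu> + \<alpha> * \<Lambda>"
    using \<Delta>(1,2) eq nx nY x0 by linarith+
qed

text \<open>As \<open>ell2_norm (v n)\<close> is at least \<mu>, the \<open>y\<close>-blocks are
  dominated by the \<open>v\<close>-blocks and the norm is equivalent to \<open>log_len b m\<close>;
  \<open>log_len_quasi_mono\<close> exchanges \<open>b n\<close> and \<open>norm (a n)\<close> in
  both directions. The constants precede \<open>v\<close> and \<open>y\<close> because they must
  serve all shifts of a block sequence at once.\<close>

lemma twisted_blocks_bounds: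
  fixes \<Phi> :: "real \<Rightarrow> real"
  assumes \<Phi>: "orlicz_function \<Phi>" "\<Phi> \<in> \<Theta>[at_right 0](\<lambda>t. t\<^sup>2 * (ln t)\<^sup>2)"
    and R: "0 < \<mu>" "0 < R"
  shows "\<exists>A>0. \<exists>B>0. \<forall>v y a m.
    (\<forall>n. v n \<in> c00 \<and> \<mu> \<le> ell2_norm (v n) \<and> ell2_norm (v n) \<le> R) \<and> disjoint_seq v \<and>
    (\<forall>n. y n \<in> ell2 \<and> ell2_norm (y n) \<le> R) \<and> disjoint_seq y \<longrightarrow>
    A * log_len (\<lambda>n. norm (a n)) m \<le> N (psum (\<lambda>n. twist (y n) (v n)) a m) \<and>
    N (psum (\<lambda>n. twist (y n) (v n)) a m) \<le> B * log_len (\<lambda>n. norm (a n)) m"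
proof -
  obtain K1 where K1: "K1 > 0"
    "\<And>b c m. (\<And>n. 0 \<le> b n) \<Longrightarrow> (\<And>n. b n \<le> R * c n) \<Longrightarrow> log_len b m \<le> K1 * log_len c m"
    using log_len_quasi_mono[OF \<Phi> R(2)] by metis
  obtain K2 where K2: "K2 > 0"
    "\<And>b c m. (\<And>n. 0 \<le> b n) \<Longrightarrow> (\<And>n. b n \<le> 1 / \<mu> * c n) \<Longrightarrow> log_len b m \<le> K2 * log_len c m"
    using log_len_quasi_mono[OF \<Phi>, of "1 / \<mu>"] R(1) by (metis divide_pos_pos zero_less_one)
  let ?U = "1 + R / \<mu> + \<alpha>" and ?V = "1 + (1 + R / \<mu>) / \<beta>"
  have UV: "0 < ?U" "0 < ?V" using R \<alpha>_pos \<beta>_pos by (auto intro!: add_pos_pos divide_pos_pos)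
  show ?thesis
  proof (rule exI[of _ "1 / (K2 * ?V)"], rule conjI, goal_cases)
    case 1
    then show ?case using K2 UV by simp
  next
    case 2
    have "0 < ?U * K1" using K1 UV by simp
    moreover have "1 / (K2 * ?V) * log_len (\<lambda>n. norm (a n)) m \<le> N (psum (\<lambda>n. twist (y n) (v n)) a m) \<and>
        N (psum (\<lambda>n. twist (y n) (v n)) a m) \<le> ?U * K1 * log_len (\<lambda>n. norm (a n)) m"
      if v: "\<And>n. v n \<in> c00" "disjoint_seq v" and y: "\<And>n. y n \<in> ell2" "disjoint_seq y"
        and bd: "\<And>n. \<mu> \<le> ell2_norm (v n)" "\<And>n. ell2_norm (v n) \<le> R" "\<And>n. ell2_norm (y n) \<le> R"
      for v y :: "nat \<Rightarrow> nat \<Rightarrow> 'k" and a :: "nat \<Rightarrow> 'k" and m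
    proof -
      define b c where "b = (\<lambda>n. norm (a n) * ell2_norm (v n))" and "c = (\<lambda>n. norm (a n) * ell2_norm (y n))"
      define \<Lambda> where "\<Lambda> = L2_set (\<lambda>n. b n * ln (b n / L2_set b {..<m})) {..<m}"
      define \<nu> where "\<nu> = N (psum (\<lambda>n. twist (y n) (v n)) a m)"
      have up: "\<nu> \<le> L2_set c {..<m} + \<alpha> * \<Lambda> + L2_set b {..<m}"
        and lo: "L2_set b {..<m} \<le> \<nu>" "\<beta> * \<Lambda> \<le> \<nu> + L2_set c {..<m}"
        unfolding \<nu>_def \<Lambda>_def b_def c_def
        by (rule N_psum_twist_le[OF v y] N_psum_twist_ge[OF v y])+
      have b0: "0 \<le> b n" for n using ell2_norm_ge_0[of "v n"] v(1)[of n] c00_subset_ell2 by (auto simp: b_def)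
      have c0: "0 \<le> c n" for n using ell2_norm_ge_0[OF y(1)] by (simp add: c_def)
      have "c n \<le> R / \<mu> * b n" for n
      proof -
        have "ell2_norm (y n) \<le> R / \<mu> * \<mu>" using bd(3) R by simp
        also have "\<dots> \<le> R / \<mu> * ell2_norm (v n)" using bd(1) R by (intro mult_left_mono) auto
        finally show ?thesis
          using mult_left_mono[of "ell2_norm (y n)" "R / \<mu> * ell2_norm (v n)" "norm (a n)"]
          by (simp add: b_def c_def mult_ac)
      qed
      then have "L2_set c {..<m} \<le> L2_set (\<lambda>n. R / \<mu> * b n) {..<m}" by (intro L2_set_mono c0)
      also have "\<dots> = R / \<mu> * L2_set b {..<m}" using R L2_set_mult_left[of "R / \<mu>" b] by simp
      finally have cb: "L2_set c {..<m} \<le> R / \<mu> * L2_set b {..<m}" .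
      have ll: "log_len b m = L2_set b {..<m} + \<Lambda>" by (simp add: log_len_def \<Lambda>_def)
      have L0: "0 \<le> \<Lambda>" "0 \<le> L2_set b {..<m}" by (simp_all add: \<Lambda>_def)
      have "\<nu> \<le> ?U * log_len b m"
      proof -
        have "\<nu> \<le> R / \<mu> * L2_set b {..<m} + \<alpha> * \<Lambda> + L2_set b {..<m}" using up cb by linarith
        also have "\<dots> \<le> ?U * L2_set b {..<m} + ?U * \<Lambda>"
          using L0 R \<alpha>_pos by (simp add: algebra_simps add_nonneg_nonneg)
        finally show ?thesis by (simp add: ll distrib_left)
      qed
      also have "\<dots> \<le> ?U * (K1 * log_len (\<lambda>n. norm (a n)) m)"
        using UV bd(2) b0 by (intro mult_left_mono K1(2)) (auto simp: b_def mult.commute mult_right_mono)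
      finally have upper: "\<nu> \<le> ?U * K1 * log_len (\<lambda>n. norm (a n)) m" by (simp add: mult.assoc)
      have "log_len (\<lambda>n. norm (a n)) m \<le> K2 * log_len b m"
      proof (rule K2(2))
        show "norm (a n) \<le> 1 / \<mu> * b n" for n
          using mult_left_mono[OF bd(1)[of n], of "norm (a n)"] R by (simp add: b_def field_simps)
      qed simp
      also have "\<dots> \<le> K2 * (?V * \<nu>)"
      proof (rule mult_left_mono)
        have "\<beta> * \<Lambda> \<le> \<nu> + R / \<mu> * \<nu>"
          using lo cb mult_left_mono[OF lo(1), of "R / \<mu>"] R by simp
        then have "\<Lambda> \<le> (1 + R / \<mu>) / \<beta> * \<nu>" using \<beta>_pos by (simp add: field_simps)
        then show "log_len b m \<le> ?V * \<nu>" using lo(1) by (simp add: ll distrib_right)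
      qed (use K2 in simp)
      finally have "1 / (K2 * ?V) * log_len (\<lambda>n. norm (a n)) m \<le> \<nu>"
        using K2(1) UV(2) by (simp add: pos_divide_le_eq mult_ac)
      with upper show ?thesis by (simp add: \<nu>_def)
    qed
    ultimately show ?case by blast
  qed
qed

end

section \<open>Subsequences of basic sequences\<close>

lemma subseq_eventually:
  assumes "\<And>n :: nat. \<forall>\<^sub>F m in sequentially. P n m"
  obtains r where "strict_mono (r :: nat \<Rightarrow> nat)" "\<And>n. P n (r n)"
proof -
  have ex: "\<exists>m>k. P n m" for n k
    using eventually_happens[OF eventually_conj[OF assms[of n] eventually_gt_at_top[of k]]] by auto
  have "\<exists>r. \<forall>n. P n (r n) \<and> r n < r (Suc n)"
    by (rule dependent_nat_choice) (use ex in blast)+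
  then show ?thesis using that by (auto simp: strict_mono_Suc_iff)
qed

context twisted_sum
begin

lemma N_pair_0: "y \<in> ell2 \<Longrightarrow> N (y, 0) = ell2_norm y"
  using N_twist[of y 0] zero_c00 by (simp add: twist_def Omega_zero ell2_norm_zero)

lemma N_twist_0: "x \<in> c00 \<Longrightarrow> N (twist 0 x) = ell2_norm x"
  using N_twist[of 0 x] ell2_zero by (simp add: ell2_norm_zero)

lemma norm_snd_le: "z \<in> E \<Longrightarrow> norm (snd z i) \<le> D * N z"
  using norm_le_ell2_norm[OF snd_ell2] snd_le order_trans by blast

text \<open>The pieces \<open>d j\<close> of \<open>v\<close> are finitely supported with norms of
  order \<open>q ^ j\<close>, and \<open>twist 0 (d j)\<close> lifts each with the same norm, so the
  lifts can be summed in \<open>E\<close>. Boundedness of the second coordinate identifies the image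
  of the sum.\<close>

lemma quotient_map_surj:
  assumes v: "v \<in> ell2"
  obtains \<xi> where "\<xi> \<in> E" "snd \<xi> = v"
proof -
  have "\<exists>k. ell2_norm (restr {k..} v) \<le> q ^ j" for j
    using order_tendstoD(2)[OF ell2_tail_tendsto_0[OF v], of "q ^ j"] q_pos
    by (auto simp: eventually_sequentially intro: less_imp_le)
  then obtain k where k: "\<And>j. ell2_norm (restr {k j..} v) \<le> q ^ j" by metis
  \<comment> \<open>\<open>k\<close> need not be increasing, as the differences telescope anyway.
    The head before \<open>k 0\<close> is left out; it is finitely supported and is lifted
    separately at the end.\<close>
  define d where "d = (\<lambda>j. restr {..<k (Suc j)} v - restr {..<k j} v)"
  have d: "d j \<in> c00" for j unfolding d_def by (intro c00_diff restr_c00) auto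
  have "d j = restr {k j..} v - restr {k (Suc j)..} v" for j
    by (auto simp: d_def restr_def fun_eq_iff)
  then have nd1: "ell2_norm (d j) \<le> q ^ j + q ^ Suc j" for j
    using ell2_norm_diff[OF restr_ell2[OF v] restr_ell2[OF v], of "{k j..}" "{k (Suc j)..}"] k[of j] k[of "Suc j"]
    by simp
  have "q ^ Suc j \<le> q ^ j" for j using q_pos q_less_1 by (intro power_decreasing) auto
  then have nd: "ell2_norm (d j) \<le> 2 * q ^ j" for j
    using nd1[of j] by (metis add_left_mono mult_2 order_trans)
  define X where "X = (\<lambda>j. \<Sum>i<j. twist 0 (d i))"
  have XE: "X j \<in> E" for j unfolding X_def by (intro E_sum twist_in_E ell2_zero d)
  have "N (X (Suc j) - X j) \<le> 2 * q ^ j" for j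
    using N_twist_0[OF d] nd[of j] by (simp add: X_def)
  moreover have "2 * q ^ Suc j \<le> q * (2 * q ^ j)" for j by simp
  ultimately obtain \<xi> where \<xi>: "\<xi> \<in> E" "\<And>j. N (\<xi> - X j) \<le> 2 * C\<^sup>2 * (2 * q ^ j)"
    using geometric_limit[OF complete, of X "\<lambda>j. 2 * q ^ j"] XE by blast
  have sndX: "snd (X j) = restr {..<k j} v - restr {..<k 0} v" for j
    unfolding X_def by (induction j) (auto simp: twist_def d_def)
  have "snd \<xi> i = restr {k 0..} v i" for i
  proof -
    have le: "norm (snd \<xi> i - restr {k 0..} v i) \<le> (D * (4 * C\<^sup>2) + 1) * q ^ j" for j
    proof -
      have "snd \<xi> i - restr {k 0..} v i = snd (\<xi> - X j) i - restr {k j..} v i"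
        by (auto simp: sndX restr_def)
      then have "norm (snd \<xi> i - restr {k 0..} v i) \<le> norm (snd (\<xi> - X j) i) + norm (restr {k j..} v i)"
        by (metis norm_triangle_ineq4)
      also have "norm (snd (\<xi> - X j) i) \<le> D * N (\<xi> - X j)" by (intro norm_snd_le E_closed \<xi> XE)
      also have "\<dots> \<le> D * (2 * C\<^sup>2 * (2 * q ^ j))" using \<xi>(2) D_nonneg by (intro mult_left_mono)
      also have "norm (restr {k j..} v i) \<le> q ^ j"
        using norm_le_ell2_norm[OF restr_ell2[OF v]] k order_trans by blast
      finally show ?thesis by (simp add: algebra_simps)
    qed
    have "norm (snd \<xi> i - restr {k 0..} v i) \<le> 0"
      by (rule tendsto_lowerbound[OF q_power_tendsto]) (use le in \<open>auto intro: always_eventually\<close>)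
    then show ?thesis by simp
  qed
  then have "snd (\<xi> + twist 0 (restr {..<k 0} v)) = v"
    by (auto simp: twist_def restr_def fun_eq_iff)
  moreover have "\<xi> + twist 0 (restr {..<k 0} v) \<in> E"
    by (intro E_closed \<xi> twist_in_E ell2_zero restr_c00) simp
  ultimately show ?thesis using that by blast
qed

text \<open>\<omega> has two parts: a lift \<xi> of the coordinatewise limit of the v-coordinates,
  and \<open>(y1, 0)\<close> from the limit of the remaining \<open>ell2\<close> part. The second
  hump changes only the \<open>y\<close>-part and merely passes to a subsequence of the
  \<open>v\<close>-blocks.\<close>

lemma bounded_sequence_blocks:
  assumes wE: "\<And>n. w n \<in> E" and bounded: "\<And>n. N (w n) \<le> 1"
  obtains r \<omega> v y R M where "strict_mono (r :: nat \<Rightarrow> nat)" "\<omega> \<in> E" "0 < R"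
    "\<And>n. v n \<in> c00" "disjoint_seq v" "\<And>n. ell2_norm (v n) \<le> R"
    "\<And>n. y n \<in> c00" "disjoint_seq y" "\<And>n. ell2_norm (y n) \<le> R"
    "\<And>n. N (w (r n) - (\<omega> + twist (y n) (v n))) \<le> M * q ^ n"
proof -
  have "snd (w n) \<in> ell2" "ell2_norm (snd (w n)) \<le> D" for n
    using snd_ell2[OF wE] snd_le[OF wE, of n] mult_left_mono[OF bounded[of n] D_nonneg] by auto
  then obtain r1 v0 where r1: "strict_mono r1" "\<And>i. (\<lambda>n. snd (w (r1 n)) i) \<longlonglongrightarrow> v0 i" and v0: "v0 \<in> ell2"
    using bounded_ell2_pointwise_subseq[of "\<lambda>n. snd (w n)" D] by metis
  obtain \<xi> where \<xi>: "\<xi> \<in> E" "snd \<xi> = v0" using quotient_map_surj[OF v0] by blast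
  have "\<exists>p. p \<in> ell2 \<times> c00 \<and> N (w (r1 n) - \<xi> - p) \<le> q ^ n" for n
    using dense[of "w (r1 n) - \<xi>" "q ^ n"] wE \<xi> E_closed(3) q_pos by (meson less_imp_le zero_less_power)
  then obtain p where p: "\<And>n. p n \<in> ell2 \<times> c00" "\<And>n. N (w (r1 n) - \<xi> - p n) \<le> q ^ n" by metis
  define u x where "u = (\<lambda>n. fst (p n))" and "x = (\<lambda>n. snd (p n))"
  have ux: "p n = (u n, x n)" "u n \<in> ell2" "x n \<in> c00" for n using p(1)[of n] by (auto simp: u_def x_def)
  have xE: "x n \<in> ell2" for n using ux c00_subset_ell2 by blast
  have pE: "p n \<in> E" for n using p(1) incl by blast
  have xlim: "(\<lambda>n. x n i) \<longlonglongrightarrow> 0" for i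
  proof -
    have "(\<lambda>n. snd (w (r1 n) - \<xi> - p n) i) \<longlonglongrightarrow> 0"
    proof (rule Lim_null_comparison)
      show "(\<lambda>n. D * q ^ n) \<longlonglongrightarrow> 0" by (rule q_power_tendsto)
      have "norm (snd (w (r1 n) - \<xi> - p n) i) \<le> D * q ^ n" for n
        using norm_snd_le[of "w (r1 n) - \<xi> - p n" i] mult_left_mono[OF p(2)[of n] D_nonneg]
          wE \<xi> pE E_closed(3) by (meson order_trans)
      then show "\<forall>\<^sub>F n in sequentially. norm (snd (w (r1 n) - \<xi> - p n) i) \<le> D * q ^ n"
        by (rule always_eventually[OF allI])
    qed
    then have "(\<lambda>n. (snd (w (r1 n)) i - v0 i) - snd (w (r1 n) - \<xi> - p n) i) \<longlonglongrightarrow> (v0 i - v0 i) - 0"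
      by (intro tendsto_diff r1 tendsto_const)
    then show ?thesis by (simp add: \<xi> x_def)
  qed
  have q_pow: "0 < q ^ n" for n using q_pos by simp
  obtain r2 v where r2: "strict_mono r2" and v: "\<And>n. v n \<in> c00" "disjoint_seq v"
    and d: "\<And>n. ell2_norm (x (r2 n) - v n) \<le> q ^ n"
    using gliding_hump[of x "\<lambda>n. q ^ n", OF xE xlim q_pow] by blast
  define h where "h = (\<lambda>n. x (r2 n) - v n)"
  have hc: "h n \<in> c00" for n unfolding h_def by (intro c00_diff ux v)
  have nh: "ell2_norm (h n) \<le> q ^ n" for n using d by (simp add: h_def)
  \<comment> \<open>Subtracting both \<open>Omega\<close> terms makes \<open>p_split\<close> exact
    although \<open>Omega\<close> is not additive: the error \<open>h n\<close> enters as
    \<open>twist 0 (h n)\<close>, of norm \<open>ell2_norm (h n)\<close>.\<close>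
  define y0 where "y0 = (\<lambda>n. u (r2 n) - Omega \<phi> (h n) - Omega \<phi> (v n))"
  have y0E: "y0 n \<in> ell2" for n unfolding y0_def by (intro ell2_diff Omega_ell2 ux hc v)
  have p_split: "p (r2 n) = twist (y0 n) (v n) + twist 0 (h n)" for n
    by (simp add: ux twist_def y0_def h_def)
  have tE: "twist (y0 n) (v n) \<in> E" "twist 0 (h n) \<in> E" for n
    by (intro twist_in_E y0E v hc ell2_zero)+
  \<comment> \<open>From the inside out, the nested expressions bound \<open>w - \<xi>\<close>, its
    approximant \<open>p\<close> and \<open>twist (y0 n) (v n)\<close>, each by one quasi-triangle
    inequality.\<close>
  define R where "R = C * (C * (1 + C * (1 + N \<xi>)) + 1)"
  have q1: "q ^ n \<le> 1" for n using q_pos q_less_1 by (intro power_le_one) auto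
  have sum_le: "ell2_norm (y0 n) + ell2_norm (v n) \<le> R" for n
  proof -
    have "N (w (r1 (r2 n)) - \<xi>) \<le> C * (1 + N \<xi>)"
      using N_diff[OF wE \<xi>(1), of "r1 (r2 n)"] bounded[of "r1 (r2 n)"] C_pos by (smt (verit) mult_left_mono)
    moreover have "N (p (r2 n)) \<le> C * (N (p (r2 n) - (w (r1 (r2 n)) - \<xi>)) + N (w (r1 (r2 n)) - \<xi>))"
      by (rule N_le_N_diff) (intro pE wE \<xi> E_closed)+
    moreover have "N (p (r2 n) - (w (r1 (r2 n)) - \<xi>)) \<le> 1"
      using p(2)[of "r2 n"] q1[of "r2 n"] N_minus_commute[OF pE E_closed(3)[OF wE \<xi>(1)], of "r2 n" "r1 (r2 n)"]
      by simp
    ultimately have "N (p (r2 n)) \<le> C * (1 + C * (1 + N \<xi>))"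
      using C_pos by (smt (verit) mult_left_mono)
    moreover have "N (twist 0 (h n)) \<le> 1" using N_twist_0[OF hc, of n] nh[of n] q1[of n] by simp
    moreover have "N (twist (y0 n) (v n)) \<le> C * (N (p (r2 n)) + N (twist 0 (h n)))"
      using N_diff[OF pE tE(2), of "r2 n" n] by (simp add: p_split)
    ultimately have "N (twist (y0 n) (v n)) \<le> R"
      unfolding R_def using C_pos by (smt (verit) mult_left_mono)
    then show ?thesis using N_twist[OF y0E v(1)] by simp
  qed
  have nonneg: "0 \<le> ell2_norm (y0 n)" "0 \<le> ell2_norm (v n)" for n
    using ell2_norm_ge_0 y0E v c00_subset_ell2 by blast+
  have bd: "ell2_norm (y0 n) \<le> R" "ell2_norm (v n) \<le> R" for n
    using sum_le[of n] nonneg[of n] by auto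
  have R0: "0 \<le> R" using bd(1)[of 0] ell2_norm_ge_0[OF y0E[of 0]] by linarith
  obtain r3 y1 where r3: "strict_mono r3" "\<And>i. (\<lambda>n. y0 (r3 n) i) \<longlonglongrightarrow> y1 i" and y1: "y1 \<in> ell2" "ell2_norm y1 \<le> R"
    by (rule bounded_ell2_pointwise_subseq[of y0 R, OF y0E bd(1)]) (rule that; assumption)
  have "(\<lambda>n. (y0 (r3 n) - y1) i) \<longlonglongrightarrow> 0" for i
    using tendsto_diff[OF r3(2)[of i] tendsto_const[of "y1 i"]] by simp
  then obtain r4 y where r4: "strict_mono r4" and y: "\<And>n. y n \<in> c00" "disjoint_seq y"
    and g: "\<And>n. ell2_norm (y0 (r3 (r4 n)) - y1 - y n) \<le> q ^ n"
    using gliding_hump[of "\<lambda>n. y0 (r3 n) - y1" "\<lambda>n. q ^ n", OF ell2_diff[OF y0E y1(1)] _ q_pow] by blast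
  have yE: "y n \<in> ell2" for n using y c00_subset_ell2 by blast
  define t where "t = (\<lambda>n. r3 (r4 n))"
  have t: "strict_mono t" using r3(1) r4 by (simp add: t_def strict_mono_def)
  have ny: "ell2_norm (y n) \<le> 2 * R + 1" for n
  proof -
    have "y n = (y0 (t n) - y1) - (y0 (t n) - y1 - y n)" by simp
    then have "ell2_norm (y n) \<le> ell2_norm (y0 (t n) - y1) + ell2_norm (y0 (t n) - y1 - y n)"
      by (metis ell2_norm_diff ell2_diff y0E y1(1) yE)
    then show ?thesis
      using ell2_norm_diff[OF y0E y1(1), of "t n"] bd(1)[of "t n"] y1(2) g[of n] q1[of n]
      by (simp add: t_def)
  qed
  show ?thesis
  proof
    show "strict_mono (\<lambda>n. r1 (r2 (t n)))" using r1(1) r2 t by (simp add: strict_mono_def)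
    show "\<xi> + (y1, 0) \<in> E" by (intro E_closed \<xi> pair_in_E y1 zero_c00)
    show "0 < 2 * R + 1" using R0 by simp
    show "(v \<circ> t) n \<in> c00" for n using v by simp
    show "disjoint_seq (v \<circ> t)" by (rule disjoint_seq_comp[OF v(2) strict_mono_imp_inj_on[OF t]])
    show "ell2_norm ((v \<circ> t) n) \<le> 2 * R + 1" for n using bd(2)[of "t n"] R0 by simp
    \<comment> \<open>Three errors remain, from the approximation by \<open>p\<close> and from the
      two humps. Each is at most \<open>q ^ n\<close>, since passing to later indices only improves
      the bounds.\<close>
    show "N (w (r1 (r2 (t n))) - (\<xi> + (y1, 0) + twist (y n) ((v \<circ> t) n))) \<le> (C * (1 + C * 2)) * q ^ n" for n
    proof -
      let ?w = "w (r1 (r2 (t n)))" and ?g = "(y0 (t n) - y1 - y n, 0)"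
      have gE: "?g \<in> E" by (intro pair_in_E ell2_diff y0E y1 yE zero_c00)
      have eq: "?w - (\<xi> + (y1, 0) + twist (y n) ((v \<circ> t) n))
          = (?w - \<xi> - p (r2 (t n))) + (twist 0 (h (t n)) + ?g)"
        unfolding p_split by (simp add: twist_def prod_eq_iff algebra_simps)
      have "N (?w - (\<xi> + (y1, 0) + twist (y n) ((v \<circ> t) n)))
          \<le> C * (N (?w - \<xi> - p (r2 (t n))) + N (twist 0 (h (t n)) + ?g))"
        unfolding eq by (intro N_add E_closed wE \<xi> pE tE gE)
      also have "\<dots> \<le> C * (q ^ n + C * (q ^ n + q ^ n))"
      proof -
        have qle: "q ^ k \<le> q ^ n" if "n \<le> k" for k
          using q_pos q_less_1 that by (intro power_decreasing) auto
        have tn: "n \<le> t n" "n \<le> r2 (t n)"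
          using strict_mono_imp_increasing[OF t, of n] strict_mono_imp_increasing[OF r2, of "t n"] by auto
        have "N (?w - \<xi> - p (r2 (t n))) \<le> q ^ n" using p(2)[of "r2 (t n)"] qle[OF tn(2)] by simp
        moreover have "N (twist 0 (h (t n))) \<le> q ^ n" using N_twist_0[OF hc] nh[of "t n"] qle[OF tn(1)] by simp
        moreover have "N ?g \<le> q ^ n" using N_pair_0[OF ell2_diff[OF ell2_diff[OF y0E y1(1)] yE]] g by (simp add: t_def)
        moreover have "N (twist 0 (h (t n)) + ?g) \<le> C * (N (twist 0 (h (t n))) + N ?g)" by (rule N_add[OF tE(2) gE])
        ultimately show ?thesis using C_pos by (smt (verit) mult_left_mono)
      qed
      finally show ?thesis by (simp add: algebra_simps)
    qed
  qed (use y ny in auto)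
qed

lemma log_len_const_tendsto: "(\<lambda>m. log_len (\<lambda>_. 1) m / real m) \<longlonglongrightarrow> 0"
proof (rule tendsto_sandwich[where f="\<lambda>_. 0" and h="\<lambda>m. (sqrt m + sqrt m * ln (sqrt m)) / real m"])
  show "(\<lambda>m. (sqrt (real m) + sqrt (real m) * ln (sqrt (real m))) / real m) \<longlonglongrightarrow> 0" by real_asymp
qed (auto intro!: always_eventually divide_right_mono log_len_const_le simp: log_len_nonneg)

text \<open>When the \<open>v\<close>-blocks tend to zero, a sparse subsequence lets them be
  absorbed into the error, and the normalization of \<open>w\<close> keeps the
  \<open>y\<close>-blocks away from zero. The limit clause is attached to the \<open>ell2\<close>
  alternative so that this alternative can later be excluded.\<close>

lemma basic_sequence_dichotomy:
  assumes \<Phi>: "orlicz_function \<Phi>" "\<Phi> \<in> \<Theta>[at_right 0](\<lambda>t. t\<^sup>2 * (ln t)\<^sup>2)"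
    and w: "normalized_basic_sequence pair_scale E N w"
  obtains r A B where "strict_mono (r :: nat \<Rightarrow> nat)" "0 < A" "0 < B"
    "(\<forall>a m. A * log_len (\<lambda>n. norm (a n)) m \<le> N (psum (w \<circ> r) a m) \<and>
        N (psum (w \<circ> r) a m) \<le> B * log_len (\<lambda>n. norm (a n)) m) \<or>
     (\<forall>a m. A * L2_set (\<lambda>n. norm (a n)) {..<m} \<le> N (psum (w \<circ> r) a m) \<and>
        N (psum (w \<circ> r) a m) \<le> B * L2_set (\<lambda>n. norm (a n)) {..<m}) \<and>
     (\<lambda>n. ell2_norm (snd (w (r n)))) \<longlonglongrightarrow> 0"
proof -
  have basic: "basic_sequence pair_scale E N w" and nw: "\<And>n. N (w n) = 1"
    using w by (auto simp: normalized_basic_sequence_def)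
  have wE: "w n \<in> E" for n using basic by (auto simp: basic_sequence_def)
  obtain r \<omega> v y R M where r: "strict_mono r" "\<omega> \<in> E" "0 < R"
    and v: "\<And>n. v n \<in> c00" "disjoint_seq v" "\<And>n. ell2_norm (v n) \<le> R"
    and y: "\<And>n. y n \<in> c00" "disjoint_seq y" "\<And>n. ell2_norm (y n) \<le> R"
    and close: "\<And>n. N (w (r n) - (\<omega> + twist (y n) (v n))) \<le> M * q ^ n"
    by (rule bounded_sequence_blocks[of w, OF wE eq_refl[OF nw]]) (rule that; assumption)
  have yE: "y n \<in> ell2" for n using y c00_subset_ell2 by blast
  have tE: "twist (y n) (v n) \<in> E" for n by (intro twist_in_E yE v)
  have M: "0 \<le> M" using close[of 0] N_nonneg[OF E_closed(3)[OF wE E_closed(2)[OF r(2) tE]], of "r 0" 0] by simp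
  have qle: "q ^ k \<le> q ^ n" if "n \<le> k" for k n
    using q_pos q_less_1 that by (intro power_decreasing) auto
  show ?thesis
  proof (cases "(\<lambda>n. ell2_norm (v n)) \<longlonglongrightarrow> 0")
    case False
    moreover have "\<bar>ell2_norm (v n)\<bar> = ell2_norm (v n)" for n
      using ell2_norm_ge_0 v(1) c00_subset_ell2 by (metis abs_of_nonneg subsetD)
    ultimately obtain \<mu> where \<mu>: "\<mu> > 0" "\<not> (\<forall>\<^sub>F n in sequentially. ell2_norm (v n) < \<mu>)"
      unfolding tendsto_iff dist_real_def by auto
    then have "infinite {n. \<mu> \<le> ell2_norm (v n)}"
      unfolding cofinite_eq_sequentially[symmetric] eventually_cofinite by (simp add: not_less)
    then obtain s :: "nat \<Rightarrow> nat" where s: "strict_mono s" "\<And>n. \<mu> \<le> ell2_norm (v (s n))"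
      using infinite_enumerate by (metis mem_Collect_eq)
    obtain A B where AB: "0 < A" "0 < B" and bounds:
      "\<forall>v y a m. (\<forall>n. v n \<in> c00 \<and> \<mu> \<le> ell2_norm (v n) \<and> ell2_norm (v n) \<le> R) \<and> disjoint_seq v \<and>
         (\<forall>n. y n \<in> ell2 \<and> ell2_norm (y n) \<le> R) \<and> disjoint_seq y \<longrightarrow>
         A * log_len (\<lambda>n. norm (a n)) m \<le> N (psum (\<lambda>n. twist (y n) (v n)) a m) \<and>
         N (psum (\<lambda>n. twist (y n) (v n)) a m) \<le> B * log_len (\<lambda>n. norm (a n)) m"
      using twisted_blocks_bounds[OF \<Phi> \<mu>(1) r(3)] by blast
    define z where "z = (\<lambda>n. twist (y (s n)) (v (s n)))"
    have zE: "z n \<in> E" for n by (simp add: z_def tE)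
    have z: "A * log_len (\<lambda>n. norm (a n)) m \<le> N (psum (\<lambda>n. z (n + k)) a m) \<and>
        N (psum (\<lambda>n. z (n + k)) a m) \<le> B * log_len (\<lambda>n. norm (a n)) m" for a m k
    proof -
      have inj: "inj (\<lambda>n. s (n + k))" using s(1) by (auto simp: inj_def strict_mono_eq)
      show ?thesis
        unfolding z_def
        using bounds[rule_format, of "\<lambda>n. v (s (n + k))" "\<lambda>n. y (s (n + k))" a m]
          disjoint_seq_comp[OF v(2) inj] disjoint_seq_comp[OF y(2) inj] v y yE s(2)
        by (simp add: comp_def)
    qed
    have close': "N (w (r (s n)) - (\<omega> + z n)) \<le> M * q ^ n" for n
      using close[of "s n"] mult_left_mono[OF qle[OF strict_mono_imp_increasing[OF s(1), of n]] M]
      by (simp add: z_def)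
    have "\<omega> = 0"
    proof (rule basic_sequence_weak_limit_0[OF complete basic nw _ r(2) zE close' _ log_len_const_tendsto])
      show "strict_mono (\<lambda>n. r (s n))" using r(1) s(1) by (simp add: strict_mono_def)
      show "N (psum (\<lambda>n. z (n + k)) (\<lambda>_. 1) m) \<le> B * log_len (\<lambda>_. 1) m" for k m
        using z[of "\<lambda>_. 1" m k] by simp
    qed
    then have "N (w (r (s n)) - z n) \<le> M * q ^ n" for n using close'[of n] by simp
    note perturb = perturbation[OF wE zE this AB zero_less_one,
        of "\<lambda>a. log_len (\<lambda>n. norm (a n))", OF _ log_len_nonneg z]
    have coeff: "norm (a n) \<le> 1 * log_len (\<lambda>n. norm (a n)) m" if "n < m" for a :: "nat \<Rightarrow> 'k" and m n
      using le_log_len[OF that, of "\<lambda>n. norm (a n)"] by simp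
    obtain k A' B' where k: "0 < A'" "0 < B'"
      "\<And>a m. A' * log_len (\<lambda>n. norm (a n)) m \<le> N (psum (\<lambda>n. w (r (s (n + k)))) a m) \<and>
         N (psum (\<lambda>n. w (r (s (n + k)))) a m) \<le> B' * log_len (\<lambda>n. norm (a n)) m"
      by (rule perturb[OF coeff]) (assumption | rule that)+
    have "strict_mono (\<lambda>n. r (s (n + k)))" using r(1) s(1) by (simp add: strict_mono_def)
    then show ?thesis using that k by (auto simp: comp_def)
  next
    case True
    have "\<forall>\<^sub>F m in sequentially. ell2_norm (v m) < q ^ n" for n
      using order_tendstoD(2)[OF True, of "q ^ n"] q_pos by simp
    then obtain s where s: "strict_mono s" "\<And>n. ell2_norm (v (s n)) < q ^ n"
      using subseq_eventually[of "\<lambda>n m. ell2_norm (v m) < q ^ n"] by metis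
    define z where "z = (\<lambda>n. twist (y (s n)) 0)"
    have zE: "z n \<in> E" for n unfolding z_def by (intro twist_in_E yE zero_c00)
    have nz: "N (z n) = ell2_norm (y (s n))" for n
      unfolding z_def by (simp add: N_twist yE zero_c00 ell2_norm_zero)
    have z: "N (psum (\<lambda>n. z (n + k)) a m) = L2_set (\<lambda>n. norm (a n) * ell2_norm (y (s (n + k)))) {..<m}" for a m k
    proof -
      have inj: "inj (\<lambda>n. s (n + k))" using s(1) by (auto simp: inj_def strict_mono_eq)
      \<comment> \<open>The zero sequence counts as disjoint, so the block estimates apply with all
        \<open>v n = 0\<close> and reduce to an equality.\<close>
      have dis: "disjoint_seq (\<lambda>n. y (s (n + k)))" "disjoint_seq (\<lambda>_. 0 :: nat \<Rightarrow> 'k)"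
        using disjoint_seq_comp[OF y(2) inj] by (simp_all add: comp_def disjoint_seq_def)
      show ?thesis
        using N_psum_twist_le[OF zero_c00 dis(2) yE dis(1), of a m] N_psum_twist_ge(3)[OF zero_c00 dis(2) yE dis(1), of a m]
        by (simp add: z_def ell2_norm_zero L2_set_def)
    qed
    have close': "N (w (r (s n)) - (\<omega> + z n)) \<le> (C * (M + 1)) * q ^ n" for n
    proof -
      let ?e = "w (r (s n)) - (\<omega> + twist (y (s n)) (v (s n)))"
      have eq: "w (r (s n)) - (\<omega> + z n) = ?e + twist 0 (v (s n))"
        by (simp add: z_def twist_def Omega_zero prod_eq_iff)
      have "N (w (r (s n)) - (\<omega> + z n)) \<le> C * (N ?e + N (twist 0 (v (s n))))"
        unfolding eq by (intro N_add E_closed wE r(2) tE twist_in_E ell2_zero v(1))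
      also have "\<dots> \<le> C * (M * q ^ n + q ^ n)"
        using close[of "s n"] mult_left_mono[OF qle[OF strict_mono_imp_increasing[OF s(1), of n]] M]
          s(2)[of n] N_twist_0[OF v(1)] C_pos by (intro mult_left_mono add_mono) auto
      finally show ?thesis by (simp add: algebra_simps)
    qed
    have y0: "0 \<le> ell2_norm (y n)" for n by (rule ell2_norm_ge_0[OF yE])
    have up: "L2_set (\<lambda>n. norm (a n) * ell2_norm (y (s (n + k)))) {..<m} \<le> R * L2_set (\<lambda>n. norm (a n)) {..<m}" for a :: "nat \<Rightarrow> 'k" and m k
    proof -
      have "L2_set (\<lambda>n. norm (a n) * ell2_norm (y (s (n + k)))) {..<m} \<le> L2_set (\<lambda>n. R * norm (a n)) {..<m}"
        using y(3) y0 by (intro L2_set_mono) (auto simp: mult.commute[of R] intro!: mult_left_mono)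
      then show ?thesis using r(3) L2_set_mult_left[of R "\<lambda>n. norm (a n)" "{..<m}"] by simp
    qed
    have "\<omega> = 0"
    proof (rule basic_sequence_weak_limit_0[OF complete basic nw _ r(2) zE close' _ log_len_const_tendsto])
      show "strict_mono (\<lambda>n. r (s n))" using r(1) s(1) by (simp add: strict_mono_def)
      \<comment> \<open>The \<open>ell2\<close> bound is weakened to \<open>log_len\<close>, so that
        the same \<open>o(m)\<close> function serves both cases.\<close>
      show "N (psum (\<lambda>n. z (n + k)) (\<lambda>_. 1) m) \<le> R * log_len (\<lambda>_. 1) m" for k m
        using order_trans[OF up[of "\<lambda>_. 1" k m] mult_left_mono[OF log_len_ge_L2]] r(3) unfolding z by simp
    qed
    with close' have close0: "N (w (r (s n)) - z n) \<le> (C * (M + 1)) * q ^ n" for n by (metis add_0)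
    \<comment> \<open>\<open>N (w (r (s n))) = 1\<close> is at most \<open>C\<close> times the error
      plus \<open>ell2_norm (y (s n))\<close>, so an error below \<open>1 / (2 * C)\<close> leaves
      the lower bound \<open>1 / (2 * C)\<close> for the \<open>y\<close>-block. This holds only for
      large \<open>n\<close>, hence the threshold \<open>k0\<close> in
      \<open>perturbation\<close>.\<close>
    have "\<forall>\<^sub>F n in sequentially. (C * (M + 1)) * q ^ n < 1 / (2 * C)"
      using order_tendstoD(2)[OF q_power_tendsto, of "1 / (2 * C)"] C_pos by simp
    then obtain k0 where k0: "\<And>n. n \<ge> k0 \<Longrightarrow> (C * (M + 1)) * q ^ n < 1 / (2 * C)"
      unfolding eventually_sequentially by blast
    have ylow: "1 / (2 * C) \<le> ell2_norm (y (s n))" if "n \<ge> k0" for n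
    proof -
      have "1 \<le> C * (N (w (r (s n)) - z n) + N (z n))" using N_le_N_diff[OF wE zE] nw by metis
      also have "\<dots> \<le> C * (1 / (2 * C) + ell2_norm (y (s n)))"
        using close0[of n] k0[OF that] nz C_pos by (intro mult_left_mono) auto
      also have "\<dots> = 1 / 2 + C * ell2_norm (y (s n))" using C_pos by (simp add: distrib_left)
      finally show ?thesis using C_pos by (simp add: field_simps)
    qed
    have zb: "1 / (2 * C) * L2_set (\<lambda>n. norm (a n)) {..<m} \<le> N (psum (\<lambda>n. z (n + k)) a m) \<and>
        N (psum (\<lambda>n. z (n + k)) a m) \<le> R * L2_set (\<lambda>n. norm (a n)) {..<m}" if "k \<ge> k0" for a m k
    proof -
      have "1 / (2 * C) * L2_set (\<lambda>n. norm (a n)) {..<m} = L2_set (\<lambda>n. 1 / (2 * C) * norm (a n)) {..<m}"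
        using L2_set_mult_left[of "1 / (2 * C)" "\<lambda>n. norm (a n)" "{..<m}"] C_pos by simp
      also have "\<dots> \<le> L2_set (\<lambda>n. norm (a n) * ell2_norm (y (s (n + k)))) {..<m}"
      proof (rule L2_set_mono)
        show "1 / (2 * C) * norm (a n) \<le> norm (a n) * ell2_norm (y (s (n + k)))" for n
          using mult_right_mono[OF ylow[of "n + k"], of "norm (a n)"] that by (simp add: mult.commute)
      qed (use C_pos in simp)
      finally show ?thesis using up unfolding z by blast
    qed
    have "0 < 1 / (2 * C)" using C_pos by simp
    note perturb = perturbation[OF wE zE close0 this r(3) zero_less_one,
        of "\<lambda>a m. L2_set (\<lambda>n. norm (a n)) {..<m}", OF _ L2_set_nonneg zb]
    have coeff: "norm (a n) \<le> 1 * L2_set (\<lambda>n. norm (a n)) {..<m}" if "n < m" for a :: "nat \<Rightarrow> 'k" and m n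
      using member_le_L2_set[of "{..<m}" n "\<lambda>n. norm (a n)"] that by simp
    obtain k A' B' where k: "0 < A'" "0 < B'"
      "\<And>a m. A' * L2_set (\<lambda>n. norm (a n)) {..<m} \<le> N (psum (\<lambda>n. w (r (s (n + k)))) a m) \<and>
         N (psum (\<lambda>n. w (r (s (n + k)))) a m) \<le> B' * L2_set (\<lambda>n. norm (a n)) {..<m}"
      by (rule perturb[OF coeff]) (assumption | rule that)+
    have mono: "strict_mono (\<lambda>n. r (s (n + k)))" using r(1) s(1) by (simp add: strict_mono_def)
    have "(\<lambda>n. ell2_norm (snd (w (r (s n))))) \<longlonglongrightarrow> 0"
    proof (rule tendsto_sandwich[where f="\<lambda>_. 0" and h="\<lambda>n. D * (C * (M + 1)) * q ^ n"])
      have "ell2_norm (snd (w (r (s n)))) \<le> D * (C * (M + 1)) * q ^ n" for n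
      proof -
        have "snd (z n) = 0" by (simp add: z_def twist_def)
        then have "ell2_norm (snd (w (r (s n)))) \<le> D * N (w (r (s n)) - z n)"
          using snd_le[OF E_closed(3)[OF wE zE], of "r (s n)" n] by simp
        also have "\<dots> \<le> D * ((C * (M + 1)) * q ^ n)" using close0 D_nonneg by (intro mult_left_mono)
        finally show ?thesis by (simp add: mult.assoc)
      qed
      then show "\<forall>\<^sub>F n in sequentially. ell2_norm (snd (w (r (s n)))) \<le> D * (C * (M + 1)) * q ^ n"
        by (rule always_eventually[OF allI])
    qed (use q_power_tendsto ell2_norm_ge_0[OF snd_ell2[OF wE]] in auto)
    from LIMSEQ_ignore_initial_segment[OF this, of k]
    show ?thesis using that[OF mono k(1,2)] k(3) by (auto simp: comp_def)
  qed
qed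

end

section \<open>From the completion predicate to the theorem\<close>

lemma is_Z_twisted_sum:
  fixes \<phi> :: "real \<Rightarrow> 'k::{real_normed_field,banach,heine_borel}"
  assumes "bi_lipschitz_half_line \<phi>" and "is_Z \<phi> E N"
  obtains C \<alpha> \<beta> D where "twisted_sum E N C \<phi> \<alpha> \<beta> D"
proof -
  have Z: "quasi_normed_space pair_scale E N" "quasi_norm_complete E N" "ell2 \<times> c00 \<subseteq> E"
    "\<And>z. z \<in> ell2 \<times> c00 \<Longrightarrow> N z = phi_norm \<phi> z"
    "\<And>z e. z \<in> E \<Longrightarrow> e > 0 \<Longrightarrow> \<exists>z'\<in>ell2 \<times> c00. N (z - z') < e"
    using assms(2) unfolding is_Z_def by auto
  obtain D where D: "\<And>z. z \<in> E \<Longrightarrow> snd z \<in> ell2 \<and> ell2_norm (snd z) \<le> D * N z"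
    using assms(2) unfolding is_Z_def by blast
  obtain \<alpha> \<beta> where lip: "0 < \<alpha>" "0 < \<beta>" "\<And>s t. 0 \<le> s \<Longrightarrow> 0 \<le> t \<Longrightarrow>
      \<beta> * \<bar>s - t\<bar> \<le> norm (\<phi> s - \<phi> t) \<and> norm (\<phi> s - \<phi> t) \<le> \<alpha> * \<bar>s - t\<bar>"
    using assms(1) unfolding bi_lipschitz_half_line_def by auto
  have Q: "vector_space (pair_scale :: 'k \<Rightarrow> _)" "module.subspace pair_scale E"
    "\<And>x. x \<in> E \<Longrightarrow> 0 \<le> N x" "\<And>x. x \<in> E \<Longrightarrow> N x = 0 \<longleftrightarrow> x = 0"
    "\<And>c x. x \<in> E \<Longrightarrow> N (pair_scale c x) = norm c * N x"
    using Z(1) unfolding quasi_normed_space_def by auto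
  obtain C where "\<forall>x\<in>E. \<forall>y\<in>E. N (x + y) \<le> C * (N x + N y)"
    using Z(1) unfolding quasi_normed_space_def by (elim conjE exE)
  then have C: "N (x + y) \<le> C * (N x + N y)" if "x \<in> E" "y \<in> E" for x y
    using that by blast
  \<comment> \<open>Since \<open>N\<close> is nonnegative on \<open>E\<close>, both constants may be
    enlarged to meet the sign conditions of the locales.\<close>
  have "N (x + y) \<le> max C 1 * (N x + N y)" if "x \<in> E" "y \<in> E" for x y
    using C[OF that] Q(3)[OF that(1)] Q(3)[OF that(2)] mult_right_mono[of C "max C 1" "N x + N y"] by simp
  moreover have "ell2_norm (snd z) \<le> max D 0 * N z" if "z \<in> E" for z
    using D[OF that] Q(3)[OF that] mult_right_mono[of D "max D 0" "N z"] by simp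
  ultimately have "twisted_sum E N (max C 1) \<phi> \<alpha> \<beta> (max D 0)"
    using Z Q lip D
    by (intro twisted_sum.intro quasi_normed.intro quasi_normed_axioms.intro twisted_sum_axioms.intro) auto
  then show ?thesis by (rule that)
qed

text \<open>A positive infimum of the norms of the second coordinates contradicts the limit clause
  of the \<open>ell2\<close> alternative, which leaves only the Orlicz alternative.\<close>

lemma Z_stability:
  fixes \<phi> :: "real \<Rightarrow> 'k::{real_normed_field,banach,heine_borel}"
  assumes \<Phi>: "orlicz_function \<Phi>" "\<Phi> \<in> \<Theta>[at_right 0](\<lambda>t. t\<^sup>2 * (ln t)\<^sup>2)"
    and "bi_lipschitz_half_line \<phi>" and "is_Z \<phi> E N"
  shows "orlicz_stable \<Phi> pair_scale E N \<and>
    (\<forall>w. normalized_basic_sequence pair_scale E N w \<and> (INF n. ell2_norm (snd (w n))) > 0 \<longrightarrow>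
       (\<exists>r. strict_mono r \<and> equivalent_to_orlicz_basis \<Phi> pair_scale N (w \<circ> r)))"
proof -
  obtain C \<alpha> \<beta> D where "twisted_sum E N C \<phi> \<alpha> \<beta> D"
    using is_Z_twisted_sum[OF assms(3,4)] by blast
  then interpret twisted_sum E N C \<phi> \<alpha> \<beta> D .
  obtain A0 B0 where orl: "A0 > 0" "B0 > 0"
    "\<forall>(a :: nat \<Rightarrow> 'k) m.
       A0 * log_len (\<lambda>n. norm (a n)) m \<le> orlicz_norm \<Phi> (\<Sum>n<m. seq_scale (a n) (unit_seq n)) \<and>
       orlicz_norm \<Phi> (\<Sum>n<m. seq_scale (a n) (unit_seq n)) \<le> B0 * log_len (\<lambda>n. norm (a n)) m"
    by (rule orlicz_norm_log_len[OF \<Phi>, where 'k='k]) (rule that; assumption)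
  have main: "\<exists>r. strict_mono r \<and> (equivalent_to_orlicz_basis \<Phi> pair_scale N (w \<circ> r) \<or>
      equivalent_to_ell2_basis pair_scale N (w \<circ> r) \<and> (\<lambda>n. ell2_norm (snd (w (r n)))) \<longlonglongrightarrow> 0)"
    if w: "normalized_basic_sequence pair_scale E N w" for w
  proof -
    obtain r A B where r: "strict_mono r" and AB: "0 < A" "0 < B" and alt:
      "(\<forall>a m. A * log_len (\<lambda>n. norm (a n)) m \<le> N (psum (w \<circ> r) a m) \<and>
          N (psum (w \<circ> r) a m) \<le> B * log_len (\<lambda>n. norm (a n)) m) \<or>
       (\<forall>a m. A * L2_set (\<lambda>n. norm (a n)) {..<m} \<le> N (psum (w \<circ> r) a m) \<and>
          N (psum (w \<circ> r) a m) \<le> B * L2_set (\<lambda>n. norm (a n)) {..<m}) \<and>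
       (\<lambda>n. ell2_norm (snd (w (r n)))) \<longlonglongrightarrow> 0"
      by (rule basic_sequence_dichotomy[OF \<Phi> w]) (rule that; assumption)
    from alt show ?thesis
    proof (elim disjE conjE)
      assume H: "\<forall>a m. A * log_len (\<lambda>n. norm (a n)) m \<le> N (psum (w \<circ> r) a m) \<and>
          N (psum (w \<circ> r) a m) \<le> B * log_len (\<lambda>n. norm (a n)) m"
      have pos: "0 < A / B0" "0 < B / A0" using AB orl by auto
      have "A / B0 * orlicz_norm \<Phi> (\<Sum>n<m. seq_scale (a n) (unit_seq n)) \<le> N (psum (w \<circ> r) a m) \<and>
        N (psum (w \<circ> r) a m) \<le> B / A0 * orlicz_norm \<Phi> (\<Sum>n<m. seq_scale (a n) (unit_seq n))" for a m
      proof
        let ?o = "orlicz_norm \<Phi> (\<Sum>n<m. seq_scale (a n) (unit_seq n))" and ?l = "log_len (\<lambda>n. norm (a n)) m"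
        have "A / B0 * ?o \<le> A / B0 * (B0 * ?l)" using orl pos by (intro mult_left_mono) auto
        also have "\<dots> \<le> N (psum (w \<circ> r) a m)" using H orl(2) by simp
        finally show "A / B0 * ?o \<le> N (psum (w \<circ> r) a m)" .
        have "N (psum (w \<circ> r) a m) \<le> B / A0 * (A0 * ?l)" using H orl(1) by simp
        also have "\<dots> \<le> B / A0 * ?o" using orl pos by (intro mult_left_mono) auto
        finally show "N (psum (w \<circ> r) a m) \<le> B / A0 * ?o" .
      qed
      with pos have "equivalent_to_orlicz_basis \<Phi> pair_scale N (w \<circ> r)"
        unfolding equivalent_to_orlicz_basis_def equivalent_sequences_def psum_def[symmetric] by blast
      with r show ?thesis by blast
    next
      assume "\<forall>a m. A * L2_set (\<lambda>n. norm (a n)) {..<m} \<le> N (psum (w \<circ> r) a m) \<and>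
          N (psum (w \<circ> r) a m) \<le> B * L2_set (\<lambda>n. norm (a n)) {..<m}"
        and lim: "(\<lambda>n. ell2_norm (snd (w (r n)))) \<longlonglongrightarrow> 0"
      then have "equivalent_to_ell2_basis pair_scale N (w \<circ> r)"
        unfolding equivalent_to_ell2_basis_def equivalent_sequences_def psum_def[symmetric]
          ell2_norm_sum_unit_seq using AB by blast
      with r lim show ?thesis by blast
    qed
  qed
  have "orlicz_stable \<Phi> pair_scale E N" using main unfolding orlicz_stable_def by blast
  moreover have "\<exists>r. strict_mono r \<and> equivalent_to_orlicz_basis \<Phi> pair_scale N (w \<circ> r)"
    if w: "normalized_basic_sequence pair_scale E N w" and pos: "(INF n. ell2_norm (snd (w n))) > 0" for w
  proof -
    have wE: "w n \<in> E" for n using w by (auto simp: normalized_basic_sequence_def basic_sequence_def)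
    \<comment> \<open>On the reals \<open>INF\<close> is known to lie below its terms only for a set
      that is bounded below.\<close>
    have "bdd_below (range (\<lambda>n. ell2_norm (snd (w n))))"
      using ell2_norm_ge_0[OF snd_ell2[OF wE]] by (auto intro!: bdd_belowI[of _ 0])
    then have le: "(INF n. ell2_norm (snd (w n))) \<le> ell2_norm (snd (w (r n)))" for r :: "nat \<Rightarrow> nat" and n
      by (rule cINF_lower) simp
    have "(INF n. ell2_norm (snd (w n))) \<le> 0" if "(\<lambda>n. ell2_norm (snd (w (r n)))) \<longlonglongrightarrow> 0" for r
      by (rule LIMSEQ_le_const[OF that]) (use le in blast)
    then have "\<not> (\<lambda>n. ell2_norm (snd (w (r n)))) \<longlonglongrightarrow> 0" for r
      using pos by fastforce
    then show ?thesis using main[OF w] by blast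
  qed
  ultimately show ?thesis by blast
qed

theorem theorem3p2:
  fixes \<Phi> :: "real \<Rightarrow> real"
  assumes "orlicz_function \<Phi>"
    and "\<Phi> \<in> \<Theta>[at_right 0](\<lambda>t. t\<^sup>2 * (ln t)\<^sup>2)"
  shows
    "(\<forall>\<phi>\<in>Lbi_real. \<forall>E N. is_Z \<phi> E N \<longrightarrow>
        orlicz_stable \<Phi> pair_scale E N \<and>
        (\<forall>w. normalized_basic_sequence pair_scale E N w \<and> (INF n. ell2_norm (snd (w n))) > 0 \<longrightarrow>
           (\<exists>r. strict_mono r \<and> equivalent_to_orlicz_basis \<Phi> pair_scale N (w \<circ> r)))) \<and>
     (\<forall>\<phi>\<in>Lbi_complex. \<forall>E N. is_Z \<phi> E N \<longrightarrow>
        orlicz_stable \<Phi> pair_scale E N \<and>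
        (\<forall>w. normalized_basic_sequence pair_scale E N w \<and> (INF n. ell2_norm (snd (w n))) > 0 \<longrightarrow>
           (\<exists>r. strict_mono r \<and> equivalent_to_orlicz_basis \<Phi> pair_scale N (w \<circ> r))))"
proof (intro conjI ballI allI impI)
  fix \<phi> E N assume "\<phi> \<in> Lbi_real" "is_Z \<phi> E N"
  then show "orlicz_stable \<Phi> pair_scale E N"
    using Z_stability[OF assms, of \<phi> E N] by (simp add: Lbi_real_def)
next
  fix \<phi> E N w
  assume "\<phi> \<in> Lbi_real" "is_Z \<phi> E N"
    "normalized_basic_sequence pair_scale E N w \<and> (INF n. ell2_norm (snd (w n))) > 0"
  then show "\<exists>r. strict_mono r \<and> equivalent_to_orlicz_basis \<Phi> pair_scale N (w \<circ> r)"
    using Z_stability[OF assms, of \<phi> E N] by (simp add: Lbi_real_def)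
next
  fix \<phi> E N assume "\<phi> \<in> Lbi_complex" "is_Z \<phi> E N"
  then show "orlicz_stable \<Phi> pair_scale E N"
    using Z_stability[OF assms, of \<phi> E N] by (simp add: Lbi_complex_def)
next
  fix \<phi> E N w
  assume "\<phi> \<in> Lbi_complex" "is_Z \<phi> E N"
    "normalized_basic_sequence pair_scale E N w \<and> (INF n. ell2_norm (snd (w n))) > 0"
  then show "\<exists>r. strict_mono r \<and> equivalent_to_orlicz_basis \<Phi> pair_scale N (w \<circ> r)"
    using Z_stability[OF assms, of \<phi> E N] by (simp add: Lbi_complex_def)
qed

end
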